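(* Consider the functional factor model and functional PCA estimator described in the context. Assume the following. (a) $\|\mathcal B_{ij}\|\le C_B$ uniformly over $i$ and $j$, with $C_B$ a positive constant. (b) There exist a positive definite matrix $\boldsymbol\Sigma_\Lambda$ with eigenvalues bounded away from zero and infinity and some $\kappa>0$ such that $\left\|\frac1N\sum_{i=1}^N\int_{\mathbb C_i}\Lambda_i(u)\Lambda_i(u)^\top du-\boldsymbol\Sigma_\Lambda\right\|=o(q^{-\kappa})$ as $N\to\infty$. (c) $\left\|\frac1{T^2}\sum_{s=1}^TG_sG_s^\top-\int_0^1B_\xi(u)B_\xi(u)^\top du\right\|=o_P(q^{-\kappa})$ as $T\to\infty$, where $B_\xi(\cdot)$ is a $q$-vector Brownian motion with positive definite covariance matrix $\boldsymbol\Sigma_\xi=\lim_{T\to\infty}\frac1T\sum_{t=1}^T\sum_{s=1}^T\mathsf E(\xi_t\xi_s^\top)$. (d) Let $\nu_{i,0}$ be the $i$-th largest eigenvalue of $\boldsymbol\Sigma_\Lambda^{1/2}\left(\int_0^1B_\xi(u)B_\xi(u)^\top du\right)\boldsymbol\Sigma_\Lambda^{1/2}$ and $\iota_{q,0}=\min_{1\le i\le q-1}(\nu_{i,0}-\nu_{i+1,0})$. There exist deterministic $\overline\nu_q,\underline\nu_q,\underline\iota_q$ such that $\mathsf P(\underline\nu_q\le\nu_{q,0}<\nu_{1,0}\le\overline\nu_q,\ \iota_{q,0}\ge\underline\iota_q)\to1$, $q^{-\kappa}(\overline\nu_q/\underline\nu_q)^2=O(1)$, and $\underline\iota_q^{-1}q^{1-\kappa}\overline\nu_q^{3/2}\underline\nu_q^{-1/2}=O(1)$.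 In addition, $q=O(T^{1/(2\kappa+1)})$. (e) $\{\varepsilon_{it}\}$ is independent of $\{\xi_t\}$ and $\{\eta_{jt}\}$; the $\varepsilon_{it}$ are mean-zero random functions and $\max_{1\le i\le N}\max_{1\le t\le T}\mathsf E\|\varepsilon_{it}\|^4<\infty$. (f) There exist $\delta_q$ and $\{\delta_{t,q}\}$ such that $\max_{1\le j\le k}\mathsf E\|\eta_{jt}\|^2\le\delta_{t,q}^2$, $\max_{1\le t\le T}\delta_{t,q}\to0$ and $\frac1T\sum_{t=1}^T\delta_{t,q}^2=O(\delta_q^2)$. (g) With $\zeta_N(s,t)=\frac1N\sum_{i=1}^N\mathsf E\langle\varepsilon_{it},\varepsilon_{is}\rangle$, there is a constant $C_\varepsilon>0$ such that $\max_{1\le t\le T}|\zeta_N(t,t)|\le C_\varepsilon$, $\sum_{s=1}^T|\zeta_N(s,t)|\le C_\varepsilon$ for all $1\le t\le T$, and $\mathsf E\left(\sum_{i=1}^N\{\langle\varepsilon_{it},\varepsilon_{is}\rangle-\mathsf E\langle\varepsilon_{it},\varepsilon_{is}\rangle\}\right)^2\le C_\varepsilon N$ for all $1\le s,t\le T$. (h) For any deterministic functions $h_i\in\mathscr H_i$, $\mathsf E\left(\sum_{i=1}^N\langle h_i,\varepsilon_{it}\rangle\right)^2\propto\sum_{i=1}^N\|h_i\|^2$. If in addition $$\underline\nu_q^{-2}q\left(T^{-2}+q\overline\nu_qN^{-1}+q\overline\nu_q\delta_q^2\right)=o(1),$$ then $$\frac1T\sum_{t=1}^T\left\|\widetilde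 G_t-\boldsymbol H_{NT}G_t\right\|^2=O_P\left(\underline\nu_q^{-2}q\left(T^{-2}+q\overline\nu_qN^{-1}+q\overline\nu_q\delta_q^2\right)\right).$$
   Context: Notation and asymptotics. $N,T\to\infty$ jointly; $k$ is a fixed positive integer; $q$ is a positive integer (known to the estimator) which may be fixed or diverge slowly to infinity. $\mathbb C_i$ ($1\le i\le N$) and $\mathbb C_j^\ast$ ($1\le j\le k$) are bounded sets, and $\mathscr H_i$, $\mathscr H_j^\ast$ are the Hilbert spaces of real square-integrable functions on them, with $\langle f,g\rangle=\int fg$ and $\|f\|=\langle f,f\rangle^{1/2}$. $\|\cdot\|$ also denotes the Euclidean norm of a vector and the operator norm of a matrix or linear operator. $a\propto b$ means $\underline c\le a/b\le\overline c$ for some constants $0<\underline c\le\overline c<\infty$. Model. Observed random functions $Z_{it}\in\mathscr H_i$ ($1\le i\le N$, $1\le t\le T$) satisfy $Z_{it}(u)=\sum_{j=1}^k\mathcal B_{ij}F_{jt}(u)+\varepsilon_{it}(u)$, where $\mathcal B_{ij}:\mathscr H_j^\ast\to\mathscr H_i$ is the integral operator $\mathcal B_{ij}f(u)=\int_{\mathbb C_j^\ast}B_{ij}(u,v)f(v)dv$ with deterministic kernel $B_{ij}$, and $F_{jt}(u)=\Phi_j(u)^\top G_t+\eta_{jt}(u)$, where $\Phi_j=(\phi_{j1},\dots,\phi_{jq})^\top$ is a vector of deterministic basis functions in $\mathscr H_j^\ast$, $\eta_{jt}$ is a random approximation error in $\mathscr H_j^\ast$, and $G_t$ is a $q$-dimensional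 real random vector with $G_t-G_{t-1}=\xi_t$, $\{\xi_t\}$ a sequence of stationary $I(0)$ random vectors, and initial value satisfying $\max_{1\le j\le q}|G_{j0}|=O_P(1)$. Put $\Lambda_i=\sum_{j=1}^k\mathcal B_{ij}\Phi_j$ (applied componentwise; a $q$-vector of functions on $\mathbb C_i$) and $\chi_{it}^\eta=\sum_{j=1}^k\mathcal B_{ij}\eta_{jt}$, so that $Z_{it}=\Lambda_i^\top G_t+\chi_{it}^\eta+\varepsilon_{it}$. Estimator. $\widetilde{\boldsymbol\Omega}$ is the $T\times T$ matrix with entries $\widetilde\Omega_{ts}=\frac1N\sum_{i=1}^N\int_{\mathbb C_i}Z_{it}(u)Z_{is}(u)du$. $\widetilde{\boldsymbol G}=(\widetilde G_1,\dots,\widetilde G_T)^\top$ is the $T\times q$ matrix whose columns are $T$ times orthonormal eigenvectors of $\widetilde{\boldsymbol\Omega}$ for its $q$ largest eigenvalues (so $T^{-2}\widetilde{\boldsymbol G}^\top\widetilde{\boldsymbol G}=\boldsymbol I_q$). $\boldsymbol G=(G_1,\dots,G_T)^\top$. $\boldsymbol V_{NT}$ is the $q\times q$ diagonal matrix of the $q$ largest eigenvalues of $\frac1{T^2}\widetilde{\boldsymbol\Omega}$ in decreasing order, and $$\boldsymbol H_{NT}=\boldsymbol V_{NT}^{-1}\left(\frac1{T^2}\widetilde{\boldsymbol G}^\top\boldsymbol G\right)\left[\frac1N\sum_{i=1}^N\int_{\mathbb C_i}\Lambda_i(u)\Lambda_i(u)^\top du\right].$$ *)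

theory Defs
  imports
    "HOL-Probability.Probability"
    "HOL-Library.Landau_Symbols"
    "Jordan_Normal_Form.Char_Poly"
    "Jordan_Normal_Form.Gauss_Jordan_Elimination"
begin

text \<open>The joint limit: both sample sizes tend to infinity, without restriction on their
  relative rates.\<close>

abbreviation NT_lim :: "(nat \<times> nat) filter" where
  "NT_lim \<equiv> sequentially \<times>\<^sub>F sequentially"

text \<open>Stochastic orders. For measurable \<open>X n\<close> the inner set \<open>A\<close> can be taken to be the event
  \<open>\<bar>X n\<bar> \<le> K * a n\<close> itself, so these are the usual notions; for a map whose measurability is not
  assumed (such as a selection of eigenvectors) they bound the outer probability of the
  complementary event.\<close>

definition bigO_P :: "'w measure \<Rightarrow> 'n filter \<Rightarrow> ('n \<Rightarrow> 'w \<Rightarrow> real) \<Rightarrow> ('n \<Rightarrow> real) \<Rightarrow> bool" where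
  "bigO_P M F X a \<longleftrightarrow>
     (\<forall>e>0. \<exists>K. \<forall>\<^sub>F n in F. \<exists>A\<in>sets M. measure M A \<ge> 1 - e \<and> (\<forall>w\<in>A. \<bar>X n w\<bar> \<le> K * a n))"

definition smallo_P :: "'w measure \<Rightarrow> 'n filter \<Rightarrow> ('n \<Rightarrow> 'w \<Rightarrow> real) \<Rightarrow> ('n \<Rightarrow> real) \<Rightarrow> bool" where
  "smallo_P M F X a \<longleftrightarrow>
     (\<forall>d>0. \<forall>e>0. \<forall>\<^sub>F n in F. \<exists>A\<in>sets M. measure M A \<ge> 1 - e \<and> (\<forall>w\<in>A. \<bar>X n w\<bar> \<le> d * a n))"

text \<open>Elements of the Hilbert space over a set are represented by functions; only their
  almost-everywhere class on the set matters.\<close>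

definition L2 :: "'u::euclidean_space set \<Rightarrow> ('u \<Rightarrow> real) set" where
  "L2 S = {f \<in> borel_measurable (lebesgue_on S). integrable (lebesgue_on S) (\<lambda>u. (f u)\<^sup>2)}"

definition L2_inner :: "'u::euclidean_space set \<Rightarrow> ('u \<Rightarrow> real) \<Rightarrow> ('u \<Rightarrow> real) \<Rightarrow> real" where
  "L2_inner S f g = (LINT u|lebesgue_on S. f u * g u)"

definition L2_norm :: "'u::euclidean_space set \<Rightarrow> ('u \<Rightarrow> real) \<Rightarrow> real" where
  "L2_norm S f = sqrt (L2_inner S f f)"

definition int_op :: "'v::euclidean_space set \<Rightarrow> ('u \<Rightarrow> 'v \<Rightarrow> real) \<Rightarrow> ('v \<Rightarrow> real) \<Rightarrow> 'u \<Rightarrow> real" where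
  "int_op S' K f u = (LINT v|lebesgue_on S'. K u v * f v)"

definition L2_integral_operator ::
  "'v::euclidean_space set \<Rightarrow> 'u::euclidean_space set \<Rightarrow> ('u \<Rightarrow> 'v \<Rightarrow> real) \<Rightarrow> bool" where
  "L2_integral_operator S' S K \<longleftrightarrow>
     (\<lambda>(u, v). K u v) \<in> borel_measurable (lebesgue_on S \<Otimes>\<^sub>M lebesgue_on S') \<and>
     (\<forall>f\<in>L2 S'. (AE u in lebesgue_on S. integrable (lebesgue_on S') (\<lambda>v. K u v * f v)) \<and>
                int_op S' K f \<in> L2 S)"

text \<open>The operator norm takes values in \<open>[0, \<infinity>]\<close>, so that an upper bound on it asserts boundedness.\<close>

definition L2_opnorm ::
  "'v::euclidean_space set \<Rightarrow> 'u::euclidean_space set \<Rightarrow> (('v \<Rightarrow> real) \<Rightarrow> 'u \<Rightarrow> real) \<Rightarrow> ennreal" where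
  "L2_opnorm S' S A = (SUP f\<in>{f \<in> L2 S'. L2_norm S' f \<le> 1}. ennreal (L2_norm S (A f)))"

definition random_L2 :: "'w measure \<Rightarrow> 'u::euclidean_space set \<Rightarrow> ('w \<Rightarrow> 'u \<Rightarrow> real) \<Rightarrow> bool" where
  "random_L2 M S X \<longleftrightarrow>
     (\<lambda>(w, u). X w u) \<in> borel_measurable (M \<Otimes>\<^sub>M lebesgue_on S) \<and> (\<forall>w\<in>space M. X w \<in> L2 S)"

definition mean_zero_L2 :: "'w measure \<Rightarrow> 'u::euclidean_space set \<Rightarrow> ('w \<Rightarrow> 'u \<Rightarrow> real) \<Rightarrow> bool" where
  "mean_zero_L2 M S X \<longleftrightarrow>
     (AE u in lebesgue_on S. integrable M (\<lambda>w. X w u) \<and> (LINT w|M. X w u) = 0)"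

text \<open>The events determined by a single random function or random variable: the Borel
  \<open>\<sigma>\<close>-algebra of a separable Hilbert space is generated by the functionals \<open>\<langle>h, \<cdot>\<rangle>\<close>.\<close>

definition L2_events :: "'w measure \<Rightarrow> 'u::euclidean_space set \<Rightarrow> ('w \<Rightarrow> 'u \<Rightarrow> real) \<Rightarrow> 'w set set" where
  "L2_events M S X =
     {(\<lambda>w. L2_inner S h (X w)) -` A \<inter> space M | h A. h \<in> L2 S \<and> A \<in> sets borel}"

definition real_events :: "'w measure \<Rightarrow> ('w \<Rightarrow> real) \<Rightarrow> 'w set set" where
  "real_events M X = {X -` A \<inter> space M | A. A \<in> sets borel}"

definition vnorm :: "real vec \<Rightarrow> real" where
  "vnorm v = sqrt (scalar_prod v v)"

definition mat_opnorm :: "real mat \<Rightarrow> real" where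
  "mat_opnorm A = (SUP v\<in>{v \<in> carrier_vec (dim_col A). vnorm v \<le> 1}. vnorm (A *\<^sub>v v))"

definition psd_mat :: "nat \<Rightarrow> real mat \<Rightarrow> bool" where
  "psd_mat n A \<longleftrightarrow> A \<in> carrier_mat n n \<and> transpose_mat A = A \<and>
     (\<forall>v\<in>carrier_vec n. scalar_prod v (A *\<^sub>v v) \<ge> 0)"

definition pd_mat :: "nat \<Rightarrow> real mat \<Rightarrow> bool" where
  "pd_mat n A \<longleftrightarrow> A \<in> carrier_mat n n \<and> transpose_mat A = A \<and>
     (\<forall>v\<in>carrier_vec n. v \<noteq> 0\<^sub>v n \<longrightarrow> scalar_prod v (A *\<^sub>v v) > 0)"

definition psd_sqrt :: "real mat \<Rightarrow> real mat" where
  "psd_sqrt A = (THE S. psd_mat (dim_row A) S \<and> S * S = A)"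

text \<open>\<open>eig A i\<close> is the \<open>i\<close>-th largest eigenvalue, counted from \<open>1\<close> and with multiplicity; it is used
  for symmetric matrices only, whose characteristic polynomial splits over the reals.\<close>

definition eig :: "real mat \<Rightarrow> nat \<Rightarrow> real" where
  "eig A i = rev (sorted_list_of_multiset (proots (char_poly A))) ! (i - 1)"

text \<open>Covariance stationarity of the sequence \<open>(\<xi>\<^sub>t)\<close>, \<open>t \<ge> 1\<close>, of \<open>q\<close>-vectors. Components of vectors
  are indexed from \<open>0\<close>, and \<open>\<xi> l t\<close> is the \<open>l\<close>-th component at time \<open>t\<close>.\<close>

definition cov_stationary :: "'w measure \<Rightarrow> nat \<Rightarrow> (nat \<Rightarrow> nat \<Rightarrow> 'w \<Rightarrow> real) \<Rightarrow> bool" where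
  "cov_stationary M q \<xi> \<longleftrightarrow>
     (\<forall>l<q. \<forall>t\<ge>1. \<xi> l t \<in> borel_measurable M \<and> integrable M (\<lambda>w. (\<xi> l t w)\<^sup>2) \<and>
        (LINT w|M. \<xi> l t w) = (LINT w|M. \<xi> l 1 w)) \<and>
     (\<forall>l<q. \<forall>m<q. \<forall>s\<ge>1. \<forall>t\<ge>1. \<forall>h.
        (LINT w|M. \<xi> l (s + h) w * \<xi> m (t + h) w) = (LINT w|M. \<xi> l s w * \<xi> m t w))"

definition long_run_cov ::
  "'w measure \<Rightarrow> nat \<Rightarrow> (nat \<Rightarrow> nat \<Rightarrow> 'w \<Rightarrow> real) \<Rightarrow> real mat \<Rightarrow> bool" where
  "long_run_cov M q \<xi> \<Sigma> \<longleftrightarrow> \<Sigma> \<in> carrier_mat q q \<and>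
     (\<forall>l<q. \<forall>m<q.
        (\<lambda>T. (\<Sum>t=1..T. \<Sum>s=1..T. (LINT w|M. \<xi> l t w * \<xi> m s w)) / real T)
          \<longlonglongrightarrow> \<Sigma> $$ (l, m))"

text \<open>A \<open>q\<close>-dimensional Brownian motion on \<open>[0, 1]\<close> with positive definite covariance matrix \<open>\<Sigma>\<close>;
  joint normality of the increments is expressed through their linear combinations.\<close>

definition brownian_motion ::
  "'w measure \<Rightarrow> nat \<Rightarrow> real mat \<Rightarrow> (real \<Rightarrow> 'w \<Rightarrow> nat \<Rightarrow> real) \<Rightarrow> bool" where
  "brownian_motion M q \<Sigma> W \<longleftrightarrow>
     (\<forall>u\<in>{0..1}. \<forall>l<q. (\<lambda>w. W u w l) \<in> borel_measurable M) \<and>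
     (AE w in M. \<forall>l<q. W 0 w l = 0 \<and> continuous_on {0..1} (\<lambda>u. W u w l)) \<and>
     (\<forall>n r. (\<forall>m\<le>n. r m \<in> {0..1}) \<longrightarrow> (\<forall>m<n. r m \<le> r (Suc m)) \<longrightarrow>
        prob_space.indep_vars M (\<lambda>_. PiM {..<q} (\<lambda>_. borel :: real measure))
          (\<lambda>m w. \<lambda>l\<in>{..<q}. W (r (Suc m)) w l - W (r m) w l) {..<n::nat}) \<and>
     (\<forall>s t a. 0 \<le> s \<longrightarrow> s < t \<longrightarrow> t \<le> 1 \<longrightarrow> (\<exists>l<q. a l \<noteq> 0) \<longrightarrow>
        distributed M lborel (\<lambda>w. \<Sum>l<q. a l * (W t w l - W s w l))
          (\<lambda>x. ennreal (normal_density 0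
             (sqrt ((t - s) * (\<Sum>l<q. \<Sum>m<q. a l * a m * \<Sigma> $$ (l, m)))) x)))"

definition BB_integral :: "nat \<Rightarrow> (real \<Rightarrow> 'w \<Rightarrow> nat \<Rightarrow> real) \<Rightarrow> 'w \<Rightarrow> real mat" where
  "BB_integral q W w = mat q q (\<lambda>(l, m). LINT u|lebesgue_on {0..1}. W u w l * W u w m)"

definition Lambda ::
  "nat \<Rightarrow> (nat \<Rightarrow> 'v::euclidean_space set) \<Rightarrow> (nat \<Rightarrow> nat \<Rightarrow> 'u \<Rightarrow> 'v \<Rightarrow> real) \<Rightarrow>
   (nat \<Rightarrow> nat \<Rightarrow> 'v \<Rightarrow> real) \<Rightarrow> nat \<Rightarrow> nat \<Rightarrow> 'u \<Rightarrow> real" where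
  "Lambda k Cs B \<phi> i l u = (\<Sum>j=1..k. int_op (Cs j) (B i j) (\<phi> j l) u)"

definition loading_gram ::
  "(nat \<Rightarrow> 'u::euclidean_space set) \<Rightarrow> nat \<Rightarrow> nat \<Rightarrow> (nat \<Rightarrow> nat \<Rightarrow> 'u \<Rightarrow> real) \<Rightarrow> real mat" where
  "loading_gram C N q \<Lambda> =
     mat q q (\<lambda>(l, m). (\<Sum>i=1..N. L2_inner (C i) (\<Lambda> i l) (\<Lambda> i m)) / real N)"

definition G_vec :: "nat \<Rightarrow> (nat \<Rightarrow> nat \<Rightarrow> 'w \<Rightarrow> real) \<Rightarrow> nat \<Rightarrow> 'w \<Rightarrow> real vec" where
  "G_vec q G t w = vec q (\<lambda>l. G l t w)"

text \<open>In matrices with \<open>T\<close> rows, row \<open>a\<close> (counted from \<open>0\<close>) belongs to time \<open>a + 1\<close>.\<close>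

definition G_mat :: "nat \<Rightarrow> nat \<Rightarrow> (nat \<Rightarrow> nat \<Rightarrow> 'w \<Rightarrow> real) \<Rightarrow> 'w \<Rightarrow> real mat" where
  "G_mat T q G w = mat T q (\<lambda>(a, l). G l (a + 1) w)"

definition Omega_tilde ::
  "(nat \<Rightarrow> 'u::euclidean_space set) \<Rightarrow> nat \<Rightarrow> nat \<Rightarrow> (nat \<Rightarrow> nat \<Rightarrow> 'w \<Rightarrow> 'u \<Rightarrow> real) \<Rightarrow> 'w \<Rightarrow> real mat" where
  "Omega_tilde C N T Z w =
     mat T T (\<lambda>(a, b). (\<Sum>i=1..N. L2_inner (C i) (Z i (a + 1) w) (Z i (b + 1) w)) / real N)"

definition fpca_factors :: "nat \<Rightarrow> nat \<Rightarrow> real mat \<Rightarrow> real mat \<Rightarrow> bool" where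
  "fpca_factors T q \<Omega> Gt \<longleftrightarrow> Gt \<in> carrier_mat T q \<and>
     (\<exists>e. (\<forall>i<q. e i \<in> carrier_vec T \<and> \<Omega> *\<^sub>v e i = eig \<Omega> (i + 1) \<cdot>\<^sub>v e i \<and>
                 col Gt i = real T \<cdot>\<^sub>v e i) \<and>
          (\<forall>i<q. \<forall>j<q. scalar_prod (e i) (e j) = (if i = j then 1 else 0)))"

definition V_mat :: "nat \<Rightarrow> nat \<Rightarrow> real mat \<Rightarrow> real mat" where
  "V_mat T q \<Omega> = mat_diag q (\<lambda>i. eig ((1 / (real T)\<^sup>2) \<cdot>\<^sub>m \<Omega>) (i + 1))"

text \<open>The rotation matrix; it is unspecified when \<open>V\<close> is singular.\<close>

definition H_mat :: "nat \<Rightarrow> real mat \<Rightarrow> real mat \<Rightarrow> real mat \<Rightarrow> real mat \<Rightarrow> real mat" where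
  "H_mat T V Gt G L =
     the (mat_inverse V) * ((1 / (real T)\<^sup>2) \<cdot>\<^sub>m (transpose_mat Gt * G)) * L"

definition eigen_nu :: "nat \<Rightarrow> real mat \<Rightarrow> (real \<Rightarrow> 'w \<Rightarrow> nat \<Rightarrow> real) \<Rightarrow> 'w \<Rightarrow> nat \<Rightarrow> real" where
  "eigen_nu q \<Sigma> W w i = eig (psd_sqrt \<Sigma> * BB_integral q W w * psd_sqrt \<Sigma>) i"

definition eigen_gap :: "nat \<Rightarrow> real mat \<Rightarrow> (real \<Rightarrow> 'w \<Rightarrow> nat \<Rightarrow> real) \<Rightarrow> 'w \<Rightarrow> real" where
  "eigen_gap q \<Sigma> W w =
     Min ((\<lambda>i. eigen_nu q \<Sigma> W w i - eigen_nu q \<Sigma> W w (i + 1)) ` {1..q - 1})"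

definition rate :: "nat \<Rightarrow> nat \<Rightarrow> real \<Rightarrow> real \<Rightarrow> real \<Rightarrow> real \<Rightarrow> real" where
  "rate N T q \<nu>lo \<nu>up \<delta> =
     \<nu>lo powi (-2) * q * (real T powi (-2) + q * \<nu>up / real N + q * \<nu>up * \<delta>\<^sup>2)"

end

theory Submission
  imports Defs "Jordan_Normal_Form.Spectral_Radius"
begin

unbundle no inner_syntax and no vec_syntax

text \<open>
  Write \<open>\<Omega> = G L G\<^sup>T + R\<close>, where \<open>L\<close> is the Gram matrix of the loadings. Since the columns of \<open>Gt\<close> are \<open>T\<close> times
  orthonormal eigenvectors of \<open>\<Omega>\<close>, the error in row \<open>t\<close> is \<open>V\<^sup>-\<^sup>1\<close> applied to the coefficients of row \<open>t\<close> of \<open>R\<close>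
  in these eigenvectors, divided by \<open>T\<close>. By Bessel's inequality the averaged squared error is at most
  \<open>\<parallel>R\<parallel>\<^sup>2 / (T\<^sup>3 v\<^sup>2)\<close> with the Frobenius norm of \<open>R\<close> and the smallest entry \<open>v\<close> of \<open>V\<close>.

  Expanding \<open>R\<close> into products of the common component, the sieve error and the noise, Cauchy--Schwarz and Markov's
  inequality give \<open>\<parallel>R\<parallel>\<^sup>2 = O\<^sub>P(T\<^sup>3 \<nu>lo\<^sup>2 rate)\<close>. Evaluating the quadratic form of \<open>\<Omega>\<close> on the range of \<open>G\<close>
  (Courant--Fischer) shows that \<open>v\<close> is at least a constant times \<open>\<nu>lo\<close>: the form of \<open>G\<^sup>T G / T\<^sup>2\<close> differs from that of the
  Brownian integral by \<open>o\<^sub>P(q powr -\<kappa>)\<close>, which is of smaller order than \<open>\<nu>lo\<close> because \<open>q powr -\<kappa> = O((\<nu>lo / \<nu>up)\<^sup>2)\<close> and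
  \<open>\<nu>up\<close> is bounded away from zero. The last fact comes from the law of the first component of the Brownian motion,
  whose variance does not depend on \<open>q\<close>.
\<close>

section \<open>Spectral theory of real symmetric matrices\<close>

text \<open>Two difficulties shape the proof. First, q may diverge, so every estimate carries
  explicit constants that depend on neither q, N nor T. Bessel's inequality treats all q
  eigenvectors at once and V enters only through its smallest entry, so the passage from R to the
  error loses no factor q; the powers of q that the bound on R uses come from the traces of G^T G
  and of L. Second, the estimator is an arbitrary selection of eigenvectors and may fail to be
  measurable. Randomness is therefore confined to a few measurable events, on which a deterministic
  inequality holds for every admissible selection. That the rate tends to zero enters twice: it
  makes the Frobenius norm of R at most half of the signal in the lower bound for v, and it bounds
  the square of \<delta> by \<nu>up, which absorbs the term quadratic in the sieve error.\<close>

lemma symmetric_mat_index: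
  assumes "A \<in> carrier_mat n n" "transpose_mat A = A" "i < n" "j < n"
  shows "A $$ (i, j) = A $$ (j, i)"
  using assms by (metis carrier_matD index_transpose_mat(1))

lemma scalar_prod_self: "v \<in> carrier_vec n \<Longrightarrow> v \<bullet> v = (\<Sum>i<n. (v $ i)\<^sup>2)" for v :: "real vec"
  by (simp add: scalar_prod_def power2_eq_square lessThan_atLeast0)

lemma scalar_prod_self_pos:
  fixes v :: "real vec"
  assumes "v \<in> carrier_vec n" "v \<noteq> 0\<^sub>v n"
  shows "v \<bullet> v > 0"
proof -
  obtain i where "i < n" "v $ i \<noteq> 0" using assms by (metis carrier_vecD eq_vecI index_zero_vec)
  then show ?thesis unfolding scalar_prod_self[OF assms(1)] by (intro sum_pos2[of _ i]) auto
qed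

lemma scalar_prod_symmetric:
  fixes A :: "real mat"
  assumes A: "A \<in> carrier_mat n n" "transpose_mat A = A"
    and v: "v \<in> carrier_vec n" and w: "w \<in> carrier_vec n"
  shows "v \<bullet> (A *\<^sub>v w) = (A *\<^sub>v v) \<bullet> w"
  using transpose_vec_mult_scalar[OF A(1) w v] A(2) v w A(1)
  by (simp add: comm_scalar_prod[of _ n])

text \<open>Over the complex numbers the spectrum is non-empty. For an eigenvector \<open>z\<close>
  with eigenvalue \<open>c\<close>, symmetry of the real matrix makes the form \<open>S\<close>
  equal to its conjugate, and \<open>S\<close> is \<open>c\<close> times a positive real, so
  \<open>c\<close> is real. The characteristic polynomial carries this root back to the
  reals.\<close>

lemma symmetric_real_eigenvalue_exists:
  fixes A :: "real mat"
  assumes A: "A \<in> carrier_mat n n" and sym: "transpose_mat A = A" and n: "n > 0"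
  obtains k where "eigenvalue A k"
proof -
  let ?A = "map_mat complex_of_real A"
  have Ac: "?A \<in> carrier_mat n n" using A by auto
  obtain c where "c \<in> spectrum ?A" using spectrum_non_empty[OF Ac n] by blast
  then obtain z where z: "z \<in> carrier_vec n" "z \<noteq> 0\<^sub>v n" "?A *\<^sub>v z = c \<cdot>\<^sub>v z"
    using Ac unfolding spectrum_def eigenvalue_def eigenvector_def by auto
  have zi: "(\<Sum>j<n. complex_of_real (A $$ (i, j)) * z $ j) = c * z $ i" if "i < n" for i
  proof -
    have "(?A *\<^sub>v z) $ i = c * z $ i" using z that by simp
    then show ?thesis using that A z(1) by (simp add: scalar_prod_def lessThan_atLeast0)
  qed
  define S where "S = (\<Sum>i<n. \<Sum>j<n. cnj (z $ i) * complex_of_real (A $$ (i, j)) * z $ j)"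
  have "S = (\<Sum>i<n. cnj (z $ i) * (c * z $ i))"
    unfolding S_def by (rule sum.cong) (simp_all add: zi[symmetric] sum_distrib_left mult.assoc)
  also have "\<dots> = c * (\<Sum>i<n. of_real ((cmod (z $ i))\<^sup>2))"
    unfolding sum_distrib_left
    by (rule sum.cong, rule refl, simp only: complex_norm_square) (simp add: mult_ac)
  finally have S1: "S = c * of_real (\<Sum>i<n. (cmod (z $ i))\<^sup>2)" by simp
  have "cnj S = (\<Sum>i<n. \<Sum>j<n. z $ i * complex_of_real (A $$ (i, j)) * cnj (z $ j))"
    unfolding S_def by simp
  also have "\<dots> = (\<Sum>j<n. \<Sum>i<n. z $ i * complex_of_real (A $$ (i, j)) * cnj (z $ j))"
    by (rule sum.swap)
  also have "\<dots> = S" unfolding S_def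
    by (intro sum.cong refl) (simp add: symmetric_mat_index[OF A sym] mult_ac)
  finally have "cnj S = S" .
  obtain i where i: "i < n" "z $ i \<noteq> 0" using z(1,2) by (metis carrier_vecD eq_vecI index_zero_vec)
  have pos: "(\<Sum>i<n. (cmod (z $ i))\<^sup>2) > 0"
    by (rule sum_pos2[of _ i]) (use i in auto)
  have "cnj c = c"
    using \<open>cnj S = S\<close> pos unfolding S1 by (simp del: of_real_sum)
  then have c: "c = of_real (Re c)" by (simp add: complex_eq_iff)
  have "eigenvalue ?A c" using \<open>c \<in> spectrum ?A\<close> unfolding spectrum_def by simp
  then have "poly (map_poly complex_of_real (char_poly A)) (of_real (Re c)) = 0"
    using c unfolding eigenvalue_root_char_poly[OF Ac] of_real_hom.char_poly_hom[OF A] by metis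
  then have "eigenvalue A (Re c)"
    unfolding eigenvalue_root_char_poly[OF A] by simp
  then show thesis by (rule that)
qed

lemma mult_mat_unit_vec:
  fixes A :: "real mat"
  assumes "A \<in> carrier_mat m n" "j < n"
  shows "A *\<^sub>v unit_vec n j = col A j"
  using assms by (intro eq_vecI) auto

text \<open>The Householder reflection along \<open>e\<^sub>0 - v\<close>.\<close>

lemma householder_exists:
  fixes v :: "real vec"
  assumes v: "v \<in> carrier_vec n" "v \<bullet> v = 1" and n: "n > 0"
  obtains U where "U \<in> carrier_mat n n" "transpose_mat U = U" "U * U = 1\<^sub>m n"
    "U *\<^sub>v unit_vec n 0 = v"
proof (cases "v = unit_vec n 0")
  case True
  then show thesis by (intro that[of "1\<^sub>m n"]) (auto simp: transpose_one)
next
  case False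
  define w where "w = unit_vec n 0 - v"
  have w: "w \<in> carrier_vec n" using v by (auto simp: w_def)
  define s where "s = w \<bullet> w"
  have s_sum: "s = (\<Sum>i<n. (w $ i)\<^sup>2)"
    using w by (simp add: s_def scalar_prod_def power2_eq_square lessThan_atLeast0)
  have "\<exists>i<n. w $ i \<noteq> 0"
  proof (rule ccontr)
    assume "\<not> ?thesis"
    then have "v = unit_vec n 0" using v by (intro eq_vecI) (auto simp: w_def)
    then show False using False by simp
  qed
  then obtain i where "i < n" "w $ i \<noteq> 0" by blast
  then have s0: "s > 0" unfolding s_sum by (intro sum_pos2[of _ i]) auto
  define U where "U = mat n n (\<lambda>(i, j). (if i = j then 1 else 0) - 2 / s * w $ i * w $ j)"
  have U: "U \<in> carrier_mat n n" by (simp add: U_def)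
  have tU: "transpose_mat U = U" by (rule eq_matI) (auto simp: U_def)
  have Ux: "U *\<^sub>v x = x - (2 / s * (w \<bullet> x)) \<cdot>\<^sub>v w" if x: "x \<in> carrier_vec n" for x
  proof (rule eq_vecI)
    fix i assume "i < dim_vec (x - (2 / s * (w \<bullet> x)) \<cdot>\<^sub>v w)"
    then have i: "i < n" using w by simp
    have "(U *\<^sub>v x) $ i = (\<Sum>j<n. ((if i = j then 1 else 0) - 2 / s * w $ i * w $ j) * x $ j)"
      using i x by (simp add: U_def scalar_prod_def lessThan_atLeast0)
    also have "\<dots> = (\<Sum>j<n. if i = j then x $ j else 0) - (\<Sum>j<n. 2 / s * w $ i * w $ j * x $ j)"
      unfolding sum_subtractf[symmetric] by (intro sum.cong refl) (auto simp: algebra_simps)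
    also have "(\<Sum>j<n. if i = j then x $ j else 0) = x $ i" using i by simp
    also have "(\<Sum>j<n. 2 / s * w $ i * w $ j * x $ j) = 2 / s * (w \<bullet> x) * w $ i"
      using x by (simp add: scalar_prod_def lessThan_atLeast0 sum_distrib_left sum_distrib_right mult_ac)
    finally show "(U *\<^sub>v x) $ i = (x - (2 / s * (w \<bullet> x)) \<cdot>\<^sub>v w) $ i" using i w x by simp
  qed (use U w in auto)
  have UU: "U *\<^sub>v (U *\<^sub>v x) = x" if x: "x \<in> carrier_vec n" for x
  proof -
    define a where "a = 2 / s * (w \<bullet> x)"
    have 1: "U *\<^sub>v x = x - a \<cdot>\<^sub>v w" using Ux[OF x] by (simp add: a_def)
    have "w \<bullet> (x - a \<cdot>\<^sub>v w) = w \<bullet> x - a * s"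
      using w x by (simp add: scalar_prod_minus_distrib[of _ n] s_def)
    also have "\<dots> = - (w \<bullet> x)" using s0 by (simp add: a_def)
    finally have 2: "2 / s * (w \<bullet> (x - a \<cdot>\<^sub>v w)) = - a" by (simp add: a_def)
    have "U *\<^sub>v (x - a \<cdot>\<^sub>v w) = (x - a \<cdot>\<^sub>v w) - (- a) \<cdot>\<^sub>v w"
      using Ux[of "x - a \<cdot>\<^sub>v w"] w x 2 by simp
    also have "\<dots> = x" using w x by (intro eq_vecI) auto
    finally show ?thesis using 1 by simp
  qed
  have "U * U = 1\<^sub>m n"
  proof (rule eq_matI)
    fix i j assume ij: "i < dim_row (1\<^sub>m n :: real mat)" "j < dim_col (1\<^sub>m n :: real mat)"
    have "col (U * U) j = U *\<^sub>v (U *\<^sub>v unit_vec n j)"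
      using ij U col_mult2[OF U U, of j] by (simp only: mult_mat_unit_vec[of _ n n] index_one_mat)
    also have "\<dots> = unit_vec n j" by (rule UU) simp
    finally have "col (U * U) j = unit_vec n j" .
    then have "(U * U) $$ (i, j) = unit_vec n j $ i"
      using ij U by (metis carrier_matD index_col index_one_mat(2,3) mult_carrier_mat)
    then show "(U * U) $$ (i, j) = 1\<^sub>m n $$ (i, j)" using ij by simp
  qed (use U in auto)
  moreover have "U *\<^sub>v unit_vec n 0 = v"
  proof -
    have e: "unit_vec n 0 \<bullet> v = v $ 0" "v \<bullet> unit_vec n 0 = v $ 0"
      using v n by (auto simp: scalar_prod_left_unit scalar_prod_right_unit)
    have "s = 2 - 2 * v $ 0" unfolding s_def w_def
      using v n e by (simp add: minus_scalar_prod_distrib[of _ n] scalar_prod_minus_distrib[of _ n])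
    moreover have "w \<bullet> unit_vec n 0 = 1 - v $ 0"
      using v n e by (simp add: w_def)
    ultimately have "2 / s * (w \<bullet> unit_vec n 0) = 1" using s0 by (simp add: field_simps)
    then have "U *\<^sub>v unit_vec n 0 = unit_vec n 0 - w" using Ux[of "unit_vec n 0"] by simp
    also have "\<dots> = v" using v by (intro eq_vecI) (auto simp: w_def)
    finally show ?thesis .
  qed
  ultimately show thesis using U tU by (intro that[of U])
qed

section \<open>Orthonormal eigenbases and ordered eigenvalues\<close>

definition orthonormal_family :: "nat \<Rightarrow> nat \<Rightarrow> (nat \<Rightarrow> real vec) \<Rightarrow> bool" where
  "orthonormal_family n m e \<longleftrightarrow> (\<forall>i<m. e i \<in> carrier_vec n) \<and>
     (\<forall>i<m. \<forall>j<m. e i \<bullet> e j = (if i = j then 1 else 0))"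

text \<open>Induction on the dimension. A Householder reflection sends the first unit vector to a
  unit eigenvector, so the conjugated matrix \<open>B\<close> has a first column that vanishes off
  the diagonal and, by symmetry, a first row of the same kind. The induction hypothesis applies to
  the remaining block; prefixing its eigenvectors with 0 and reflecting back completes the
  basis.\<close>

lemma spectral_theorem_unordered:
  fixes A :: "real mat"
  assumes "A \<in> carrier_mat n n" "transpose_mat A = A"
  shows "\<exists>e d. orthonormal_family n n e \<and> (\<forall>i<n. A *\<^sub>v e i = d i \<cdot>\<^sub>v e i)"
  using assms
proof (induction n arbitrary: A)
  case 0
  then show ?case by (auto simp: orthonormal_family_def)
next
  case (Suc m)
  let ?n = "Suc m"
  note A = Suc.prems
  obtain k where "eigenvalue A k" using symmetric_real_eigenvalue_exists[OF A] by auto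
  then obtain x where x: "x \<in> carrier_vec ?n" "x \<noteq> 0\<^sub>v ?n" "A *\<^sub>v x = k \<cdot>\<^sub>v x"
    using A unfolding eigenvalue_def eigenvector_def by auto
  have xx: "x \<bullet> x > 0" using x by (intro scalar_prod_self_pos)
  define v where "v = (1 / sqrt (x \<bullet> x)) \<cdot>\<^sub>v x"
  have v: "v \<in> carrier_vec ?n" using x by (simp add: v_def)
  have vv: "v \<bullet> v = 1" using x xx by (simp add: v_def real_sqrt_mult[symmetric])
  have Av: "A *\<^sub>v v = k \<cdot>\<^sub>v v" using x A
    by (simp add: v_def mult_mat_vec[of _ ?n ?n] smult_smult_assoc mult.commute)
  obtain U where U: "U \<in> carrier_mat ?n ?n" "transpose_mat U = U" "U * U = 1\<^sub>m ?n"
    "U *\<^sub>v unit_vec ?n 0 = v" using householder_exists[OF v vv] by auto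
  have UUx: "U *\<^sub>v (U *\<^sub>v x) = x" if "x \<in> carrier_vec ?n" for x
    using U that by (metis assoc_mult_mat_vec one_mult_mat_vec)
  define B where "B = U * A * U"
  have B: "B \<in> carrier_mat ?n ?n" using U A by (simp add: B_def)
  have Bx: "B *\<^sub>v x = U *\<^sub>v (A *\<^sub>v (U *\<^sub>v x))" if "x \<in> carrier_vec ?n" for x
    using that U A by (simp add: B_def assoc_mult_mat_vec[of _ ?n ?n _ ?n])
  have tB: "transpose_mat B = B"
    using U A B by (simp add: B_def transpose_mult[of _ ?n ?n _ ?n] assoc_mult_mat[of _ ?n ?n _ ?n _ ?n])
  have UAx: "A *\<^sub>v (U *\<^sub>v x) = U *\<^sub>v (B *\<^sub>v x)" if x: "x \<in> carrier_vec ?n" for x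
    using UUx[of "A *\<^sub>v (U *\<^sub>v x)"] Bx[OF x] U A x by simp
  have Uv: "U *\<^sub>v v = unit_vec ?n 0" using UUx[of "unit_vec ?n 0"] U(4) by simp
  have Be: "B *\<^sub>v unit_vec ?n 0 = k \<cdot>\<^sub>v unit_vec ?n 0"
    using Bx[of "unit_vec ?n 0"] U v Uv by (simp add: Av mult_mat_vec[of _ ?n ?n])
  have B0: "B $$ (i, 0) = 0" if "i > 0" "i < ?n" for i
  proof -
    have "(B *\<^sub>v unit_vec ?n 0) $ i = 0" unfolding Be using that by simp
    then show ?thesis using that B by (simp add: mult_mat_unit_vec[of _ ?n ?n])
  qed
  have B0': "B $$ (0, i) = 0" if "i > 0" "i < ?n" for i
    using B0[OF that] symmetric_mat_index[OF B tB, of 0 i] that by simp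
  define A' where "A' = mat m m (\<lambda>(i, j). B $$ (Suc i, Suc j))"
  have A': "A' \<in> carrier_mat m m" by (simp add: A'_def)
  have tA': "transpose_mat A' = A'"
    by (rule eq_matI) (auto simp: A'_def intro: symmetric_mat_index[OF B tB])
  have BC: "B *\<^sub>v vCons 0 y = vCons 0 (A' *\<^sub>v y)" if y: "y \<in> carrier_vec m" for y
  proof (rule eq_vecI)
    fix i assume "i < dim_vec (vCons 0 (A' *\<^sub>v y))"
    then have i: "i < ?n" by (simp add: A'_def)
    have "(B *\<^sub>v vCons 0 y) $ i = (\<Sum>j<?n. B $$ (i, j) * vCons 0 y $ j)"
      using i B y by (simp add: scalar_prod_def lessThan_atLeast0)
    also have "\<dots> = (\<Sum>j<m. B $$ (i, Suc j) * y $ j)"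
      unfolding sum.lessThan_Suc_shift by simp
    also have "\<dots> = vCons 0 (A' *\<^sub>v y) $ i"
    proof (cases i)
      case 0
      then show ?thesis by (simp add: B0')
    next
      case (Suc i')
      then show ?thesis using i y by (simp add: A'_def scalar_prod_def lessThan_atLeast0)
    qed
    finally show "(B *\<^sub>v vCons 0 y) $ i = vCons 0 (A' *\<^sub>v y) $ i" .
  qed (use B A' in auto)
  obtain e d where e: "orthonormal_family m m e" and d: "\<forall>i<m. A' *\<^sub>v e i = d i \<cdot>\<^sub>v e i"
    using Suc.IH[OF A' tA'] by blast
  have ec: "e i \<in> carrier_vec m" if "i < m" for i using e that by (simp add: orthonormal_family_def)
  define g where "g i = (if i = 0 then unit_vec ?n 0 else vCons 0 (e (i - 1)))" for i
  have gc: "g i \<in> carrier_vec ?n" if "i < ?n" for i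
    using ec that by (cases i) (auto simp: g_def)
  have g_unit: "unit_vec ?n 0 = vCons (1::real) (0\<^sub>v m)"
    by (rule eq_vecI) (auto simp: vec_index_vCons unit_vec_def)
  have gg: "g i \<bullet> g j = (if i = j then 1 else 0)" if "i < ?n" "j < ?n" for i j
    using that e ec[of "i - 1"] ec[of "j - 1"]
    by (cases i; cases j) (auto simp: g_def g_unit orthonormal_family_def)
  define f where "f i = U *\<^sub>v g i" for i
  have fc: "f i \<in> carrier_vec ?n" if "i < ?n" for i using gc[OF that] U by (simp add: f_def)
  have ff: "f i \<bullet> f j = (if i = j then 1 else 0)" if "i < ?n" "j < ?n" for i j
    using scalar_prod_symmetric[OF U(1,2) fc[OF that(1)] gc[OF that(2)]] gg[OF that] UUx[OF gc[OF that(1)]]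
    by (simp add: f_def)
  have Bg: "B *\<^sub>v g i = (if i = 0 then k else d (i - 1)) \<cdot>\<^sub>v g i" if "i < ?n" for i
  proof (cases i)
    case 0
    then show ?thesis using Be by (simp add: g_def)
  next
    case (Suc i')
    have "c \<cdot>\<^sub>v vCons 0 y = vCons 0 (c \<cdot>\<^sub>v y)" for c :: real and y
      by (rule eq_vecI) (auto simp: vec_index_vCons)
    then show ?thesis using Suc that BC[OF ec] d by (simp add: g_def)
  qed
  have "A *\<^sub>v f i = (if i = 0 then k else d (i - 1)) \<cdot>\<^sub>v f i" if "i < ?n" for i
    using UAx[OF gc[OF that]] Bg[OF that] U gc[OF that] by (simp add: f_def mult_mat_vec[of _ ?n ?n])
  then show ?case
    using fc ff by (intro exI[of _ f] exI[of _ "\<lambda>i. if i = 0 then k else d (i - 1)"])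
      (auto simp: orthonormal_family_def)
qed

text \<open>The eigenvectors, taken as columns, form an orthogonal matrix that diagonalises
  \<open>A\<close>. This connects eigenvectors with \<open>eig\<close>, which is defined through the
  roots of the characteristic polynomial.\<close>

lemma char_poly_eigenbasis:
  fixes A :: "real mat"
  assumes A: "A \<in> carrier_mat n n" and e: "orthonormal_family n n e"
    and d: "\<And>i. i < n \<Longrightarrow> A *\<^sub>v e i = d i \<cdot>\<^sub>v e i"
  shows "char_poly A = (\<Prod>i\<leftarrow>[0..<n]. [:- d i, 1:])"
proof -
  have ec: "e i \<in> carrier_vec n" if "i < n" for i using e that by (simp add: orthonormal_family_def)
  define U where "U = mat_of_cols n (map e [0..<n])"
  define D where "D = mat_diag n d"
  have U: "U \<in> carrier_mat n n" by (simp add: U_def mat_of_cols_def)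
  have D: "D \<in> carrier_mat n n" by (simp add: D_def)
  have colU: "col U i = e i" if "i < n" for i using that ec by (simp add: U_def)
  have tUU: "transpose_mat U * U = 1\<^sub>m n"
    by (rule eq_matI) (use U colU e in \<open>auto simp: orthonormal_family_def\<close>)
  have UtU: "U * transpose_mat U = 1\<^sub>m n"
    using mat_mult_left_right_inverse[of "transpose_mat U" n U] U tUU by simp
  have AU: "A * U = U * D"
  proof (rule eq_matI)
    fix i j assume "i < dim_row (U * D)" "j < dim_col (U * D)"
    then have ij: "i < n" "j < n" using U D by auto
    have "(A * U) $$ (i, j) = (A *\<^sub>v e j) $ i" using ij A U colU by simp
    also have "\<dots> = d j * e j $ i" using ij ec[OF ij(2)] by (simp add: d)
    also have "e j $ i = U $$ (i, j)" using ij by (simp add: U_def mat_of_cols_index)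
    also have "d j * U $$ (i, j) = (U * D) $$ (i, j)" using ij U unfolding D_def mat_diag_mult_right[OF U] by simp
    finally show "(A * U) $$ (i, j) = (U * D) $$ (i, j)" .
  qed (use A U D in auto)
  have "A = A * (U * transpose_mat U)" using A UtU by simp
  also have "\<dots> = A * U * transpose_mat U" using A U by (simp add: assoc_mult_mat[of _ n n _ n _ n])
  also have "\<dots> = U * D * transpose_mat U" unfolding AU ..
  finally have "A = U * D * transpose_mat U" .
  then have "similar_mat_wit A D U (transpose_mat U)"
    using A U D UtU tUU unfolding similar_mat_wit_def by (auto simp: Let_def)
  then have "char_poly A = char_poly D" by (intro char_poly_similar) (auto simp: similar_mat_def)
  also have "\<dots> = (\<Prod>a\<leftarrow>diag_mat D. [:- a, 1:])"
    by (rule char_poly_upper_triangular[OF D]) (auto simp: D_def mat_diag_def)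
  also have "diag_mat D = map d [0..<n]"
    by (rule nth_equalityI) (auto simp: diag_mat_def D_def mat_diag_def)
  finally show ?thesis by (simp add: comp_def)
qed

lemma proots_eigenbasis:
  fixes A :: "real mat"
  assumes A: "A \<in> carrier_mat n n" and e: "orthonormal_family n n e"
    and d: "\<And>i. i < n \<Longrightarrow> A *\<^sub>v e i = d i \<cdot>\<^sub>v e i"
  shows "proots (char_poly A) = mset (map d [0..<n])"
proof -
  have "proots (\<Prod>i\<leftarrow>xs. [:- d i, 1:]) = mset (map d xs)" for xs
  proof (induction xs)
    case (Cons a xs)
    have "(\<Prod>i\<leftarrow>xs. [:- d i, 1:]) \<noteq> 0" by (auto simp: prod_list_zero_iff)
    then have "proots ([:- d a, 1:] * (\<Prod>i\<leftarrow>xs. [:- d i, 1:])) =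
        proots [:- d a, 1:] + proots (\<Prod>i\<leftarrow>xs. [:- d i, 1:])"
      by (intro proots_mult) auto
    then show ?case using Cons by simp
  qed simp
  then show ?thesis by (simp only: char_poly_eigenbasis[OF assms])
qed

text \<open>After this criterion no polynomial root has to be touched again: an orthonormal
  eigenbasis listed with non-increasing eigenvalues already determines the sorted root list.\<close>

lemma eig_eigenbasis:
  fixes A :: "real mat"
  assumes A: "A \<in> carrier_mat n n" and e: "orthonormal_family n n e"
    and d: "\<And>i. i < n \<Longrightarrow> A *\<^sub>v e i = d i \<cdot>\<^sub>v e i"
    and anti: "\<And>i j. i \<le> j \<Longrightarrow> j < n \<Longrightarrow> d j \<le> d i" and i: "i < n"
  shows "eig A (i + 1) = d i"
proof -
  have "rev (sorted_list_of_multiset (mset (map d [0..<n]))) = map d [0..<n]"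
  proof -
    have "sorted (rev (map d [0..<n]))"
      unfolding sorted_rev_iff_nth_mono by (auto intro: anti)
    then have "sort (map d [0..<n]) = rev (map d [0..<n])"
      by (intro properties_for_sort) auto
    then show ?thesis by (simp only: sorted_list_of_multiset_mset rev_rev_ident)
  qed
  moreover have "proots (char_poly A) = mset (map d [0..<n])"
    by (rule proots_eigenbasis[OF A e d])
  ultimately have "eig A (i + 1) = map d [0..<n] ! i" by (simp only: eig_def add_diff_cancel_right')
  then show ?thesis using i by simp
qed

text \<open>The eigenvalues are named by \<open>eig\<close> itself, so that expansions in the basis
  speak directly of the ordered eigenvalues.\<close>

definition sorted_eigenbasis :: "nat \<Rightarrow> real mat \<Rightarrow> (nat \<Rightarrow> real vec) \<Rightarrow> bool" where
  "sorted_eigenbasis n A e \<longleftrightarrow> orthonormal_family n n e \<and>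
     (\<forall>i<n. A *\<^sub>v e i = eig A (i + 1) \<cdot>\<^sub>v e i) \<and>
     (\<forall>i j. i \<le> j \<longrightarrow> j < n \<longrightarrow> eig A (j + 1) \<le> eig A (i + 1))"

lemma sorted_eigenbasisD:
  assumes "sorted_eigenbasis n A e"
  shows "orthonormal_family n n e" "\<And>i. i < n \<Longrightarrow> A *\<^sub>v e i = eig A (i + 1) \<cdot>\<^sub>v e i"
    "\<And>i j. i \<le> j \<Longrightarrow> j < n \<Longrightarrow> eig A (j + 1) \<le> eig A (i + 1)"
  using assms unfolding sorted_eigenbasis_def by blast+

lemma spectral_theorem:
  fixes A :: "real mat"
  assumes A: "A \<in> carrier_mat n n" and sym: "transpose_mat A = A"
  shows "\<exists>e. sorted_eigenbasis n A e"
proof -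
  obtain e d where e: "orthonormal_family n n e" and d: "\<And>i. i < n \<Longrightarrow> A *\<^sub>v e i = d i \<cdot>\<^sub>v e i"
    using spectral_theorem_unordered[OF assms] by auto
  define s where "s = rev (sort (map d [0..<n]))"
  have len: "length s = n" by (simp add: s_def)
  have "mset s = mset (map d [0..<n])" by (simp add: s_def)
  then obtain f where p: "f permutes {..<length (map d [0..<n])}"
    and ps: "permute_list f (map d [0..<n]) = s" by (rule mset_eq_permutation)
  have fn: "f i < n" if "i < n" for i using permutes_in_image[OF p, of i] that by simp
  have finj: "f i = f j \<longleftrightarrow> i = j" for i j
    using permutes_inj[OF p] by (auto simp: inj_def)
  have f: "s ! i = d (f i)" if "i < n" for i
    using permute_list_nth[OF p, of i] that fn[OF that] by (simp add: ps)
  have e': "orthonormal_family n n (e \<circ> f)"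
    using e fn finj by (auto simp: orthonormal_family_def)
  have d': "A *\<^sub>v (e \<circ> f) i = s ! i \<cdot>\<^sub>v (e \<circ> f) i" if "i < n" for i
    using d[OF fn[OF that]] f[OF that] by simp
  have "sorted (rev s)" by (simp add: s_def)
  then have anti: "s ! j \<le> s ! i" if "i \<le> j" "j < n" for i j
    using that len sorted_rev_nth_mono[of s i j] by simp
  have eq: "eig A (i + 1) = s ! i" if "i < n" for i
    by (rule eig_eigenbasis[OF A e' d' anti that])
  have "A *\<^sub>v (e \<circ> f) i = eig A (i + 1) \<cdot>\<^sub>v (e \<circ> f) i" if "i < n" for i
    using d'[OF that] eq[OF that] by simp
  moreover have "eig A (j + 1) \<le> eig A (i + 1)" if "i \<le> j" "j < n" for i j
    using anti[OF that] eq that by simp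
  ultimately show ?thesis using e' unfolding sorted_eigenbasis_def by blast
qed

text \<open>A nonnegative factor preserves the order of the eigenvalues. This relates the entries of
  \<open>V_mat\<close>, taken from the rescaled matrix, to the eigenvalues of \<Omega>.\<close>

lemma eig_smult:
  fixes A :: "real mat"
  assumes A: "A \<in> carrier_mat n n" and sym: "transpose_mat A = A" and c: "c \<ge> 0" and i: "i < n"
  shows "eig (c \<cdot>\<^sub>m A) (i + 1) = c * eig A (i + 1)"
proof -
  obtain e where "sorted_eigenbasis n A e" using spectral_theorem[OF A sym] by blast
  note e = sorted_eigenbasisD[OF this]
  show ?thesis
  proof (rule eig_eigenbasis[OF _ e(1) _ _ i])
    show "c \<cdot>\<^sub>m A *\<^sub>v e i = (c * eig A (i + 1)) \<cdot>\<^sub>v e i" if "i < n" for i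
    proof -
      have "e i \<in> carrier_vec n" using e(1) that by (simp add: orthonormal_family_def)
      then have "c \<cdot>\<^sub>m A *\<^sub>v e i = c \<cdot>\<^sub>v (A *\<^sub>v e i)" using A by (intro eq_vecI) auto
      then show ?thesis using e(2)[OF that] by (simp only: smult_smult_assoc)
    qed
    show "c * eig A (j + 1) \<le> c * eig A (i + 1)" if "i \<le> j" "j < n" for i j
      using e(3)[OF that] c by (rule mult_left_mono)
  qed (use A in simp)
qed

lemma eig_eigenvalue:
  fixes A :: "real mat"
  assumes A: "A \<in> carrier_mat n n" and sym: "transpose_mat A = A" and i: "i < n"
  shows "eigenvalue A (eig A (i + 1))"
proof -
  obtain e where "sorted_eigenbasis n A e" using spectral_theorem[OF A sym] by blast
  note e = sorted_eigenbasisD[OF this]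
  have ei: "e i \<in> carrier_vec n" "e i \<bullet> e i = 1" using e(1) i by (simp_all add: orthonormal_family_def)
  have "e i \<noteq> 0\<^sub>v n"
  proof
    assume "e i = 0\<^sub>v n"
    then show False using ei(2) by simp
  qed
  moreover have "dim_row A = n" using A by simp
  ultimately have "eigenvector A (e i) (eig A (i + 1))"
    unfolding eigenvector_def using e(2)[OF i] ei(1) by simp
  then show ?thesis unfolding eigenvalue_def by blast
qed

section \<open>Expansions in orthonormal families and bounds for quadratic forms\<close>

lemma bessel_inequality:
  assumes e: "orthonormal_family n m e" and x: "x \<in> carrier_vec n"
  shows "(\<Sum>i<m. (e i \<bullet> x)\<^sup>2) \<le> x \<bullet> x"
proof -
  have ec: "e i \<in> carrier_vec n" if "i < m" for i using e that by (simp add: orthonormal_family_def)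
  \<comment> \<open>Coordinates of the projection of \<open>x\<close> onto the span. Its inner
    product with \<open>x\<close> and its squared length both equal the sum of squared coefficients,
    so the squared distance from \<open>x\<close> is the difference of the two sides.\<close>
  define y where "y a = (\<Sum>i<m. (e i \<bullet> x) * e i $ a)" for a
  have ex: "e i \<bullet> x = (\<Sum>a<n. e i $ a * x $ a)" for i
    using x by (simp add: scalar_prod_def lessThan_atLeast0)
  have ee: "(\<Sum>a<n. e i $ a * e j $ a) = (if i = j then 1 else 0)" if "i < m" "j < m" for i j
  proof -
    have "e i \<bullet> e j = (\<Sum>a<n. e i $ a * e j $ a)"
      using ec[OF that(2)] by (simp add: scalar_prod_def lessThan_atLeast0)
    then show ?thesis using e that by (simp add: orthonormal_family_def)
  qed
  have xy: "(\<Sum>a<n. x $ a * y a) = (\<Sum>i<m. (e i \<bullet> x)\<^sup>2)"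
  proof -
    have "(\<Sum>a<n. x $ a * y a) = (\<Sum>a<n. \<Sum>i<m. (e i \<bullet> x) * (e i $ a * x $ a))"
      unfolding y_def sum_distrib_left by (intro sum.cong refl) (simp add: mult_ac)
    also have "\<dots> = (\<Sum>i<m. (e i \<bullet> x) * (\<Sum>a<n. e i $ a * x $ a))"
      by (subst sum.swap) (simp add: sum_distrib_left)
    finally show ?thesis by (simp add: ex[symmetric] power2_eq_square)
  qed
  have yy: "(\<Sum>a<n. y a * y a) = (\<Sum>i<m. (e i \<bullet> x)\<^sup>2)"
  proof -
    have "(\<Sum>a<n. y a * y a) = (\<Sum>a<n. \<Sum>i<m. \<Sum>j<m. (e i \<bullet> x) * (e j \<bullet> x) * (e i $ a * e j $ a))"
      unfolding y_def sum_product by (intro sum.cong refl) (simp add: mult_ac)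
    also have "\<dots> = (\<Sum>i<m. \<Sum>j<m. (e i \<bullet> x) * (e j \<bullet> x) * (\<Sum>a<n. e i $ a * e j $ a))"
      unfolding sum_distrib_left by (rule trans[OF sum.swap], rule sum.cong[OF refl], rule sum.swap)
    also have "\<dots> = (\<Sum>i<m. \<Sum>j<m. if i = j then (e i \<bullet> x) * (e j \<bullet> x) else 0)"
      by (intro sum.cong refl) (simp add: ee)
    also have "\<dots> = (\<Sum>i<m. (e i \<bullet> x)\<^sup>2)" by (simp add: power2_eq_square)
    finally show ?thesis .
  qed
  have "0 \<le> (\<Sum>a<n. (x $ a - y a)\<^sup>2)" by (intro sum_nonneg) simp
  also have "\<dots> = (\<Sum>a<n. (x $ a)\<^sup>2) - 2 * (\<Sum>a<n. x $ a * y a) + (\<Sum>a<n. y a * y a)"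
    unfolding sum_distrib_left sum.distrib[symmetric] sum_subtractf[symmetric]
    by (intro sum.cong refl) (simp add: power2_eq_square algebra_simps)
  finally show ?thesis using xy yy by (simp add: scalar_prod_self[OF x])
qed

text \<open>A left inverse of a square matrix is also a right inverse, so orthonormal columns entail
  orthonormal rows.\<close>

lemma orthonormal_basis_completeness:
  assumes e: "orthonormal_family n n e" and "a < n" "b < n"
  shows "(\<Sum>i<n. e i $ a * e i $ b) = (if a = b then 1 else 0)"
proof -
  have ec: "e i \<in> carrier_vec n" if "i < n" for i using e that by (simp add: orthonormal_family_def)
  define U where "U = mat_of_cols n (map e [0..<n])"
  have U: "U \<in> carrier_mat n n" by (simp add: U_def mat_of_cols_def)
  have colU: "col U i = e i" if "i < n" for i using that ec by (simp add: U_def)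
  have tUU: "transpose_mat U * U = 1\<^sub>m n"
    by (rule eq_matI) (use U colU e in \<open>auto simp: orthonormal_family_def\<close>)
  have "U * transpose_mat U = 1\<^sub>m n"
    using mat_mult_left_right_inverse[of "transpose_mat U" n U] U tUU by simp
  then have "(U * transpose_mat U) $$ (a, b) = (if a = b then 1 else 0)" using assms by simp
  also have "(U * transpose_mat U) $$ (a, b) = (\<Sum>i<n. U $$ (a, i) * U $$ (b, i))"
    using assms U by (simp add: scalar_prod_def lessThan_atLeast0)
  also have "\<dots> = (\<Sum>i<n. e i $ a * e i $ b)"
    using assms by (intro sum.cong refl) (simp add: U_def mat_of_cols_index)
  finally show ?thesis .
qed

lemma parseval:
  assumes e: "orthonormal_family n n e" and x: "x \<in> carrier_vec n" and y: "y \<in> carrier_vec n"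
  shows "(\<Sum>i<n. (e i \<bullet> x) * (e i \<bullet> y)) = x \<bullet> y"
proof -
  have ex: "e i \<bullet> x = (\<Sum>a<n. e i $ a * x $ a)" if "x \<in> carrier_vec n" for i x
    using that by (simp add: scalar_prod_def lessThan_atLeast0)
  have "(\<Sum>i<n. (e i \<bullet> x) * (e i \<bullet> y)) = (\<Sum>i<n. \<Sum>a<n. \<Sum>b<n. x $ a * y $ b * (e i $ a * e i $ b))"
    unfolding ex[OF x] ex[OF y] sum_product by (intro sum.cong refl) (simp add: mult_ac)
  also have "\<dots> = (\<Sum>a<n. \<Sum>i<n. \<Sum>b<n. x $ a * y $ b * (e i $ a * e i $ b))" by (rule sum.swap)
  also have "\<dots> = (\<Sum>a<n. \<Sum>b<n. \<Sum>i<n. x $ a * y $ b * (e i $ a * e i $ b))"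
    by (rule sum.cong[OF refl]) (rule sum.swap)
  also have "\<dots> = (\<Sum>a<n. \<Sum>b<n. x $ a * y $ b * (\<Sum>i<n. e i $ a * e i $ b))"
    by (simp add: sum_distrib_left)
  also have "\<dots> = (\<Sum>a<n. \<Sum>b<n. if a = b then x $ a * y $ b else 0)"
    by (intro sum.cong refl) (simp add: orthonormal_basis_completeness[OF e])
  also have "\<dots> = x \<bullet> y" using y by (simp add: scalar_prod_def lessThan_atLeast0)
  finally show ?thesis .
qed

lemma quadratic_form_eigenbasis:
  fixes A :: "real mat"
  assumes A: "A \<in> carrier_mat n n" and sym: "transpose_mat A = A" and e: "orthonormal_family n n e"
    and d: "\<And>i. i < n \<Longrightarrow> A *\<^sub>v e i = d i \<cdot>\<^sub>v e i" and x: "x \<in> carrier_vec n"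
  shows "x \<bullet> (A *\<^sub>v x) = (\<Sum>i<n. d i * (e i \<bullet> x)\<^sup>2)"
proof -
  have ec: "e i \<in> carrier_vec n" if "i < n" for i using e that by (simp add: orthonormal_family_def)
  have "x \<bullet> (A *\<^sub>v x) = (\<Sum>i<n. (e i \<bullet> x) * (e i \<bullet> (A *\<^sub>v x)))"
    using parseval[OF e x, of "A *\<^sub>v x"] A x by simp
  also have "\<dots> = (\<Sum>i<n. d i * (e i \<bullet> x)\<^sup>2)"
  proof (rule sum.cong[OF refl])
    fix i assume "i \<in> {..<n}"
    then have i: "i < n" by simp
    have "e i \<bullet> (A *\<^sub>v x) = d i * (e i \<bullet> x)"
      using scalar_prod_symmetric[OF A sym ec[OF i] x] d[OF i] ec[OF i] x by simp
    then show "(e i \<bullet> x) * (e i \<bullet> (A *\<^sub>v x)) = d i * (e i \<bullet> x)\<^sup>2" by (simp add: power2_eq_square)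
  qed
  finally show ?thesis .
qed

lemma quadratic_form_ge_min_eig:
  fixes A :: "real mat"
  assumes A: "A \<in> carrier_mat n n" and sym: "transpose_mat A = A" and x: "x \<in> carrier_vec n"
    and lo: "\<And>i. i < n \<Longrightarrow> c \<le> eig A (i + 1)"
  shows "c * (x \<bullet> x) \<le> x \<bullet> (A *\<^sub>v x)"
proof -
  obtain e where "sorted_eigenbasis n A e" using spectral_theorem[OF A sym] by blast
  note e = sorted_eigenbasisD[OF this]
  have "c * (x \<bullet> x) = (\<Sum>i<n. c * (e i \<bullet> x)\<^sup>2)"
    unfolding parseval[OF e(1) x x, symmetric] by (simp add: sum_distrib_left power2_eq_square)
  also have "\<dots> \<le> (\<Sum>i<n. eig A (i + 1) * (e i \<bullet> x)\<^sup>2)"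
    by (intro sum_mono mult_right_mono lo) auto
  finally show ?thesis
    by (simp only: quadratic_form_eigenbasis[where d = "\<lambda>i. eig A (i + 1)", OF A sym e(1,2) x])
qed

lemma quadratic_form_le_max_eig:
  fixes A :: "real mat"
  assumes A: "A \<in> carrier_mat n n" and sym: "transpose_mat A = A" and x: "x \<in> carrier_vec n"
    and up: "\<And>i. i < n \<Longrightarrow> eig A (i + 1) \<le> c"
  shows "x \<bullet> (A *\<^sub>v x) \<le> c * (x \<bullet> x)"
proof -
  obtain e where "sorted_eigenbasis n A e" using spectral_theorem[OF A sym] by blast
  note e = sorted_eigenbasisD[OF this]
  have "(\<Sum>i<n. eig A (i + 1) * (e i \<bullet> x)\<^sup>2) \<le> (\<Sum>i<n. c * (e i \<bullet> x)\<^sup>2)"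
    by (intro sum_mono mult_right_mono up) auto
  also have "\<dots> = c * (x \<bullet> x)"
    unfolding parseval[OF e(1) x x, symmetric] by (simp add: sum_distrib_left power2_eq_square)
  finally show ?thesis
    by (simp only: quadratic_form_eigenbasis[where d = "\<lambda>i. eig A (i + 1)", OF A sym e(1,2) x])
qed

section \<open>Square roots of positive semidefinite matrices\<close>

lemma mat_eq_if_mult_vec_eq:
  fixes A B :: "real mat"
  assumes A: "A \<in> carrier_mat n n" and B: "B \<in> carrier_mat n n"
    and eq: "\<And>x. x \<in> carrier_vec n \<Longrightarrow> A *\<^sub>v x = B *\<^sub>v x"
  shows "A = B"
proof (rule eq_matI)
  fix i j assume "i < dim_row B" "j < dim_col B"
  then have ij: "i < n" "j < n" using B by auto
  have "col A j = col B j"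
    using eq[of "unit_vec n j"] ij A B by (simp add: mult_mat_unit_vec[of _ n n])
  then show "A $$ (i, j) = B $$ (i, j)" using ij A B by (metis carrier_matD index_col)
qed (use A B in auto)

text \<open>With D = S - S', equality of the squares gives S D + D S' = 0. At a unit eigenvector v
  of D with eigenvalue k this reads k (v.Sv + v.S'v) = 0, while k is the difference of these two
  nonnegative numbers. Hence k = 0 for every eigenvector, and the symmetric matrix D
  vanishes.\<close>

lemma psd_sqrt_unique:
  assumes S: "psd_mat n S" and S': "psd_mat n S'" and eq: "S * S = S' * S'"
  shows "S = S'"
proof -
  have c: "S \<in> carrier_mat n n" "S' \<in> carrier_mat n n" and
    t: "transpose_mat S = S" "transpose_mat S' = S'" using S S' by (auto simp: psd_mat_def)
  define D where "D = S - S'"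
  have D: "D \<in> carrier_mat n n" using c by (auto simp: D_def)
  have Dx: "D *\<^sub>v x = S *\<^sub>v x - S' *\<^sub>v x" if "x \<in> carrier_vec n" for x
    using c that unfolding D_def by (intro minus_mult_distrib_mat_vec)
  have tD: "transpose_mat D = D" unfolding D_def
    using c t by (intro eq_matI) (auto simp: symmetric_mat_index[OF c(1) t(1)] symmetric_mat_index[OF c(2) t(2)])
  obtain e where "sorted_eigenbasis n D e" using spectral_theorem[OF D tD] by blast
  note e = sorted_eigenbasisD[OF this]
  have ec: "e i \<in> carrier_vec n" if "i < n" for i using e(1) that by (simp add: orthonormal_family_def)
  have zero: "D *\<^sub>v e i = 0\<^sub>v n" if i: "i < n" for i
  proof -
    define v where "v = e i"
    define k where "k = eig D (i + 1)"
    have v: "v \<in> carrier_vec n" "D *\<^sub>v v = k \<cdot>\<^sub>v v" "v \<bullet> v = 1"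
      using ec[OF i] e(2)[OF i] e(1) i by (simp_all add: v_def k_def orthonormal_family_def)
    have Sv: "S *\<^sub>v v \<in> carrier_vec n" "S' *\<^sub>v v \<in> carrier_vec n" using c v by auto
    have pos: "v \<bullet> (S *\<^sub>v v) \<ge> 0" "v \<bullet> (S' *\<^sub>v v) \<ge> 0"
      using S S' v by (auto simp: psd_mat_def)
    have k: "k = v \<bullet> (S *\<^sub>v v) - v \<bullet> (S' *\<^sub>v v)"
    proof -
      have "v \<bullet> (D *\<^sub>v v) = v \<bullet> (S *\<^sub>v v) - v \<bullet> (S' *\<^sub>v v)"
        unfolding Dx[OF v(1)] using v(1) Sv by (rule scalar_prod_minus_distrib)
      then show ?thesis using v by simp
    qed
    have a: "v \<bullet> (S *\<^sub>v (D *\<^sub>v v)) = k * (v \<bullet> (S *\<^sub>v v))"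
      using v c Sv by (simp add: mult_mat_vec[of _ n n])
    have b: "v \<bullet> (D *\<^sub>v (S' *\<^sub>v v)) = k * (v \<bullet> (S' *\<^sub>v v))"
      using scalar_prod_symmetric[OF D tD v(1) Sv(2)] v Sv by simp
    have "v \<bullet> (S *\<^sub>v (D *\<^sub>v v)) = v \<bullet> (S *\<^sub>v (S *\<^sub>v v)) - v \<bullet> (S *\<^sub>v (S' *\<^sub>v v))"
    proof -
      have "S *\<^sub>v (D *\<^sub>v v) = S *\<^sub>v (S *\<^sub>v v) - S *\<^sub>v (S' *\<^sub>v v)"
        unfolding Dx[OF v(1)] using c(1) Sv by (rule mult_minus_distrib_mat_vec)
      then show ?thesis using v(1) c Sv by (simp add: scalar_prod_minus_distrib[of _ n])
    qed
    moreover have "v \<bullet> (D *\<^sub>v (S' *\<^sub>v v)) = v \<bullet> (S *\<^sub>v (S' *\<^sub>v v)) - v \<bullet> (S' *\<^sub>v (S' *\<^sub>v v))"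
      unfolding Dx[OF Sv(2)] using v(1) c Sv by (simp add: scalar_prod_minus_distrib[of _ n])
    moreover have "S *\<^sub>v (S *\<^sub>v v) = S' *\<^sub>v (S' *\<^sub>v v)"
      using eq c v(1) by (metis assoc_mult_mat_vec)
    ultimately have "k * (v \<bullet> (S *\<^sub>v v) + v \<bullet> (S' *\<^sub>v v)) = 0"
      using a b by (simp add: algebra_simps)
    then have "k = 0" using pos k by auto
    then show ?thesis using v by (auto simp: v_def intro!: eq_vecI)
  qed
  have "S *\<^sub>v x = S' *\<^sub>v x" if x: "x \<in> carrier_vec n" for x
  proof -
    have Dxc: "D *\<^sub>v x \<in> carrier_vec n" using D x by simp
    have "e i \<bullet> (D *\<^sub>v x) = 0" if i: "i < n" for i
      using scalar_prod_symmetric[OF D tD ec[OF i] x] zero[OF i] x by simp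
    then have "(D *\<^sub>v x) \<bullet> (D *\<^sub>v x) = 0" using parseval[OF e(1) Dxc Dxc] by simp
    then have z: "D *\<^sub>v x = 0\<^sub>v n" using scalar_prod_self_pos[OF Dxc] by fastforce
    show ?thesis
    proof (rule eq_vecI)
      fix i assume "i < dim_vec (S' *\<^sub>v x)"
      then have i: "i < n" using c by simp
      have "(S *\<^sub>v x - S' *\<^sub>v x) $ i = 0" using z i unfolding Dx[OF x] by simp
      then show "(S *\<^sub>v x) $ i = (S' *\<^sub>v x) $ i" using i c by simp
    qed (use c in auto)
  qed
  then show ?thesis by (rule mat_eq_if_mult_vec_eq[OF c])
qed

lemma psd_sqrt_exists:
  assumes "psd_mat n A"
  shows "\<exists>S. psd_mat n S \<and> S * S = A"
proof -
  have A: "A \<in> carrier_mat n n" and tA: "transpose_mat A = A"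
    and pos: "\<And>v. v \<in> carrier_vec n \<Longrightarrow> v \<bullet> (A *\<^sub>v v) \<ge> 0" using assms by (auto simp: psd_mat_def)
  obtain e where "sorted_eigenbasis n A e" using spectral_theorem[OF A tA] by blast
  note e = sorted_eigenbasisD[OF this]
  have ec: "e i \<in> carrier_vec n" if "i < n" for i using e(1) that by (simp add: orthonormal_family_def)
  have ee: "e i \<bullet> e j = (if i = j then 1 else 0)" if "i < n" "j < n" for i j
    using e(1) that by (simp add: orthonormal_family_def)
  have d0: "eig A (i + 1) \<ge> 0" if i: "i < n" for i
    using pos[OF ec[OF i]] e(2)[OF i] ee[OF i i] ec[OF i] by simp
  define s where "s i = sqrt (eig A (i + 1))" for i
  have ss: "s i * s i = eig A (i + 1)" if "i < n" for i using d0[OF that] by (simp add: s_def)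
  define S where "S = mat n n (\<lambda>(a, b). \<Sum>i<n. s i * e i $ a * e i $ b)"
  have S: "S \<in> carrier_mat n n" by (simp add: S_def)
  have tS: "transpose_mat S = S"
    by (rule eq_matI) (auto simp: S_def mult_ac)
  have Sx: "(S *\<^sub>v x) $ a = (\<Sum>i<n. s i * (e i \<bullet> x) * e i $ a)" if x: "x \<in> carrier_vec n" and a: "a < n" for x a
  proof -
    have "(S *\<^sub>v x) $ a = (\<Sum>b<n. (\<Sum>i<n. s i * e i $ a * e i $ b) * x $ b)"
      using a x by (simp add: S_def scalar_prod_def lessThan_atLeast0)
    also have "\<dots> = (\<Sum>i<n. \<Sum>b<n. s i * e i $ a * e i $ b * x $ b)"
      unfolding sum_distrib_right by (rule sum.swap)
    also have "\<dots> = (\<Sum>i<n. s i * (e i \<bullet> x) * e i $ a)"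
      using x by (intro sum.cong refl)
        (simp add: scalar_prod_def lessThan_atLeast0 sum_distrib_left sum_distrib_right mult_ac)
    finally show ?thesis .
  qed
  have Se: "S *\<^sub>v e j = s j \<cdot>\<^sub>v e j" if j: "j < n" for j
  proof (rule eq_vecI)
    fix a assume "a < dim_vec (s j \<cdot>\<^sub>v e j)"
    then have a: "a < n" using ec[OF j] by simp
    have "(S *\<^sub>v e j) $ a = (\<Sum>i<n. if i = j then s i * e i $ a else 0)"
      unfolding Sx[OF ec[OF j] a] by (intro sum.cong refl) (use j in \<open>simp add: ee\<close>)
    also have "\<dots> = s j * e j $ a" using j by simp
    finally show "(S *\<^sub>v e j) $ a = (s j \<cdot>\<^sub>v e j) $ a" using a ec[OF j] by simp
  qed (use S ec[OF j] in auto)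
  have psd: "psd_mat n S" unfolding psd_mat_def
  proof (intro conjI ballI S tS)
    fix v :: "real vec" assume v: "v \<in> carrier_vec n"
    have "v \<bullet> (S *\<^sub>v v) = (\<Sum>i<n. s i * (e i \<bullet> v)\<^sup>2)"
      by (rule quadratic_form_eigenbasis[OF S tS e(1) Se v])
    also have "\<dots> \<ge> 0" by (intro sum_nonneg mult_nonneg_nonneg) (auto simp: s_def d0[unfolded Suc_eq_plus1[symmetric]])
    finally show "v \<bullet> (S *\<^sub>v v) \<ge> 0" .
  qed
  have "S * S = A"
  proof (rule mat_eq_if_mult_vec_eq)
    fix x :: "real vec" assume x: "x \<in> carrier_vec n"
    have y: "S *\<^sub>v x \<in> carrier_vec n" "S *\<^sub>v (S *\<^sub>v x) \<in> carrier_vec n" "A *\<^sub>v x \<in> carrier_vec n"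
      using S A x by auto
    define z where "z = S *\<^sub>v (S *\<^sub>v x) - A *\<^sub>v x"
    have z: "z \<in> carrier_vec n" using y by (simp add: z_def)
    have "e i \<bullet> z = 0" if i: "i < n" for i
    proof -
      have "e i \<bullet> (S *\<^sub>v (S *\<^sub>v x)) = s i * (s i * (e i \<bullet> x))"
        using scalar_prod_symmetric[OF S tS ec[OF i] y(1)] scalar_prod_symmetric[OF S tS ec[OF i] x]
          Se[OF i] ec[OF i] x y by simp
      moreover have "e i \<bullet> (A *\<^sub>v x) = eig A (i + 1) * (e i \<bullet> x)"
        using scalar_prod_symmetric[OF A tA ec[OF i] x] e(2)[OF i] ec[OF i] x by simp
      ultimately show ?thesis unfolding z_def
        using scalar_prod_minus_distrib[OF ec[OF i] y(2,3)] ss[OF i] by simp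
    qed
    then have "z \<bullet> z = 0" using parseval[OF e(1) z z] by simp
    then have z0: "z = 0\<^sub>v n" using scalar_prod_self_pos[OF z] by fastforce
    have "S *\<^sub>v (S *\<^sub>v x) = A *\<^sub>v x"
    proof (rule eq_vecI)
      fix i assume "i < dim_vec (A *\<^sub>v x)"
      then have i: "i < n" using A by simp
      have "z $ i = 0" using z0 i by simp
      then show "(S *\<^sub>v (S *\<^sub>v x)) $ i = (A *\<^sub>v x) $ i" using i y A by (simp add: z_def)
    qed (use A S in auto)
    then show "S * S *\<^sub>v x = A *\<^sub>v x" using S x by simp
  qed (use A S in auto)
  with psd show ?thesis by blast
qed

text \<open>\<open>psd_sqrt\<close> is a definite description, so its properties require both
  existence and uniqueness.\<close>

lemma psd_sqrt:
  assumes "psd_mat n A"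
  shows "psd_mat n (psd_sqrt A)" "psd_sqrt A * psd_sqrt A = A"
proof -
  have n: "dim_row A = n" using assms by (auto simp: psd_mat_def)
  have "\<exists>!S. psd_mat (dim_row A) S \<and> S * S = A"
    unfolding n using psd_sqrt_exists[OF assms] psd_sqrt_unique by blast
  from theI'[OF this] show "psd_mat n (psd_sqrt A)" "psd_sqrt A * psd_sqrt A = A"
    unfolding psd_sqrt_def n by blast+
qed

section \<open>Matrix norms, quadratic forms and eigenvalue comparison\<close>

lemma scalar_prod_cauchy_schwarz:
  fixes x y :: "real vec"
  assumes "x \<in> carrier_vec n" "y \<in> carrier_vec n"
  shows "(x \<bullet> y)\<^sup>2 \<le> (x \<bullet> x) * (y \<bullet> y)"
  using assms Cauchy_Schwarz_ineq_sum[of "\<lambda>i. x $ i" "\<lambda>i. y $ i" "{..<n}"]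
  by (simp add: scalar_prod_def lessThan_atLeast0 power2_eq_square)

text \<open>\<open>mat_opnorm\<close> is a supremum of reals and bounds its members only once their
  set is known to be bounded; the Frobenius norm of \<open>A\<close> is such a bound.\<close>

lemma vnorm_mult_mat_vec_le_opnorm:
  assumes A: "A \<in> carrier_mat m n" and x: "x \<in> carrier_vec n" "vnorm x \<le> 1"
  shows "vnorm (A *\<^sub>v x) \<le> mat_opnorm A"
proof -
  define c where "c = (\<Sum>i<m. row A i \<bullet> row A i)"
  have "vnorm (A *\<^sub>v v) \<le> sqrt c" if v: "v \<in> carrier_vec n" "vnorm v \<le> 1" for v
  proof -
    have vv: "v \<bullet> v \<le> 1" using v by (simp add: vnorm_def)
    have "(A *\<^sub>v v) \<bullet> (A *\<^sub>v v) = (\<Sum>i<m. (row A i \<bullet> v)\<^sup>2)"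
      using A v by (subst scalar_prod_self[of _ m]) auto
    also have "\<dots> \<le> (\<Sum>i<m. (row A i \<bullet> row A i) * (v \<bullet> v))"
      using A v by (intro sum_mono scalar_prod_cauchy_schwarz[of _ n]) auto
    also have "\<dots> \<le> (\<Sum>i<m. (row A i \<bullet> row A i) * 1)"
      using A vv by (intro sum_mono mult_left_mono) (auto simp: scalar_prod_self[of _ n] intro: sum_nonneg)
    finally show ?thesis by (simp add: vnorm_def c_def)
  qed
  then have "bdd_above ((\<lambda>v. vnorm (A *\<^sub>v v)) ` {v \<in> carrier_vec n. vnorm v \<le> 1})"
    by (intro bdd_aboveI[of _ "sqrt c"]) auto
  then show ?thesis unfolding mat_opnorm_def using A x by (intro cSUP_upper) auto
qed

lemma quadratic_form_le_opnorm:
  assumes A: "A \<in> carrier_mat n n" and x: "x \<in> carrier_vec n"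
  shows "\<bar>x \<bullet> (A *\<^sub>v x)\<bar> \<le> mat_opnorm A * (x \<bullet> x)"
proof (cases "x = 0\<^sub>v n")
  case True
  have "A *\<^sub>v 0\<^sub>v n = 0\<^sub>v n" using A by (intro eq_vecI) auto
  then show ?thesis using True by simp
next
  case False
  define r where "r = vnorm x"
  have xx: "x \<bullet> x > 0" using scalar_prod_self_pos[OF x False] .
  then have r: "r > 0" "r * r = x \<bullet> x" by (simp_all add: r_def vnorm_def)
  define u where "u = (1 / r) \<cdot>\<^sub>v x"
  have u: "u \<in> carrier_vec n" using x by (simp add: u_def)
  have "u \<bullet> u = 1 / r * (1 / r * (x \<bullet> x))" using x by (simp add: u_def)
  then have uu: "u \<bullet> u = 1" using r(1) unfolding r(2)[symmetric] by simp
  have Au: "A *\<^sub>v u = (1 / r) \<cdot>\<^sub>v (A *\<^sub>v x)" using A x by (simp add: u_def mult_mat_vec[of _ n n])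
  have Auc: "A *\<^sub>v u \<in> carrier_vec n" using A u by simp
  have nu: "vnorm (A *\<^sub>v u) \<le> mat_opnorm A"
    using A u uu by (intro vnorm_mult_mat_vec_le_opnorm) (auto simp: vnorm_def)
  have "(u \<bullet> (A *\<^sub>v u))\<^sup>2 \<le> (A *\<^sub>v u) \<bullet> (A *\<^sub>v u)"
    using scalar_prod_cauchy_schwarz[OF u Auc] uu by simp
  then have "\<bar>u \<bullet> (A *\<^sub>v u)\<bar> \<le> vnorm (A *\<^sub>v u)"
    unfolding vnorm_def by (metis real_sqrt_abs real_sqrt_le_iff)
  then have "\<bar>u \<bullet> (A *\<^sub>v u)\<bar> \<le> mat_opnorm A" using nu by linarith
  moreover have "u \<bullet> (A *\<^sub>v u) = (x \<bullet> (A *\<^sub>v x)) / (x \<bullet> x)"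
  proof -
    have "u \<bullet> (A *\<^sub>v u) = 1 / r * (1 / r * (x \<bullet> (A *\<^sub>v x)))"
      unfolding Au using A x by (simp add: u_def)
    also have "\<dots> = (x \<bullet> (A *\<^sub>v x)) / (r * r)" by simp
    finally show ?thesis unfolding r(2) .
  qed
  ultimately show ?thesis using xx by (simp add: field_simps abs_divide)
qed

text \<open>The lower half of the Courant--Fischer principle: the range of \<open>G\<close> meets the span of the
  eigenvectors \<open>e (q - 1), \<dots>, e (n - 1)\<close>.\<close>

lemma eig_ge_on_subspace:
  fixes A G :: "real mat"
  assumes A: "A \<in> carrier_mat n n" and sym: "transpose_mat A = A"
    and G: "G \<in> carrier_mat n q" and q: "1 \<le> q" "q \<le> n"
    and inj: "\<And>x. x \<in> carrier_vec q \<Longrightarrow> x \<noteq> 0\<^sub>v q \<Longrightarrow> G *\<^sub>v x \<noteq> 0\<^sub>v n"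
    and form: "\<And>x. x \<in> carrier_vec q \<Longrightarrow>
      \<mu> * ((G *\<^sub>v x) \<bullet> (G *\<^sub>v x)) \<le> (G *\<^sub>v x) \<bullet> (A *\<^sub>v (G *\<^sub>v x))"
  shows "\<mu> \<le> eig A q"
proof -
  obtain e where "sorted_eigenbasis n A e" using spectral_theorem[OF A sym] by blast
  note e = sorted_eigenbasisD[OF this]
  have ec: "e i \<in> carrier_vec n" if "i < n" for i using e(1) that by (simp add: orthonormal_family_def)
  \<comment> \<open>Row \<open>q - 1\<close> is zero, so the square matrix \<open>M\<close> is
    singular. A kernel vector \<open>x\<close> yields a nonzero \<open>G x\<close> orthogonal to the
    first \<open>q - 1\<close> eigenvectors; the determinant thus replaces a dimension
    count.\<close>
  define M where "M = mat q q (\<lambda>(i, j). if i < q - 1 then e i \<bullet> col G j else 0)"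
  have M: "M \<in> carrier_mat q q" by (simp add: M_def)
  have "transpose_mat M *\<^sub>v unit_vec q (q - 1) = 0\<^sub>v q"
    using q by (subst mult_mat_unit_vec[of _ q q]) (auto simp: M_def intro!: eq_vecI)
  moreover have "unit_vec q (q - 1) \<noteq> (0\<^sub>v q :: real vec)"
  proof
    assume "unit_vec q (q - 1) = (0\<^sub>v q :: real vec)"
    then have "unit_vec q (q - 1) $ (q - 1) = (0\<^sub>v q :: real vec) $ (q - 1)" by simp
    then show False using q by simp
  qed
  ultimately have "det (transpose_mat M) = 0"
    using det_0_iff_vec_prod_zero_field[of "transpose_mat M" q] M
    by (metis transpose_carrier_mat unit_vec_carrier)
  then have "det M = 0" using det_transpose[OF M] by simp
  then obtain x where x: "x \<in> carrier_vec q" "x \<noteq> 0\<^sub>v q" "M *\<^sub>v x = 0\<^sub>v q"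
    using det_0_iff_vec_prod_zero_field[OF M] by blast
  define y where "y = G *\<^sub>v x"
  have y: "y \<in> carrier_vec n" using G x by (simp add: y_def)
  have ey: "e i \<bullet> y = 0" if i: "i < q - 1" for i
  proof -
    have i': "i < n" using i q by simp
    have "e i \<bullet> y = (transpose_mat G *\<^sub>v e i) \<bullet> x"
      unfolding y_def using transpose_vec_mult_scalar[OF G x(1) ec[OF i']] by simp
    also have "\<dots> = (\<Sum>j<q. (col G j \<bullet> e i) * x $ j)"
      using G x by (simp add: scalar_prod_def[of _ x] lessThan_atLeast0)
    also have "\<dots> = (\<Sum>j<q. (e i \<bullet> col G j) * x $ j)"
      using G ec[OF i'] by (intro sum.cong refl) (simp add: comm_scalar_prod[of _ n])
    also have "\<dots> = (M *\<^sub>v x) $ i"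
      using i x(1) by (simp add: M_def scalar_prod_def[of _ x] lessThan_atLeast0)
    finally show ?thesis using x(3) i by simp
  qed
  have yy: "y \<bullet> y > 0" using scalar_prod_self_pos[OF y] inj[OF x(1,2)] by (simp add: y_def)
  have "\<mu> * (y \<bullet> y) \<le> y \<bullet> (A *\<^sub>v y)" using form[OF x(1)] by (simp add: y_def)
  also have "\<dots> = (\<Sum>i<n. eig A (i + 1) * (e i \<bullet> y)\<^sup>2)"
    by (rule quadratic_form_eigenbasis[OF A sym e(1,2) y])
  also have "\<dots> \<le> (\<Sum>i<n. eig A q * (e i \<bullet> y)\<^sup>2)"
  proof (rule sum_mono)
    fix i assume i: "i \<in> {..<n}"
    show "eig A (i + 1) * (e i \<bullet> y)\<^sup>2 \<le> eig A q * (e i \<bullet> y)\<^sup>2"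
    proof (cases "i < q - 1")
      case False
      then have "eig A (i + 1) \<le> eig A q" using e(3)[of "q - 1" i] i q by simp
      then show ?thesis by (rule mult_right_mono) simp
    qed (simp add: ey)
  qed
  also have "\<dots> = eig A q * (y \<bullet> y)"
    unfolding parseval[OF e(1) y y, symmetric] by (simp add: sum_distrib_left power2_eq_square)
  finally show ?thesis using yy by simp
qed

lemma eig_anti:
  assumes "A \<in> carrier_mat n n" "transpose_mat A = A" "i \<le> j" "j < n"
  shows "eig A (j + 1) \<le> eig A (i + 1)"
  using spectral_theorem[OF assms(1,2)] sorted_eigenbasisD(3)[OF _ assms(3,4)] by blast

text \<open>With P the square root of S and x = P y, the form of B at x is the form of P B P at y,
  while x.x is the form of S at y and hence lies between c and C times y.y. This turns the bounds on
  the eigenvalues \<nu> into form bounds for the Brownian integral itself.\<close>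

lemma sandwich_form_bounds:
  assumes pd: "pd_mat n S" and ev: "\<And>x. eigenvalue S x \<Longrightarrow> c \<le> x \<and> x \<le> C"
    and B: "B \<in> carrier_mat n n" "transpose_mat B = B" and n: "n \<ge> 1"
    and lo: "l \<le> eig (psd_sqrt S * B * psd_sqrt S) n" "l \<ge> 0"
    and up: "eig (psd_sqrt S * B * psd_sqrt S) 1 \<le> u"
    and c: "c > 0" and x: "x \<in> carrier_vec n"
  shows "l / C * (x \<bullet> x) \<le> x \<bullet> (B *\<^sub>v x)" "x \<bullet> (B *\<^sub>v x) \<le> u / c * (x \<bullet> x)"
proof -
  have S: "S \<in> carrier_mat n n" "transpose_mat S = S" using pd by (auto simp: pd_mat_def)
  have psd: "psd_mat n S"
    unfolding psd_mat_def
  proof (intro conjI ballI S)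
    fix v :: "real vec" assume v: "v \<in> carrier_vec n"
    show "v \<bullet> (S *\<^sub>v v) \<ge> 0"
    proof (cases "v = 0\<^sub>v n")
      case True
      then show ?thesis using S by simp
    next
      case False
      then show ?thesis using pd v by (auto simp: pd_mat_def intro: less_imp_le)
    qed
  qed
  define P where "P = psd_sqrt S"
  have P: "P \<in> carrier_mat n n" "transpose_mat P = P" "P * P = S"
    using psd_sqrt[OF psd] by (auto simp: P_def psd_mat_def)
  have PPv: "P *\<^sub>v (P *\<^sub>v v) = S *\<^sub>v v" if "v \<in> carrier_vec n" for v
    using P that by (metis assoc_mult_mat_vec)
  have "det P \<noteq> 0"
  proof
    assume "det P = 0"
    then obtain v where v: "v \<in> carrier_vec n" "v \<noteq> 0\<^sub>v n" "P *\<^sub>v v = 0\<^sub>v n"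
      using det_0_iff_vec_prod_zero_field[OF P(1)] by blast
    have "P *\<^sub>v 0\<^sub>v n = 0\<^sub>v n" using P(1) by (intro eq_vecI) auto
    then have "S *\<^sub>v v = 0\<^sub>v n" using PPv[OF v(1)] v(3) by simp
    then have "v \<bullet> (S *\<^sub>v v) = 0" using v by simp
    then show False using pd v unfolding pd_mat_def by fastforce
  qed
  \<comment> \<open>The adjugate provides the preimage of \<open>x\<close> under \<open>P\<close>
    explicitly.\<close>
  define y where "y = (1 / det P) \<cdot>\<^sub>v (adj_mat P *\<^sub>v x)"
  have adj: "adj_mat P \<in> carrier_mat n n" "P * adj_mat P = det P \<cdot>\<^sub>m 1\<^sub>m n" using adj_mat[OF P(1)] by auto
  have y: "y \<in> carrier_vec n" using adj x by (simp add: y_def)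
  have Py: "P *\<^sub>v y = x"
  proof -
    have "P *\<^sub>v y = (1 / det P) \<cdot>\<^sub>v ((P * adj_mat P) *\<^sub>v x)"
      using P(1) adj(1) x assoc_mult_mat_vec[OF P(1) adj(1) x] by (simp add: y_def mult_mat_vec[of _ n n])
    also have "(P * adj_mat P) *\<^sub>v x = det P \<cdot>\<^sub>v x"
      unfolding adj(2) using x by (intro eq_vecI) auto
    finally show ?thesis using \<open>det P \<noteq> 0\<close> x by (simp add: smult_smult_assoc)
  qed
  have evS: "c \<le> eig S (i + 1) \<and> eig S (i + 1) \<le> C" if "i < n" for i
    by (rule ev[OF eig_eigenvalue[OF S that]])
  have C: "C > 0" using evS[of 0] n c by simp
  have xx: "x \<bullet> x = y \<bullet> (S *\<^sub>v y)"
  proof -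
    have "x \<bullet> x = (P *\<^sub>v y) \<bullet> (P *\<^sub>v y)" using Py by simp
    also have "\<dots> = y \<bullet> (P *\<^sub>v (P *\<^sub>v y))" using P y scalar_prod_symmetric[OF P(1,2) y, of "P *\<^sub>v y"] by simp
    finally show ?thesis using PPv[OF y] by simp
  qed
  have xC: "x \<bullet> x \<le> C * (y \<bullet> y)"
    unfolding xx by (rule quadratic_form_le_max_eig[OF S y]) (use evS in blast)
  have xc: "c * (y \<bullet> y) \<le> x \<bullet> x"
    unfolding xx by (rule quadratic_form_ge_min_eig[OF S y]) (use evS in blast)
  define K where "K = P * B * P"
  have K: "K \<in> carrier_mat n n" using P B by (simp add: K_def)
  have tK: "transpose_mat K = K"
    using P B by (simp add: K_def transpose_mult[of _ n n _ n] assoc_mult_mat[of _ n n _ n _ n])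
  have xBx: "x \<bullet> (B *\<^sub>v x) = y \<bullet> (K *\<^sub>v y)"
  proof -
    have "K *\<^sub>v y = P *\<^sub>v (B *\<^sub>v x)" using P B y Py by (simp add: K_def assoc_mult_mat_vec[of _ n n _ n])
    then have "y \<bullet> (K *\<^sub>v y) = (P *\<^sub>v y) \<bullet> (B *\<^sub>v x)"
      using scalar_prod_symmetric[OF P(1,2) y, of "B *\<^sub>v x"] B x by simp
    then show ?thesis using Py by simp
  qed
  have ge: "eig K (i + 1) \<ge> l" if "i < n" for i
  proof -
    have "i \<le> n - 1" using that by simp
    then show ?thesis using eig_anti[OF K tK, of i "n - 1"] lo(1) n by (simp add: K_def P_def)
  qed
  have le: "eig K (i + 1) \<le> u" if "i < n" for i
    using eig_anti[OF K tK, of 0 i] that up by (simp add: K_def P_def)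
  have Kl: "l * (y \<bullet> y) \<le> x \<bullet> (B *\<^sub>v x)"
    unfolding xBx by (rule quadratic_form_ge_min_eig[OF K tK y ge])
  have Ku: "x \<bullet> (B *\<^sub>v x) \<le> u * (y \<bullet> y)"
    unfolding xBx by (rule quadratic_form_le_max_eig[OF K tK y le])
  have "l / C * (x \<bullet> x) \<le> l / C * (C * (y \<bullet> y))"
    using lo(2) C xC by (intro mult_left_mono) auto
  then show "l / C * (x \<bullet> x) \<le> x \<bullet> (B *\<^sub>v x)" using Kl C by simp
  have yy: "y \<bullet> y \<ge> 0" using y by (simp add: scalar_prod_self[of _ n] sum_nonneg)
  \<comment> \<open>The sign of \<open>u\<close> is needed to multiply the bound on
    \<open>y \<bullet> y\<close>; it follows since \<open>u\<close> dominates
    \<open>l\<close>.\<close>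
  have "u \<ge> l" using ge[of 0] le[of 0] n by simp
  then have "u \<ge> 0" using lo(2) by simp
  then have "u * (y \<bullet> y) \<le> u * ((x \<bullet> x) / c)"
    using xc c by (intro mult_left_mono) (auto simp: field_simps)
  then show "x \<bullet> (B *\<^sub>v x) \<le> u / c * (x \<bullet> x)" using Ku by simp
qed

section \<open>Square-integrable functions and integral operators\<close>

lemma L2_D:
  assumes "f \<in> L2 S"
  shows "f \<in> borel_measurable (lebesgue_on S)" "integrable (lebesgue_on S) (\<lambda>u. (f u)\<^sup>2)"
  using assms by (auto simp: L2_def)

lemma L2_mult_integrable:
  assumes f: "f \<in> L2 S" and g: "g \<in> L2 S"
  shows "integrable (lebesgue_on S) (\<lambda>u. f u * g u)"
proof (rule Bochner_Integration.integrable_bound)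
  show "integrable (lebesgue_on S) (\<lambda>u. (f u)\<^sup>2 + (g u)\<^sup>2)"
    using L2_D(2)[OF f] L2_D(2)[OF g] by (rule Bochner_Integration.integrable_add)
  show "(\<lambda>u. f u * g u) \<in> borel_measurable (lebesgue_on S)"
    using L2_D(1)[OF f] L2_D(1)[OF g] by (rule borel_measurable_times)
  have "\<bar>a * b\<bar> \<le> a\<^sup>2 + b\<^sup>2" for a b :: real
  proof -
    have "0 \<le> (\<bar>a\<bar> - \<bar>b\<bar>)\<^sup>2" by simp
    then have "2 * (\<bar>a\<bar> * \<bar>b\<bar>) \<le> a\<^sup>2 + b\<^sup>2" by (simp add: power2_diff)
    moreover have "0 \<le> \<bar>a\<bar> * \<bar>b\<bar>" by simp
    ultimately show ?thesis unfolding abs_mult by linarith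
  qed
  then show "AE u in lebesgue_on S. norm (f u * g u) \<le> norm ((f u)\<^sup>2 + (g u)\<^sup>2)"
    by (intro AE_I2) (simp add: order_trans[OF _ abs_ge_self])
qed

lemma L2_add:
  assumes f: "f \<in> L2 S" and g: "g \<in> L2 S"
  shows "(\<lambda>u. f u + g u) \<in> L2 S"
proof -
  have "integrable (lebesgue_on S) (\<lambda>u. (f u)\<^sup>2 + (g u)\<^sup>2 + 2 * (f u * g u))"
    using L2_D(2)[OF f] L2_D(2)[OF g] L2_mult_integrable[OF f g] by auto
  then show ?thesis using L2_D(1)[OF f] L2_D(1)[OF g] unfolding L2_def
    by (auto simp: power2_sum mult.assoc)
qed

lemma L2_scale: "f \<in> L2 S \<Longrightarrow> (\<lambda>u. c * f u) \<in> L2 S"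
  by (auto simp: L2_def power_mult_distrib)

lemma L2_zero: "(\<lambda>u. 0) \<in> L2 S"
  by (auto simp: L2_def)

lemma L2_sum: "(\<And>l. l \<in> I \<Longrightarrow> f l \<in> L2 S) \<Longrightarrow> (\<lambda>u. \<Sum>l\<in>I. f l u) \<in> L2 S"
  by (induction I rule: infinite_finite_induct) (auto intro: L2_zero L2_add)

lemma L2_inner_commute: "L2_inner S f g = L2_inner S g f"
  by (simp add: L2_inner_def mult.commute)

lemma L2_inner_add_left:
  assumes "f \<in> L2 S" "g \<in> L2 S" "h \<in> L2 S"
  shows "L2_inner S (\<lambda>u. f u + g u) h = L2_inner S f h + L2_inner S g h"
  using assms by (simp add: L2_inner_def distrib_right L2_mult_integrable)

lemma L2_inner_scale_left: "L2_inner S (\<lambda>u. c * f u) h = c * L2_inner S f h"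
  by (simp add: L2_inner_def mult.assoc)

lemma L2_inner_sum_left:
  assumes "\<And>l. l \<in> I \<Longrightarrow> f l \<in> L2 S" "h \<in> L2 S"
  shows "L2_inner S (\<lambda>u. \<Sum>l\<in>I. c l * f l u) h = (\<Sum>l\<in>I. c l * L2_inner S (f l) h)"
  using assms by (simp add: L2_inner_def sum_distrib_right mult.assoc L2_mult_integrable)

lemma L2_inner_self_nonneg: "L2_inner S f f \<ge> 0"
  by (simp add: L2_inner_def)

lemma L2_norm_nonneg: "L2_norm S f \<ge> 0"
  by (simp add: L2_norm_def L2_inner_self_nonneg)

lemma L2_norm_sq: "(L2_norm S f)\<^sup>2 = L2_inner S f f"
  by (simp add: L2_norm_def L2_inner_self_nonneg)

lemma L2_inner_cong_AE:
  assumes "AE u in lebesgue_on S. f u = f' u" "AE u in lebesgue_on S. g u = g' u"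
    and "f \<in> L2 S" "f' \<in> L2 S" "g \<in> L2 S" "g' \<in> L2 S"
  shows "L2_inner S f g = L2_inner S f' g'"
  unfolding L2_inner_def
proof (rule integral_cong_AE)
  show "AE u in lebesgue_on S. f u * g u = f' u * g' u"
    using assms(1,2) by eventually_elim simp
qed (use assms L2_D in \<open>auto intro!: borel_measurable_times\<close>)

text \<open>The discriminant criterion, including the degenerate case of a vanishing leading
  coefficient, which occurs for functions of norm zero.\<close>

lemma nonneg_quadratic_imp:
  fixes a b c :: real
  assumes "\<And>t. 0 \<le> a * t\<^sup>2 + 2 * b * t + c"
  shows "b\<^sup>2 \<le> a * c"
proof (cases "a = 0")
  case True
  have "b = 0"
  proof (rule ccontr)
    assume "b \<noteq> 0"
    \<comment> \<open>At this argument the affine function takes the value -1.\<close>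
    then show False using assms[of "- (c + 1) / (2 * b)"] True by (simp add: field_simps)
  qed
  then show ?thesis using True by simp
next
  case False
  have "a \<ge> 0"
  proof (rule ccontr)
    assume neg: "\<not> a \<ge> 0"
    \<comment> \<open>Chosen so that the quadratic term equals -(|c| + 1). Adding the values at
      \<open>t\<close> and \<open>- t\<close> cancels the linear term and leaves something
      negative.\<close>
    define t where "t = sqrt ((\<bar>c\<bar> + 1) / - a)"
    have "t\<^sup>2 = (\<bar>c\<bar> + 1) / - a" using neg by (simp add: t_def divide_nonneg_neg)
    then have "a * t\<^sup>2 = - (\<bar>c\<bar> + 1)" using neg by (simp add: field_simps)
    then show False using assms[of t] assms[of "- t"] by simp
  qed
  with False have a: "a > 0" by simp
  have "0 \<le> a * (- b / a)\<^sup>2 + 2 * b * (- b / a) + c" by (rule assms)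
  also have "\<dots> = (a * c - b\<^sup>2) / a" using a by (simp add: field_simps power2_eq_square)
  finally show ?thesis using a by (simp add: zero_le_divide_iff)
qed

text \<open>The averaged inner product on families of functions, in which the \<open>T\<close> observations
  \<open>(Z i t)\<^sub>i\<close> have the Gram matrix \<open>\<Omega>\<close>.\<close>

definition fam_inner ::
  "(nat \<Rightarrow> 'u::euclidean_space set) \<Rightarrow> nat \<Rightarrow> (nat \<Rightarrow> 'u \<Rightarrow> real) \<Rightarrow> (nat \<Rightarrow> 'u \<Rightarrow> real) \<Rightarrow> real" where
  "fam_inner C N f g = (\<Sum>i=1..N. L2_inner (C i) (f i) (g i)) / real N"

definition fam_L2 :: "(nat \<Rightarrow> 'u::euclidean_space set) \<Rightarrow> nat \<Rightarrow> (nat \<Rightarrow> 'u \<Rightarrow> real) set" where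
  "fam_L2 C N = {f. \<forall>i\<in>{1..N}. f i \<in> L2 (C i)}"

lemma fam_L2_add: "f \<in> fam_L2 C N \<Longrightarrow> g \<in> fam_L2 C N \<Longrightarrow> (\<lambda>i u. f i u + g i u) \<in> fam_L2 C N"
  by (auto simp: fam_L2_def intro: L2_add)

lemma fam_L2_scale: "f \<in> fam_L2 C N \<Longrightarrow> (\<lambda>i u. c * f i u) \<in> fam_L2 C N"
  by (auto simp: fam_L2_def intro: L2_scale)

lemma fam_L2_lincomb:
  "(\<And>l. l \<in> I \<Longrightarrow> f l \<in> fam_L2 C N) \<Longrightarrow> (\<lambda>i u. \<Sum>l\<in>I. c l * f l i u) \<in> fam_L2 C N"
  by (auto simp: fam_L2_def intro!: L2_sum L2_scale)

lemma fam_inner_commute: "fam_inner C N f g = fam_inner C N g f"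
  by (simp add: fam_inner_def L2_inner_commute)

lemma fam_inner_add_left:
  assumes "f \<in> fam_L2 C N" "g \<in> fam_L2 C N" "h \<in> fam_L2 C N"
  shows "fam_inner C N (\<lambda>i u. f i u + g i u) h = fam_inner C N f h + fam_inner C N g h"
proof -
  have "(\<Sum>i=1..N. L2_inner (C i) (\<lambda>u. f i u + g i u) (h i))
      = (\<Sum>i=1..N. L2_inner (C i) (f i) (h i) + L2_inner (C i) (g i) (h i))"
    using assms by (intro sum.cong refl L2_inner_add_left) (auto simp: fam_L2_def)
  then show ?thesis by (simp add: fam_inner_def sum.distrib add_divide_distrib)
qed

lemma fam_inner_add_right:
  assumes "f \<in> fam_L2 C N" "g \<in> fam_L2 C N" "h \<in> fam_L2 C N"
  shows "fam_inner C N h (\<lambda>i u. f i u + g i u) = fam_inner C N h f + fam_inner C N h g"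
  using fam_inner_add_left[OF assms] by (simp only: fam_inner_commute[of C N h])

lemma fam_inner_scale_left: "fam_inner C N (\<lambda>i u. c * f i u) h = c * fam_inner C N f h"
  by (simp add: fam_inner_def L2_inner_scale_left sum_distrib_left)

lemma fam_inner_lincomb_left:
  assumes "\<And>l. l \<in> I \<Longrightarrow> f l \<in> fam_L2 C N" "h \<in> fam_L2 C N"
  shows "fam_inner C N (\<lambda>i u. \<Sum>l\<in>I. c l * f l i u) h = (\<Sum>l\<in>I. c l * fam_inner C N (f l) h)"
proof -
  have "(\<Sum>i=1..N. L2_inner (C i) (\<lambda>u. \<Sum>l\<in>I. c l * f l i u) (h i))
      = (\<Sum>i=1..N. \<Sum>l\<in>I. c l * L2_inner (C i) (f l i) (h i))"
    using assms by (intro sum.cong refl L2_inner_sum_left) (auto simp: fam_L2_def)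
  also have "\<dots> = (\<Sum>l\<in>I. c l * (\<Sum>i=1..N. L2_inner (C i) (f l i) (h i)))"
    by (subst sum.swap) (simp add: sum_distrib_left)
  finally show ?thesis
    unfolding fam_inner_def times_divide_eq_right sum_divide_distrib[symmetric] by simp
qed

lemma fam_inner_self_nonneg: "fam_inner C N f f \<ge> 0"
  by (simp add: fam_inner_def L2_inner_self_nonneg sum_nonneg)

lemma fam_inner_cauchy_schwarz:
  assumes f: "f \<in> fam_L2 C N" and g: "g \<in> fam_L2 C N"
  shows "(fam_inner C N f g)\<^sup>2 \<le> fam_inner C N f f * fam_inner C N g g"
proof (rule nonneg_quadratic_imp)
  fix t :: real
  let ?tf = "\<lambda>i u. t * f i u"
  note tf = fam_L2_scale[OF f, of t]
  have "0 \<le> fam_inner C N (\<lambda>i u. ?tf i u + g i u) (\<lambda>i u. ?tf i u + g i u)"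
    by (rule fam_inner_self_nonneg)
  also have "\<dots> = fam_inner C N ?tf ?tf + fam_inner C N ?tf g + (fam_inner C N g ?tf + fam_inner C N g g)"
    using tf g by (simp add: fam_inner_add_left fam_inner_add_right fam_L2_add)
  also have "fam_inner C N ?tf ?tf = t * (t * fam_inner C N f f)"
    by (simp only: fam_inner_scale_left fam_inner_commute[of C N f ?tf])
  also have "fam_inner C N g ?tf = t * fam_inner C N f g"
    by (simp only: fam_inner_scale_left fam_inner_commute[of C N g ?tf])
  also have "fam_inner C N ?tf g = t * fam_inner C N f g" by (rule fam_inner_scale_left)
  finally show "0 \<le> fam_inner C N f f * t\<^sup>2 + 2 * fam_inner C N f g * t + fam_inner C N g g"
    by (simp add: power2_eq_square algebra_simps)
qed

text \<open>A single function is a family with one member.\<close>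

lemma L2_cauchy_schwarz:
  assumes "f \<in> L2 S" "g \<in> L2 S"
  shows "(L2_inner S f g)\<^sup>2 \<le> L2_inner S f f * L2_inner S g g"
  using fam_inner_cauchy_schwarz[of "\<lambda>_. f" "\<lambda>_. S" 1 "\<lambda>_. g"] assms
  by (simp add: fam_inner_def fam_L2_def)

lemma L2_inner_self_sum_le:
  assumes f: "\<And>j. j \<in> {1..k} \<Longrightarrow> f j \<in> L2 S"
  shows "L2_inner S (\<lambda>u. \<Sum>j=1..k. f j u) (\<lambda>u. \<Sum>j=1..k. f j u)
    \<le> real k * (\<Sum>j=1..k. L2_inner S (f j) (f j))"
proof -
  have fs: "(\<lambda>u. \<Sum>j=1..k. f j u) \<in> L2 S" using f by (rule L2_sum)
  have "L2_inner S (\<lambda>u. \<Sum>j=1..k. f j u) (\<lambda>u. \<Sum>j=1..k. f j u)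
    \<le> (LINT u|lebesgue_on S. real k * (\<Sum>j=1..k. f j u * f j u))"
    unfolding L2_inner_def
  proof (rule integral_mono)
    show "integrable (lebesgue_on S) (\<lambda>u. (\<Sum>j=1..k. f j u) * (\<Sum>j=1..k. f j u))"
      by (rule L2_mult_integrable[OF fs fs])
    show "integrable (lebesgue_on S) (\<lambda>u. real k * (\<Sum>j=1..k. f j u * f j u))"
      using f by (intro integrable_mult_right Bochner_Integration.integrable_sum L2_mult_integrable) auto
    show "(\<Sum>j=1..k. f j u) * (\<Sum>j=1..k. f j u) \<le> real k * (\<Sum>j=1..k. f j u * f j u)" for u
      using Cauchy_Schwarz_ineq_sum[of "\<lambda>_. 1" "\<lambda>j. f j u" "{1..k}"] by (simp add: power2_eq_square)
  qed
  also have "\<dots> = real k * (\<Sum>j=1..k. L2_inner S (f j) (f j))"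
    unfolding L2_inner_def using f by (simp add: L2_mult_integrable)
  finally show ?thesis .
qed

section \<open>Linearity and norm bounds for integral operators\<close>

lemma int_op_section_measurable:
  assumes "L2_integral_operator S' S K" "u \<in> S"
  shows "(\<lambda>v. K u v) \<in> borel_measurable (lebesgue_on S')"
proof -
  have "(\<lambda>(u, v). K u v) \<in> borel_measurable (lebesgue_on S \<Otimes>\<^sub>M lebesgue_on S')"
    using assms by (simp add: L2_integral_operator_def)
  from measurable_Pair2[OF this, of u] show ?thesis using assms(2) by simp
qed

text \<open>Linearity holds only for almost every \<open>u\<close>: for each function the defining
  integral exists off a null set. Only finitely many functions occur, so these null sets can be
  discarded together.\<close>

lemma int_op_lincomb:
  fixes q :: nat
  assumes K: "L2_integral_operator S' S K"
    and f: "f \<in> L2 S'" and \<phi>: "\<And>l. l < q \<Longrightarrow> \<phi> l \<in> L2 S'" and \<eta>: "\<eta> \<in> L2 S'"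
    and eq: "AE v in lebesgue_on S'. f v = (\<Sum>l<q. \<phi> l v * c l) + \<eta> v"
  shows "AE u in lebesgue_on S. int_op S' K f u
    = (\<Sum>l<q. c l * int_op S' K (\<phi> l) u) + int_op S' K \<eta> u"
proof -
  have int: "AE u in lebesgue_on S. integrable (lebesgue_on S') (\<lambda>v. K u v * g v)" if "g \<in> L2 S'" for g
    using K that by (simp add: L2_integral_operator_def)
  have "AE u in lebesgue_on S. \<forall>l<q. integrable (lebesgue_on S') (\<lambda>v. K u v * \<phi> l v)"
  proof -
    have "\<forall>l. AE u in lebesgue_on S. l < q \<longrightarrow> integrable (lebesgue_on S') (\<lambda>v. K u v * \<phi> l v)"
    proof
      fix l :: nat
      show "AE u in lebesgue_on S. l < q \<longrightarrow> integrable (lebesgue_on S') (\<lambda>v. K u v * \<phi> l v)"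
        by (cases "l < q") (simp_all add: int \<phi>)
    qed
    then show ?thesis unfolding AE_all_countable .
  qed
  moreover note int[OF \<eta>]
  moreover have "AE u in lebesgue_on S. u \<in> space (lebesgue_on S)" by (rule AE_space)
  ultimately show ?thesis
  proof eventually_elim
    case (elim u)
    have u: "u \<in> S" using elim(3) by simp
    note Ku = int_op_section_measurable[OF K u]
    have "int_op S' K f u = (LINT v|lebesgue_on S'. (\<Sum>l<q. c l * (K u v * \<phi> l v)) + K u v * \<eta> v)"
      unfolding int_op_def
    proof (rule integral_cong_AE)
      show "AE v in lebesgue_on S'. K u v * f v = (\<Sum>l<q. c l * (K u v * \<phi> l v)) + K u v * \<eta> v"
        using eq by eventually_elim (simp add: distrib_left sum_distrib_left mult_ac)
      show "(\<lambda>v. K u v * f v) \<in> borel_measurable (lebesgue_on S')"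
        by (intro borel_measurable_times Ku L2_D(1)[OF f])
      show "(\<lambda>v. (\<Sum>l<q. c l * (K u v * \<phi> l v)) + K u v * \<eta> v) \<in> borel_measurable (lebesgue_on S')"
        by (intro borel_measurable_times borel_measurable_add borel_measurable_sum borel_measurable_const
          Ku L2_D(1)[OF \<eta>] L2_D(1)[OF \<phi>]) simp
    qed
    also have "\<dots> = (\<Sum>l<q. c l * int_op S' K (\<phi> l) u) + int_op S' K \<eta> u"
    proof -
      have "integrable (lebesgue_on S') (\<lambda>v. c l * (K u v * \<phi> l v))" if "l < q" for l
        using elim(1) that by simp
      then have "integrable (lebesgue_on S') (\<lambda>v. \<Sum>l<q. c l * (K u v * \<phi> l v))"
        and "(LINT v|lebesgue_on S'. (\<Sum>l<q. c l * (K u v * \<phi> l v)))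
          = (\<Sum>l<q. LINT v|lebesgue_on S'. c l * (K u v * \<phi> l v))"
        by auto
      then show ?thesis
        unfolding int_op_def using elim(2) by (simp only: Bochner_Integration.integral_add integral_mult_right_zero)
    qed
    finally show ?case .
  qed
qed

text \<open>The operator norm sees only the unit ball; \<open>key\<close> is the scaling of
  \<open>f\<close> into it.\<close>

lemma int_op_norm_le:
  assumes K: "L2_integral_operator S' S K" and c: "L2_opnorm S' S (int_op S' K) \<le> ennreal c" "c > 0"
    and f: "f \<in> L2 S'"
  shows "L2_inner S (int_op S' K f) (int_op S' K f) \<le> c\<^sup>2 * L2_inner S' f f"
proof -
  have unit: "L2_norm S (int_op S' K g) \<le> c" if "g \<in> L2 S'" "L2_norm S' g \<le> 1" for g
  proof -
    have "ennreal (L2_norm S (int_op S' K g)) \<le> L2_opnorm S' S (int_op S' K)"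
      unfolding L2_opnorm_def using that by (intro SUP_upper) auto
    also have "\<dots> \<le> ennreal c" by (rule c)
    finally show ?thesis using c by (simp add: ennreal_le_iff)
  qed
  have sc: "int_op S' K (\<lambda>v. a * f v) = (\<lambda>u. a * int_op S' K f u)" for a
  proof
    fix u
    have "(\<lambda>v. K u v * (a * f v)) = (\<lambda>v. a * (K u v * f v))" by (auto simp: mult_ac)
    then show "int_op S' K (\<lambda>v. a * f v) u = a * int_op S' K f u" by (simp add: int_op_def)
  qed
  have ii: "L2_inner T (\<lambda>u. a * g u) (\<lambda>u. a * g u) = a\<^sup>2 * L2_inner T g g" for a g and T :: "'x::euclidean_space set"
    by (simp add: L2_inner_scale_left L2_inner_commute[of T g "\<lambda>u. a * g u"] power2_eq_square)
  have key: "a\<^sup>2 * L2_inner S (int_op S' K f) (int_op S' K f) \<le> c\<^sup>2" if "a\<^sup>2 * L2_inner S' f f \<le> 1" for a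
  proof -
    have "L2_norm S' (\<lambda>v. a * f v) \<le> 1" using that by (simp add: L2_norm_def ii)
    then have "L2_norm S (\<lambda>u. a * int_op S' K f u) \<le> c"
      using unit[of "\<lambda>v. a * f v"] L2_scale[OF f] by (simp add: sc)
    then have "(L2_norm S (\<lambda>u. a * int_op S' K f u))\<^sup>2 \<le> c\<^sup>2"
      using L2_norm_nonneg by (intro power_mono)
    then show ?thesis by (simp add: L2_norm_sq ii)
  qed
  define x where "x = L2_inner S' f f"
  define y where "y = L2_inner S (int_op S' K f) (int_op S' K f)"
  have xy: "x \<ge> 0" "y \<ge> 0" by (simp_all add: x_def y_def L2_inner_self_nonneg)
  show ?thesis
  proof (cases "x = 0")
    case True
    have "y = 0"
    proof (rule ccontr)
      assume "y \<noteq> 0"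
      then have y: "y > 0" using xy by simp
      \<comment> \<open>Every multiple of a function of norm zero lies in the unit ball. This
        multiple would have an image of squared norm \<open>c\<^sup>2 + 1\<close>.\<close>
      have "(sqrt ((c\<^sup>2 + 1) / y))\<^sup>2 * y \<le> c\<^sup>2"
        unfolding y_def by (rule key) (use True in \<open>simp add: x_def\<close>)
      then show False using y by simp
    qed
    then show ?thesis using True by (simp add: x_def[symmetric] y_def[symmetric])
  next
    case False
    then have x: "x > 0" using xy by simp
    have "(sqrt (1 / x))\<^sup>2 * y \<le> c\<^sup>2"
      unfolding y_def by (rule key) (use x in \<open>simp add: x_def[symmetric]\<close>)
    then have "y \<le> c\<^sup>2 * x" using x by (simp add: field_simps)
    then show ?thesis by (simp add: x_def y_def)
  qed
qed

lemma int_op_L2: "L2_integral_operator S' S K \<Longrightarrow> f \<in> L2 S' \<Longrightarrow> int_op S' K f \<in> L2 S"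
  by (simp add: L2_integral_operator_def)

text \<open>\<open>A\<close>, \<open>X\<close>, \<open>E\<close> stand for the common component, the sieve error and the noise.\<close>

lemma gram_remainder_bound:
  fixes \<Lambda> :: "nat \<Rightarrow> nat \<Rightarrow> 'u::euclidean_space \<Rightarrow> real" and g :: "nat \<Rightarrow> nat \<Rightarrow> real"
  assumes \<Lambda>: "\<And>l. l < q \<Longrightarrow> (\<lambda>i. \<Lambda> i l) \<in> fam_L2 C N"
    and X: "\<And>t. t \<in> I \<Longrightarrow> X t \<in> fam_L2 C N" and E: "\<And>t. t \<in> I \<Longrightarrow> E t \<in> fam_L2 C N"
    and A_def: "\<And>t. A t = (\<lambda>i u. \<Sum>l<q. g l t * \<Lambda> i l u)"
    and Y_def: "\<And>t. Y t = (\<lambda>i u. (A t i u + X t i u) + E t i u)"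
  defines "ip \<equiv> fam_inner C N"
  shows "(\<Sum>t\<in>I. \<Sum>s\<in>I. (ip (Y t) (Y s) - ip (A t) (A s))\<^sup>2) \<le>
    8 * (2 * (\<Sum>t\<in>I. ip (A t) (A t)) * (\<Sum>t\<in>I. ip (X t) (X t)) + (\<Sum>t\<in>I. ip (X t) (X t))\<^sup>2
      + 2 * (\<Sum>t\<in>I. \<Sum>l<q. (g l t)\<^sup>2) * (\<Sum>t\<in>I. \<Sum>l<q. (ip (\<lambda>i. \<Lambda> i l) (E t))\<^sup>2)
      + 2 * (\<Sum>t\<in>I. ip (X t) (X t)) * (\<Sum>t\<in>I. ip (E t) (E t))
      + (\<Sum>t\<in>I. \<Sum>s\<in>I. (ip (E t) (E s))\<^sup>2))"
proof -
  have A: "A t \<in> fam_L2 C N" for t unfolding A_def using \<Lambda> by (intro fam_L2_lincomb) auto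
  have cs: "(ip f h)\<^sup>2 \<le> ip f f * ip h h" if "f \<in> fam_L2 C N" "h \<in> fam_L2 C N" for f h
    unfolding ip_def by (rule fam_inner_cauchy_schwarz[OF that])
  \<comment> \<open>Plain Cauchy-Schwarz would produce \<open>ip (E s) (E s)\<close>, which does not
    become small. Expanding \<open>A t\<close> in the loadings leaves only projections of the noise
    on them, whose second moments are of order 1/N.\<close>
  have AE: "(ip (A t) (E s))\<^sup>2 \<le> (\<Sum>l<q. (g l t)\<^sup>2) * (\<Sum>l<q. (ip (\<lambda>i. \<Lambda> i l) (E s))\<^sup>2)" if "s \<in> I" for t s
  proof -
    have "ip (A t) (E s) = (\<Sum>l<q. g l t * ip (\<lambda>i. \<Lambda> i l) (E s))"
      unfolding ip_def A_def using \<Lambda> E[OF that] by (intro fam_inner_lincomb_left) auto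
    then show ?thesis using Cauchy_Schwarz_ineq_sum[of "\<lambda>l. g l t" "\<lambda>l. ip (\<lambda>i. \<Lambda> i l) (E s)" "{..<q}"]
      by simp
  qed
  \<comment> \<open>Of the nine products in the expansion of \<open>ip (Y t) (Y s)\<close>, eight
    remain after \<open>ip (A t) (A s)\<close> is subtracted.\<close>
  have sq8: "(a + b + c + d + e + f + g + h)\<^sup>2 \<le> 8 * (a\<^sup>2 + b\<^sup>2 + c\<^sup>2 + d\<^sup>2 + e\<^sup>2 + f\<^sup>2 + g\<^sup>2 + h\<^sup>2)"
    for a b c d e f g h :: real
  proof -
    have "(\<Sum>i<8::nat. 1 * nth [a, b, c, d, e, f, g, h] i)\<^sup>2
        \<le> (\<Sum>i<8::nat. 1\<^sup>2) * (\<Sum>i<8::nat. (nth [a, b, c, d, e, f, g, h] i)\<^sup>2)"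
      by (rule Cauchy_Schwarz_ineq_sum)
    then show ?thesis by (simp add: eval_nat_numeral)
  qed
  define a where "a t = (\<Sum>l<q. (g l t)\<^sup>2)" for t
  define b where "b s = (\<Sum>l<q. (ip (\<lambda>i. \<Lambda> i l) (E s))\<^sup>2)" for s
  define x where "x t = ip (X t) (X t)" for t
  define y where "y t = ip (E t) (E t)" for t
  define m where "m t = ip (A t) (A t)" for t
  have entry: "(ip (Y t) (Y s) - ip (A t) (A s))\<^sup>2 \<le>
     8 * (m t * x s + x t * m s + x t * x s + a t * b s + b t * a s + x t * y s + y t * x s + (ip (E t) (E s))\<^sup>2)"
    if t: "t \<in> I" and s: "s \<in> I" for t s
  proof -
    note mem = A[of t] A[of s] X[OF t] X[OF s] E[OF t] E[OF s]
    have "ip (Y t) (Y s) - ip (A t) (A s) =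
      ip (A t) (X s) + ip (X t) (A s) + ip (X t) (X s) + ip (A t) (E s) + ip (E t) (A s)
        + ip (X t) (E s) + ip (E t) (X s) + ip (E t) (E s)"
      unfolding ip_def Y_def using mem
      by (simp add: fam_inner_add_left fam_inner_add_right fam_L2_add)
    then have "(ip (Y t) (Y s) - ip (A t) (A s))\<^sup>2 \<le>
      8 * ((ip (A t) (X s))\<^sup>2 + (ip (X t) (A s))\<^sup>2 + (ip (X t) (X s))\<^sup>2 + (ip (A t) (E s))\<^sup>2
        + (ip (E t) (A s))\<^sup>2 + (ip (X t) (E s))\<^sup>2 + (ip (E t) (X s))\<^sup>2 + (ip (E t) (E s))\<^sup>2)"
      by (simp only: sq8)
    moreover have "(ip (E t) (A s))\<^sup>2 \<le> b t * a s"
      using AE[OF t, of s] by (simp add: ip_def fam_inner_commute[of C N "E t" "A s"] a_def b_def mult.commute)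
    moreover have "(ip (A t) (E s))\<^sup>2 \<le> a t * b s" using AE[OF s, of t] by (simp add: a_def b_def)
    moreover have "(ip (A t) (X s))\<^sup>2 \<le> m t * x s" "(ip (X t) (A s))\<^sup>2 \<le> x t * m s"
      "(ip (X t) (X s))\<^sup>2 \<le> x t * x s" "(ip (X t) (E s))\<^sup>2 \<le> x t * y s" "(ip (E t) (X s))\<^sup>2 \<le> y t * x s"
      using cs[OF mem(1,4)] cs[OF mem(3,2)] cs[OF mem(3,4)] cs[OF mem(3,6)] cs[OF mem(5,4)]
      unfolding x_def y_def m_def by blast+
    ultimately show ?thesis by argo
  qed
  have "(\<Sum>t\<in>I. \<Sum>s\<in>I. (ip (Y t) (Y s) - ip (A t) (A s))\<^sup>2) \<le> (\<Sum>t\<in>I. \<Sum>s\<in>I.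
     8 * (m t * x s + x t * m s + x t * x s + a t * b s + b t * a s + x t * y s + y t * x s + (ip (E t) (E s))\<^sup>2))"
    by (intro sum_mono entry)
  also have "\<dots> = 8 * ((\<Sum>t\<in>I. m t) * (\<Sum>t\<in>I. x t) + (\<Sum>t\<in>I. x t) * (\<Sum>t\<in>I. m t)
      + (\<Sum>t\<in>I. x t) * (\<Sum>t\<in>I. x t) + (\<Sum>t\<in>I. a t) * (\<Sum>t\<in>I. b t) + (\<Sum>t\<in>I. b t) * (\<Sum>t\<in>I. a t)
      + (\<Sum>t\<in>I. x t) * (\<Sum>t\<in>I. y t) + (\<Sum>t\<in>I. y t) * (\<Sum>t\<in>I. x t) + (\<Sum>t\<in>I. \<Sum>s\<in>I. (ip (E t) (E s))\<^sup>2))"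
    by (simp only: sum_distrib_left[symmetric] sum.distrib sum_distrib_right[symmetric])
  finally show ?thesis
    unfolding a_def b_def x_def y_def m_def by (simp add: power2_eq_square algebra_simps)
qed

section \<open>Moments of the noise\<close>

lemma sigma_finite_lebesgue_on:
  assumes "S \<in> sets lebesgue"
  shows "sigma_finite_measure (lebesgue_on S)"
proof -
  have "sigma_finite_measure (lebesgue :: 'a measure)"
  proof
    obtain A :: "'a set set" where A: "countable A" "A \<subseteq> sets lborel" "\<Union>A = space lborel"
      "\<forall>a\<in>A. emeasure lborel a \<noteq> \<infinity>"
      using sigma_finite_measure.sigma_finite_countable[OF sigma_finite_lborel] by blast
    show "\<exists>A. countable A \<and> A \<subseteq> sets lebesgue \<and> \<Union>A = space (lebesgue :: 'a measure)
        \<and> (\<forall>a\<in>A. emeasure lebesgue a \<noteq> \<infinity>)"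
      using A by (intro exI[of _ A]) (auto simp: subset_eq emeasure_completion)
  qed
  then show ?thesis using assms by (rule sigma_finite_measure_restrict_space)
qed

lemma random_L2_const:
  assumes "h \<in> L2 S"
  shows "random_L2 M S (\<lambda>_. h)"
  using assms L2_D(1)[OF assms] unfolding random_L2_def by (auto simp: split_beta')

lemma random_L2_inner_measurable:
  assumes S: "S \<in> sets lebesgue" and X: "random_L2 M S X" and Y: "random_L2 M S Y"
  shows "(\<lambda>w. L2_inner S (X w) (Y w)) \<in> borel_measurable M"
proof -
  interpret sigma_finite_measure "lebesgue_on S" by (rule sigma_finite_lebesgue_on[OF S])
  have "(\<lambda>(w, u). X w u * Y w u) \<in> borel_measurable (M \<Otimes>\<^sub>M lebesgue_on S)"
    using X Y unfolding random_L2_def split_beta' by (auto intro: borel_measurable_times)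
  then show ?thesis unfolding L2_inner_def by (rule borel_measurable_lebesgue_integral)
qed

lemma random_L2_mem: "random_L2 M S X \<Longrightarrow> w \<in> space M \<Longrightarrow> X w \<in> L2 S"
  by (simp add: random_L2_def)

text \<open>Markov's inequality is cast as the existence of an event in \<open>sets M\<close>, the
  form in which \<open>bigO_P\<close> asks for it.\<close>

lemma (in prob_space) markov_event:
  assumes Y: "integrable M Y" "\<And>w. w \<in> space M \<Longrightarrow> 0 \<le> Y w" and a: "(LINT w|M. Y w) \<le> a" and e: "e > 0"
  shows "\<exists>A\<in>sets M. measure M A \<ge> 1 - e \<and> (\<forall>w\<in>A. Y w \<le> a / e)"
proof -
  let ?A = "{w \<in> space M. Y w \<le> a / e}"
  have [measurable]: "Y \<in> borel_measurable M" using Y(1) by simp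
  have A: "?A \<in> events" by measurable
  have EY: "0 \<le> (LINT w|M. Y w)" using Y(2) by (intro integral_nonneg_AE) auto
  have "prob ?A \<ge> 1 - e"
  \<comment> \<open>For \<open>a = 0\<close> the threshold is zero and Markov's inequality is void;
    there \<open>Y\<close> vanishes almost surely.\<close>
  proof (cases "a = 0")
    case True
    then have "(LINT w|M. Y w) = 0" using EY a by simp
    then have "AE w in M. Y w = 0"
      using integral_nonneg_eq_0_iff_AE[OF Y(1)] Y(2) by auto
    then have "AE w in M. w \<in> ?A" using True by (auto elim: eventually_mono)
    then have "prob ?A = 1" using A by (simp add: prob_eq_1)
    then show ?thesis using e by simp
  next
    case False
    then have a0: "a > 0" using EY a by simp
    have "prob {w \<in> space M. Y w \<ge> a / e} \<le> (LINT w|M. Y w) / (a / e)"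
      using Y a0 e by (intro integral_Markov_inequality_measure[where A = "{}"]) auto
    also have "\<dots> \<le> a / (a / e)" using a a0 e by (intro divide_right_mono) auto
    also have "\<dots> = e" using a0 e by simp
    finally have 1: "prob {w \<in> space M. Y w \<ge> a / e} \<le> e" .
    have "prob (space M - ?A) \<le> prob {w \<in> space M. Y w \<ge> a / e}"
      by (intro finite_measure_mono) auto
    then show ?thesis using 1 prob_compl[OF A] by simp
  qed
  then show ?thesis using A by (intro bexI[of _ ?A]) auto
qed

lemma (in prob_space) prob_inter_ge:
  assumes "A \<in> events" "B \<in> events" "prob A \<ge> 1 - a" "prob B \<ge> 1 - b"
  shows "prob (A \<inter> B) \<ge> 1 - (a + b)"
proof -
  have "prob (space M - A \<inter> B) \<le> prob ((space M - A) \<union> (space M - B))"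
    using assms by (intro finite_measure_mono) auto
  also have "\<dots> \<le> prob (space M - A) + prob (space M - B)"
    using assms by (intro measure_Un_le) auto
  finally show ?thesis using assms by (simp add: prob_compl)
qed

lemma (in prob_space) AE_event:
  assumes "AE w in M. P w"
  shows "\<exists>A\<in>events. prob A = 1 \<and> (\<forall>w\<in>A. P w)"
proof -
  obtain N where N: "{w \<in> space M. \<not> P w} \<subseteq> N" "N \<in> null_sets M"
    using assms by (auto elim!: AE_E3 simp: eventually_ae_filter)
  have "prob (space M - N) = 1" using N(2) prob_compl[of N] by (auto simp: null_sets_def measure_def)
  then show ?thesis using N by (intro bexI[of _ "space M - N"]) auto
qed

context prob_space
begin

text \<open>Cauchy-Schwarz bounds the squared inner product by a product of squared norms, hence by
  the sum of the fourth powers of the norms.\<close>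

lemma fourth_moment_inner:
  assumes S: "S \<in> sets lebesgue" and X: "random_L2 M S X" and Y: "random_L2 M S Y"
    and iX: "integrable M (\<lambda>w. L2_norm S (X w) ^ 4)" and iY: "integrable M (\<lambda>w. L2_norm S (Y w) ^ 4)"
  shows "integrable M (\<lambda>w. (L2_inner S (X w) (Y w))\<^sup>2)" "integrable M (\<lambda>w. L2_inner S (X w) (Y w))"
proof -
  note m = random_L2_inner_measurable[OF S X Y]
  show sq: "integrable M (\<lambda>w. (L2_inner S (X w) (Y w))\<^sup>2)"
  proof (rule Bochner_Integration.integrable_bound)
    show "integrable M (\<lambda>w. L2_norm S (X w) ^ 4 + L2_norm S (Y w) ^ 4)"
      using iX iY by (rule Bochner_Integration.integrable_add)
    show "(\<lambda>w. (L2_inner S (X w) (Y w))\<^sup>2) \<in> borel_measurable M"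
      using m by (rule borel_measurable_power)
    have "(L2_inner S (X w) (Y w))\<^sup>2 \<le> L2_norm S (X w) ^ 4 + L2_norm S (Y w) ^ 4" if "w \<in> space M" for w
    proof -
      define a b where "a = (L2_norm S (X w))\<^sup>2" "b = (L2_norm S (Y w))\<^sup>2"
      have "(L2_inner S (X w) (Y w))\<^sup>2 \<le> a * b"
        using L2_cauchy_schwarz[OF random_L2_mem[OF X that] random_L2_mem[OF Y that]]
        by (simp add: a_b_def L2_norm_sq)
      also have "a * b \<le> a\<^sup>2 + b\<^sup>2"
      proof -
        have "a \<ge> 0" "b \<ge> 0" by (simp_all add: a_b_def)
        then show ?thesis
          using zero_le_power2[of "a - b"] mult_nonneg_nonneg[of a b] unfolding power2_diff by linarith
      qed
      also have "\<dots> = L2_norm S (X w) ^ 4 + L2_norm S (Y w) ^ 4"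
        by (simp add: a_b_def flip: power_mult)
      finally show ?thesis .
    qed
    then show "AE w in M. norm ((L2_inner S (X w) (Y w))\<^sup>2) \<le> norm (L2_norm S (X w) ^ 4 + L2_norm S (Y w) ^ 4)"
      by (intro AE_I2) simp
  qed
  show "integrable M (\<lambda>w. L2_inner S (X w) (Y w))"
    using m sq by (rule square_integrable_imp_integrable)
qed

lemma sum_square_integrable:
  fixes f :: "nat \<Rightarrow> 'a \<Rightarrow> real"
  assumes "finite I" "\<And>i. i \<in> I \<Longrightarrow> f i \<in> borel_measurable M"
    "\<And>i. i \<in> I \<Longrightarrow> integrable M (\<lambda>w. (f i w)\<^sup>2)"
  shows "integrable M (\<lambda>w. (\<Sum>i\<in>I. f i w)\<^sup>2)"
proof (rule Bochner_Integration.integrable_bound)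
  show "integrable M (\<lambda>w. real (card I) * (\<Sum>i\<in>I. (f i w)\<^sup>2))"
    using assms by auto
  show "(\<lambda>w. (\<Sum>i\<in>I. f i w)\<^sup>2) \<in> borel_measurable M"
    using assms by (intro borel_measurable_power borel_measurable_sum)
  have "(\<Sum>i\<in>I. f i w)\<^sup>2 \<le> real (card I) * (\<Sum>i\<in>I. (f i w)\<^sup>2)" for w
    using Cauchy_Schwarz_ineq_sum[of "\<lambda>_. 1" "\<lambda>i. f i w" I] by simp
  then show "AE w in M. norm ((\<Sum>i\<in>I. f i w)\<^sup>2) \<le> norm (real (card I) * (\<Sum>i\<in>I. (f i w)\<^sup>2))"
    by (intro AE_I2) (simp add: order_trans[OF _ abs_ge_self])
qed

end

text \<open>A bound on a Bochner integral says nothing about a function that is not integrable,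
  since its integral is 0 by convention. The locale therefore includes integrability of the fourth
  powers, and each moment bound below is accompanied by integrability.\<close>

locale noise = prob_space M for M :: "'w measure" +
  fixes C :: "nat \<Rightarrow> 'u::euclidean_space set" and \<epsilon> :: "nat \<Rightarrow> nat \<Rightarrow> 'w \<Rightarrow> 'u \<Rightarrow> real"
    and \<zeta> :: "nat \<Rightarrow> nat \<Rightarrow> nat \<Rightarrow> real" and c\<^sub>e c\<^sub>h :: real
  assumes C: "\<And>i. i \<ge> 1 \<Longrightarrow> C i \<in> sets lebesgue"
    and eps: "\<And>i t. i \<ge> 1 \<Longrightarrow> t \<ge> 1 \<Longrightarrow> random_L2 M (C i) (\<epsilon> i t)"
    and moment: "\<And>i t. i \<ge> 1 \<Longrightarrow> t \<ge> 1 \<Longrightarrow> integrable M (\<lambda>w. L2_norm (C i) (\<epsilon> i t w) ^ 4)"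
    and zeta: "\<And>N s t. \<zeta> N s t
          = (\<Sum>i=1..N. (LINT w|M. L2_inner (C i) (\<epsilon> i t w) (\<epsilon> i s w))) / real N"
    and ce: "c\<^sub>e > 0"
    and zeta_diag: "\<And>N t. N \<ge> 1 \<Longrightarrow> t \<ge> 1 \<Longrightarrow> \<bar>\<zeta> N t t\<bar> \<le> c\<^sub>e"
    and zeta_sum: "\<And>N T t. N \<ge> 1 \<Longrightarrow> t \<in> {1..T} \<Longrightarrow> (\<Sum>s=1..T. \<bar>\<zeta> N s t\<bar>) \<le> c\<^sub>e"
    and fluct: "\<And>N s t. N \<ge> 1 \<Longrightarrow> s \<ge> 1 \<Longrightarrow> t \<ge> 1 \<Longrightarrow>
         (LINT w|M. (\<Sum>i=1..N. L2_inner (C i) (\<epsilon> i t w) (\<epsilon> i s w)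
            - (LINT w'|M. L2_inner (C i) (\<epsilon> i t w') (\<epsilon> i s w')))\<^sup>2) \<le> c\<^sub>e * real N"
    and proj: "\<And>N t h. N \<ge> 1 \<Longrightarrow> t \<ge> 1 \<Longrightarrow> (\<And>i. i \<ge> 1 \<Longrightarrow> h i \<in> L2 (C i)) \<Longrightarrow>
         (LINT w|M. (\<Sum>i=1..N. L2_inner (C i) (h i) (\<epsilon> i t w))\<^sup>2)
             \<le> c\<^sub>h * (\<Sum>i=1..N. (L2_norm (C i) (h i))\<^sup>2)"
begin

lemma eps_mem: "t \<ge> 1 \<Longrightarrow> w \<in> space M \<Longrightarrow> (\<lambda>i. \<epsilon> i t w) \<in> fam_L2 C N"
  unfolding fam_L2_def using random_L2_mem[OF eps] by simp

text \<open>Averaging over i divides the square by N^2, while \<open>proj\<close> gives back only N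
  times the averaged squared norm. The remaining 1/N is the source of that term of the rate.\<close>

lemma projection_moment:
  assumes N: "N \<ge> 1" and t: "t \<ge> 1" and h: "\<And>i. i \<ge> 1 \<Longrightarrow> h i \<in> L2 (C i)"
  shows "integrable M (\<lambda>w. (fam_inner C N h (\<lambda>i. \<epsilon> i t w))\<^sup>2)"
    "(LINT w|M. (fam_inner C N h (\<lambda>i. \<epsilon> i t w))\<^sup>2) \<le> c\<^sub>h * fam_inner C N h h / real N"
proof -
  have "integrable M (\<lambda>w. (L2_inner (C i) (h i) (\<epsilon> i t w))\<^sup>2)" if "i \<in> {1..N}" for i
    using that t h random_L2_const[OF h[of i]]
    by (intro fourth_moment_inner C eps moment) auto
  moreover have "(\<lambda>w. L2_inner (C i) (h i) (\<epsilon> i t w)) \<in> borel_measurable M" if "i \<in> {1..N}" for i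
    using that t by (intro random_L2_inner_measurable random_L2_const h C eps) auto
  ultimately have "integrable M (\<lambda>w. (\<Sum>i=1..N. L2_inner (C i) (h i) (\<epsilon> i t w))\<^sup>2)"
    by (intro sum_square_integrable) auto
  then show "integrable M (\<lambda>w. (fam_inner C N h (\<lambda>i. \<epsilon> i t w))\<^sup>2)"
    by (simp add: fam_inner_def power_divide)
  have "(LINT w|M. (fam_inner C N h (\<lambda>i. \<epsilon> i t w))\<^sup>2)
      = (LINT w|M. (\<Sum>i=1..N. L2_inner (C i) (h i) (\<epsilon> i t w))\<^sup>2) / (real N)\<^sup>2"
    by (simp add: fam_inner_def power_divide)
  also have "\<dots> \<le> (c\<^sub>h * (\<Sum>i=1..N. (L2_norm (C i) (h i))\<^sup>2)) / (real N)\<^sup>2"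
    by (intro divide_right_mono proj[OF N t h]) auto
  also have "\<dots> = c\<^sub>h * fam_inner C N h h / real N"
    using N by (simp add: fam_inner_def L2_norm_sq power2_eq_square[of "real N"])
  finally show "(LINT w|M. (fam_inner C N h (\<lambda>i. \<epsilon> i t w))\<^sup>2) \<le> c\<^sub>h * fam_inner C N h h / real N" .
qed

lemma loading_noise_moment:
  fixes q T :: nat
  assumes N: "N \<ge> 1" and \<Lambda>: "\<And>i l. i \<ge> 1 \<Longrightarrow> l < q \<Longrightarrow> \<Lambda> i l \<in> L2 (C i)"
  defines "Y \<equiv> \<lambda>w. \<Sum>t=1..T. \<Sum>l<q. (fam_inner C N (\<lambda>i. \<Lambda> i l) (\<lambda>i. \<epsilon> i t w))\<^sup>2"
  shows "integrable M Y"
    "(LINT w|M. Y w) \<le> real T * (c\<^sub>h * (\<Sum>l<q. fam_inner C N (\<lambda>i. \<Lambda> i l) (\<lambda>i. \<Lambda> i l)) / real N)"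
proof -
  have pm: "integrable M (\<lambda>w. (fam_inner C N (\<lambda>i. \<Lambda> i l) (\<lambda>i. \<epsilon> i t w))\<^sup>2)"
    "(LINT w|M. (fam_inner C N (\<lambda>i. \<Lambda> i l) (\<lambda>i. \<epsilon> i t w))\<^sup>2)
      \<le> c\<^sub>h * fam_inner C N (\<lambda>i. \<Lambda> i l) (\<lambda>i. \<Lambda> i l) / real N" if "t \<in> {1..T}" "l \<in> {..<q}" for t l
    using that \<Lambda> by (intro projection_moment N; simp)+
  show "integrable M Y" unfolding Y_def
    by (intro Bochner_Integration.integrable_sum pm)
  have "(LINT w|M. Y w)
      = (\<Sum>t=1..T. \<Sum>l<q. (LINT w|M. (fam_inner C N (\<lambda>i. \<Lambda> i l) (\<lambda>i. \<epsilon> i t w))\<^sup>2))"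
    unfolding Y_def
    by (subst Bochner_Integration.integral_sum, intro Bochner_Integration.integrable_sum pm; assumption?)
      (intro sum.cong refl Bochner_Integration.integral_sum pm; assumption)
  also have "\<dots> \<le> (\<Sum>t=1..T. \<Sum>l<q. c\<^sub>h * fam_inner C N (\<lambda>i. \<Lambda> i l) (\<lambda>i. \<Lambda> i l) / real N)"
    by (intro sum_mono pm)
  also have "\<dots> = real T * (c\<^sub>h * (\<Sum>l<q. fam_inner C N (\<lambda>i. \<Lambda> i l) (\<lambda>i. \<Lambda> i l)) / real N)"
    by (simp add: sum_distrib_left sum_divide_distrib)
  finally show "(LINT w|M. Y w)
    \<le> real T * (c\<^sub>h * (\<Sum>l<q. fam_inner C N (\<lambda>i. \<Lambda> i l) (\<lambda>i. \<Lambda> i l)) / real N)" .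
qed

lemma inner_eps:
  assumes "i \<ge> 1" "s \<ge> 1" "t \<ge> 1"
  shows "integrable M (\<lambda>w. L2_inner (C i) (\<epsilon> i t w) (\<epsilon> i s w))"
    "integrable M (\<lambda>w. (L2_inner (C i) (\<epsilon> i t w) (\<epsilon> i s w))\<^sup>2)"
  by (intro fourth_moment_inner C eps moment assms)+

lemma noise_energy_moment:
  fixes T :: nat
  assumes N: "N \<ge> 1"
  defines "Y \<equiv> \<lambda>w. \<Sum>t=1..T. fam_inner C N (\<lambda>i. \<epsilon> i t w) (\<lambda>i. \<epsilon> i t w)"
  shows "integrable M Y" "(LINT w|M. Y w) \<le> real T * c\<^sub>e"
proof -
  have int: "integrable M (\<lambda>w. fam_inner C N (\<lambda>i. \<epsilon> i t w) (\<lambda>i. \<epsilon> i t w))" if "t \<in> {1..T}" for t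
    unfolding fam_inner_def using that
    by (intro integrable_divide Bochner_Integration.integrable_sum inner_eps) auto
  show "integrable M Y" unfolding Y_def by (intro Bochner_Integration.integrable_sum int)
  have "(LINT w|M. Y w) = (\<Sum>t=1..T. \<zeta> N t t)"
    unfolding Y_def
  proof (subst Bochner_Integration.integral_sum)
    show "(\<Sum>t=1..T. LINT w|M. fam_inner C N (\<lambda>i. \<epsilon> i t w) (\<lambda>i. \<epsilon> i t w)) = (\<Sum>t=1..T. \<zeta> N t t)"
    proof (rule sum.cong[OF refl])
      fix t assume t: "t \<in> {1..T}"
      show "(LINT w|M. fam_inner C N (\<lambda>i. \<epsilon> i t w) (\<lambda>i. \<epsilon> i t w)) = \<zeta> N t t"
      proof -
        have "(LINT w|M. (\<Sum>i=1..N. L2_inner (C i) (\<epsilon> i t w) (\<epsilon> i t w)))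
            = (\<Sum>i=1..N. LINT w|M. L2_inner (C i) (\<epsilon> i t w) (\<epsilon> i t w))"
          by (rule Bochner_Integration.integral_sum) (rule inner_eps(1); use t in simp)
        then show ?thesis unfolding fam_inner_def zeta by (simp only: integral_divide_zero)
      qed
    qed
  qed (rule int)
  also have "\<dots> \<le> (\<Sum>t=1..T. c\<^sub>e)"
    by (intro sum_mono order_trans[OF abs_ge_self zeta_diag[OF N]]) simp
  finally show "(LINT w|M. Y w) \<le> real T * c\<^sub>e" by simp
qed

text \<open>Each entry is its mean \<zeta> plus a centred average with second moment of order 1/N.
  Absolute summability of \<zeta> in \<open>s\<close> makes the squared means contribute order T
  instead of T^2; after division by T^3 this is the T^-2 of the rate.\<close>

lemma noise_gram_moment:
  fixes T :: nat
  assumes N: "N \<ge> 1"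
  defines "Y \<equiv> \<lambda>w. \<Sum>t=1..T. \<Sum>s=1..T. (fam_inner C N (\<lambda>i. \<epsilon> i t w) (\<lambda>i. \<epsilon> i s w))\<^sup>2"
  shows "integrable M Y" "(LINT w|M. Y w) \<le> 2 * real T * c\<^sub>e\<^sup>2 + 2 * (real T)\<^sup>2 * c\<^sub>e / real N"
proof -
  have bound: "integrable M (\<lambda>w. (fam_inner C N (\<lambda>i. \<epsilon> i t w) (\<lambda>i. \<epsilon> i s w))\<^sup>2)"
    "(LINT w|M. (fam_inner C N (\<lambda>i. \<epsilon> i t w) (\<lambda>i. \<epsilon> i s w))\<^sup>2) \<le> 2 * (\<zeta> N s t)\<^sup>2 + 2 * c\<^sub>e / real N"
    if s: "s \<in> {1..T}" and t: "t \<in> {1..T}" for s t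
  proof -
    define f where "f i w = L2_inner (C i) (\<epsilon> i t w) (\<epsilon> i s w)" for i w
    define m where "m i = (LINT w|M. f i w)" for i
    have fi: "integrable M (f i)" "integrable M (\<lambda>w. (f i w)\<^sup>2)" if "i \<in> {1..N}" for i
      using inner_eps[of i s t] that s t by (auto simp: f_def[abs_def])
    have ffi: "integrable M (\<lambda>w. (f i w - m i)\<^sup>2)" if "i \<in> {1..N}" for i
    proof -
      have "integrable M (\<lambda>w. (f i w)\<^sup>2 + (m i)\<^sup>2 - 2 * m i * f i w)"
        using fi[OF that] by auto
      then show ?thesis by (simp add: power2_diff mult_ac)
    qed
    define D where "D w = (\<Sum>i=1..N. f i w - m i)" for w
    have Di: "integrable M (\<lambda>w. (D w)\<^sup>2)" unfolding D_def
      using ffi fi by (intro sum_square_integrable) (auto intro: borel_measurable_integrable)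
    have DN: "(LINT w|M. (D w)\<^sup>2) \<le> c\<^sub>e * real N"
      using fluct[OF N, of s t] s t by (simp add: D_def f_def m_def)
    have z: "fam_inner C N (\<lambda>i. \<epsilon> i t w) (\<lambda>i. \<epsilon> i s w) = \<zeta> N s t + D w / real N" for w
      by (simp add: fam_inner_def zeta D_def f_def m_def sum_subtractf add_divide_distrib diff_divide_distrib)
    show 1: "integrable M (\<lambda>w. (fam_inner C N (\<lambda>i. \<epsilon> i t w) (\<lambda>i. \<epsilon> i s w))\<^sup>2)"
      unfolding fam_inner_def power_divide using fi
      by (intro integrable_divide sum_square_integrable) (auto simp: f_def[abs_def] intro: borel_measurable_integrable)
    have "(LINT w|M. (fam_inner C N (\<lambda>i. \<epsilon> i t w) (\<lambda>i. \<epsilon> i s w))\<^sup>2)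
        \<le> (LINT w|M. 2 * (\<zeta> N s t)\<^sup>2 + 2 / (real N)\<^sup>2 * (D w)\<^sup>2)"
    proof (rule integral_mono[OF 1])
      show "integrable M (\<lambda>w. 2 * (\<zeta> N s t)\<^sup>2 + 2 / (real N)\<^sup>2 * (D w)\<^sup>2)" using Di by auto
      fix w
      have "(a + b)\<^sup>2 \<le> 2 * a\<^sup>2 + 2 * b\<^sup>2" for a b :: real
        using zero_le_power2[of "a - b"] by (simp add: power2_diff power2_sum)
      from this[of "\<zeta> N s t" "D w / real N"]
      show "(fam_inner C N (\<lambda>i. \<epsilon> i t w) (\<lambda>i. \<epsilon> i s w))\<^sup>2 \<le> 2 * (\<zeta> N s t)\<^sup>2 + 2 / (real N)\<^sup>2 * (D w)\<^sup>2"
        unfolding z by (simp add: power_divide)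
    qed
    also have "\<dots> = 2 * (\<zeta> N s t)\<^sup>2 + 2 / (real N)\<^sup>2 * (LINT w|M. (D w)\<^sup>2)"
      using Di by (simp add: prob_space)
    also have "\<dots> \<le> 2 * (\<zeta> N s t)\<^sup>2 + 2 / (real N)\<^sup>2 * (c\<^sub>e * real N)"
      using DN by (intro add_left_mono mult_left_mono) auto
    finally show "(LINT w|M. (fam_inner C N (\<lambda>i. \<epsilon> i t w) (\<lambda>i. \<epsilon> i s w))\<^sup>2) \<le> 2 * (\<zeta> N s t)\<^sup>2 + 2 * c\<^sub>e / real N"
      using N by (simp add: power2_eq_square)
  qed
  show "integrable M Y" unfolding Y_def by (intro Bochner_Integration.integrable_sum bound)
  have "(LINT w|M. Y w)
     = (\<Sum>t=1..T. \<Sum>s=1..T. (LINT w|M. (fam_inner C N (\<lambda>i. \<epsilon> i t w) (\<lambda>i. \<epsilon> i s w))\<^sup>2))"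
    unfolding Y_def
    by (subst Bochner_Integration.integral_sum, intro Bochner_Integration.integrable_sum bound; assumption?)
      (intro sum.cong refl Bochner_Integration.integral_sum bound; assumption)
  also have "\<dots> \<le> (\<Sum>t=1..T. \<Sum>s=1..T. 2 * (\<zeta> N s t)\<^sup>2 + 2 * c\<^sub>e / real N)"
    by (intro sum_mono bound)
  also have "\<dots> \<le> (\<Sum>t=1..T. 2 * c\<^sub>e\<^sup>2 + real T * (2 * c\<^sub>e / real N))"
  proof (rule sum_mono)
    fix t assume t: "t \<in> {1..T}"
    have "(\<Sum>s=1..T. (\<zeta> N s t)\<^sup>2) = (\<Sum>s=1..T. \<bar>\<zeta> N s t\<bar> * \<bar>\<zeta> N s t\<bar>)"
      by (simp add: power2_eq_square)
    also have "\<dots> \<le> (\<Sum>s=1..T. \<bar>\<zeta> N s t\<bar> * c\<^sub>e)"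
    proof (intro sum_mono mult_left_mono)
      fix s assume s: "s \<in> {1..T}"
      have "\<bar>\<zeta> N s t\<bar> \<le> (\<Sum>s=1..T. \<bar>\<zeta> N s t\<bar>)" using s by (intro member_le_sum) auto
      then show "\<bar>\<zeta> N s t\<bar> \<le> c\<^sub>e" using zeta_sum[OF N t] by linarith
    qed simp
    also have "\<dots> = (\<Sum>s=1..T. \<bar>\<zeta> N s t\<bar>) * c\<^sub>e" by (simp add: sum_distrib_right)
    also have "\<dots> \<le> c\<^sub>e * c\<^sub>e" using zeta_sum[OF N t] ce by (intro mult_right_mono) auto
    finally have "(\<Sum>s=1..T. (\<zeta> N s t)\<^sup>2) \<le> c\<^sub>e\<^sup>2" by (simp add: power2_eq_square)
    then show "(\<Sum>s=1..T. 2 * (\<zeta> N s t)\<^sup>2 + 2 * c\<^sub>e / real N) \<le> 2 * c\<^sub>e\<^sup>2 + real T * (2 * c\<^sub>e / real N)"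
      by (simp add: sum.distrib sum_distrib_left[symmetric])
  qed
  also have "\<dots> = 2 * real T * c\<^sub>e\<^sup>2 + 2 * (real T)\<^sup>2 * c\<^sub>e / real N"
    by (simp add: power2_eq_square algebra_simps)
  finally show "(LINT w|M. Y w) \<le> 2 * real T * c\<^sub>e\<^sup>2 + 2 * (real T)\<^sup>2 * c\<^sub>e / real N" .
qed

end

section \<open>Energy of a Brownian path\<close>

text \<open>Rounding takes countably many values, so a path read at rounded times is jointly
  measurable in time and sample point. Rounding upward keeps times from [1/2, 1] inside that
  interval.\<close>

definition grid_point :: "nat \<Rightarrow> real \<Rightarrow> real" where
  "grid_point n u = of_int \<lceil>u * real (Suc n)\<rceil> / real (Suc n)"

lemma grid_point_bounds: "u \<le> grid_point n u" "grid_point n u \<le> u + 1 / real (Suc n)"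
proof -
  have "u * real (Suc n) \<le> of_int \<lceil>u * real (Suc n)\<rceil>" by (rule le_of_int_ceiling)
  then show "u \<le> grid_point n u" by (simp add: grid_point_def field_simps)
  have m: "real (Suc n) > 0" by simp
  have "of_int \<lceil>u * real (Suc n)\<rceil> \<le> u * real (Suc n) + 1" by linarith
  then have "grid_point n u \<le> (u * real (Suc n) + 1) / real (Suc n)"
    unfolding grid_point_def by (rule divide_right_mono) simp
  also have "\<dots> = u + 1 / real (Suc n)" using m by (simp only: add_divide_distrib) simp
  finally show "grid_point n u \<le> u + 1 / real (Suc n)" .
qed

lemma grid_point_le_1: "u \<le> 1 \<Longrightarrow> grid_point n u \<le> 1"
proof -
  assume "u \<le> 1"
  then have "u * real (Suc n) \<le> of_int (int (Suc n))" using mult_right_mono[of u 1 "real (Suc n)"] by simp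
  then have "\<lceil>u * real (Suc n)\<rceil> \<le> int (Suc n)" by (rule ceiling_le)
  then have "of_int \<lceil>u * real (Suc n)\<rceil> \<le> real_of_int (int (Suc n))" by (simp only: of_int_le_iff)
  then show ?thesis by (simp add: grid_point_def)
qed

lemma grid_point_tendsto: "(\<lambda>n. grid_point n u) \<longlonglongrightarrow> u"
proof (rule tendsto_sandwich[where f = "\<lambda>_. u" and h = "\<lambda>n. u + 1 / real (Suc n)"])
  have "(\<lambda>n. u + 1 / real (Suc n)) \<longlonglongrightarrow> u + 0"
    by (intro tendsto_add tendsto_const) (rule LIMSEQ_inverse_real_of_nat[unfolded inverse_eq_divide])
  then show "(\<lambda>n. u + 1 / real (Suc n)) \<longlonglongrightarrow> u" by simp
qed (use grid_point_bounds in \<open>simp_all del: of_nat_Suc\<close>)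

lemma normal_density_le: "\<sigma> > 0 \<Longrightarrow> normal_density 0 \<sigma> x \<le> 1 / \<sigma>"
proof -
  assume s: "\<sigma> > 0"
  have "sqrt (2 * pi * \<sigma>\<^sup>2) \<ge> sqrt (\<sigma>\<^sup>2)"
  proof (rule real_sqrt_le_mono)
    have "1 \<le> 2 * pi" using pi_gt3 by simp
    then show "\<sigma>\<^sup>2 \<le> 2 * pi * \<sigma>\<^sup>2" using mult_right_mono[of 1 "2 * pi" "\<sigma>\<^sup>2"] by simp
  qed
  then have r: "sqrt (2 * pi * \<sigma>\<^sup>2) \<ge> \<sigma>" using s by simp
  have e: "exp (- (x - 0)\<^sup>2 / (2 * \<sigma>\<^sup>2)) \<le> 1" by simp
  have "1 / sqrt (2 * pi * \<sigma>\<^sup>2) * exp (- (x - 0)\<^sup>2 / (2 * \<sigma>\<^sup>2)) \<le> 1 / \<sigma> * 1"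
    using r s e by (intro mult_mono frac_le) auto
  then show ?thesis by (simp add: normal_density_def)
qed

text \<open>The density is at most 1/\<sigma>, so |X| < b has probability at most 2b/\<sigma>, hence
  at most 1/2; on the complement the truncated square is at least b^2. The truncation provides the
  bounded integrands for the later passage to the limit.\<close>

lemma (in prob_space) normal_truncated_moment:
  assumes X: "distributed M lborel X (\<lambda>x. ennreal (normal_density 0 \<sigma> x))" and s: "\<sigma> > 0"
    and b: "0 < b" "b \<le> 1" "4 * b \<le> \<sigma>"
  shows "(LINT w|M. min ((X w)\<^sup>2) 1) \<ge> b\<^sup>2 / 2"
proof -
  have [measurable]: "X \<in> borel_measurable M" using distributed_measurable[OF X] by simp
  let ?A = "{w \<in> space M. \<bar>X w\<bar> < b}"
  have A: "?A \<in> events" by measurable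
  have "emeasure M ?A = emeasure M (X -` {-b<..<b} \<inter> space M)"
    by (rule arg_cong[where f = "emeasure M"]) (auto simp: abs_less_iff)
  also have "\<dots> = (\<integral>\<^sup>+ x. ennreal (normal_density 0 \<sigma> x) * indicator {-b<..<b} x \<partial>lborel)"
    by (rule distributed_emeasure[OF X]) simp
  also have "\<dots> \<le> (\<integral>\<^sup>+ x. ennreal (1 / \<sigma>) * indicator {-b<..<b} x \<partial>lborel)"
    using normal_density_le[OF s] by (intro nn_integral_mono mult_right_mono ennreal_leI) auto
  also have "\<dots> = ennreal (1 / \<sigma>) * ennreal (2 * b)"
    using b by (subst nn_integral_cmult_indicator) auto
  also have "\<dots> = ennreal (2 * b / \<sigma>)" using s b by (simp add: ennreal_mult'[symmetric])
  also have "\<dots> \<le> ennreal (1 / 2)" using s b by (intro ennreal_leI) (simp add: field_simps)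
  finally have "prob ?A \<le> 1 / 2"
    unfolding emeasure_eq_measure using ennreal_le_iff[of "1 / 2" "prob ?A"] by linarith
  then have PA: "prob (space M - ?A) \<ge> 1 / 2" using prob_compl[OF A] by simp
  have ind: "b\<^sup>2 * indicator (space M - ?A) w \<le> min ((X w)\<^sup>2) 1" if "w \<in> space M" for w
  proof (cases "w \<in> ?A")
    case False
    then have "b \<le> \<bar>X w\<bar>" using that by auto
    then have "b\<^sup>2 \<le> (X w)\<^sup>2" using b by (metis less_imp_le power2_abs power_mono)
    moreover have "b\<^sup>2 \<le> 1" using b by (simp add: power_le_one)
    ultimately show ?thesis by (simp add: indicator_def)
  qed (simp add: indicator_def)
  have int: "integrable M (\<lambda>w. min ((X w)\<^sup>2) 1)"
    by (rule integrable_const_bound[of _ 1]) auto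
  have "b\<^sup>2 / 2 \<le> b\<^sup>2 * prob (space M - ?A)" using PA mult_left_mono[OF PA, of "b\<^sup>2"] by simp
  also have "\<dots> = (LINT w|M. b\<^sup>2 * indicator (space M - ?A) w)"
    using A by (simp add: sets.compl_sets)
  also have "\<dots> \<le> (LINT w|M. min ((X w)\<^sup>2) 1)"
  proof (rule integral_mono[OF _ int])
    show "integrable M (\<lambda>w. b\<^sup>2 * indicator (space M - ?A) w)"
      using A by (intro integrable_mult_right integrable_real_indicator) (auto simp: emeasure_eq_measure)
  qed (rule ind)
  finally show ?thesis .
qed

text \<open>A path that is small in mean square on an event of probability near one contradicts the lower bound
  on the truncated second moments \<open>E min(W(u)\<^sup>2, 1)\<close>; the integral over \<open>u\<close> is taken along grid
  approximations of \<open>W\<close> because joint measurability of \<open>W\<close> is not assumed.\<close>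

lemma (in prob_space) brownian_energy_lower_bound:
  assumes W: "brownian_motion M q S W" and q: "q \<ge> 1" and s2: "S $$ (0, 0) = \<sigma>\<^sup>2" "\<sigma> > 0"
    and b: "0 < b" "b \<le> 1" "8 * b \<le> \<sigma>"
    and A: "A \<in> events" "prob A \<ge> 1 - b\<^sup>2 / 8"
  shows "\<exists>w\<in>A. (LINT u|lebesgue_on {0..1}. W u w 0 * W u w 0) \<ge> b\<^sup>2 / 8"
proof (rule ccontr)
  assume neg: "\<not> ?thesis"
  \<comment> \<open>Times near 0 are left out because the variance of the path degenerates there. On
    \<open>J\<close> the standard deviation is at least \<sigma>/2, hence at least 4b.\<close>
  define J where "J = {1/2..1::real}"
  define L where "L = restrict_space lborel J"
  have spL: "space L = J" by (simp add: L_def space_restrict_space)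
  have J01: "u \<in> {0..1}" "u > 0" if "u \<in> J" for u using that by (auto simp: J_def)
  have emL: "emeasure L (space L) = ennreal (1 / 2)"
    by (simp add: L_def J_def emeasure_restrict_space space_restrict_space)
  interpret L: finite_measure L by (rule finite_measureI) (simp add: emL)
  have mL: "measure L (space L) = 1 / 2" unfolding measure_def emL by (rule enn2real_ennreal) simp
  interpret P: pair_sigma_finite M L ..
  have Wm: "(\<lambda>w. W u w 0) \<in> borel_measurable M" if "u \<in> {0..1}" for u
    using W that q by (simp add: brownian_motion_def)
  have cont: "AE w in M. W 0 w 0 = 0 \<and> continuous_on {0..1} (\<lambda>u. W u w 0)"
    using W q unfolding brownian_motion_def by (auto elim!: eventually_mono)
  have gp: "grid_point n u \<in> {0..1}" "grid_point n u \<ge> 1/2" if "u \<in> J" for n u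
    using that grid_point_bounds(1)[of u n] grid_point_le_1[of u n] by (auto simp: J_def)
  \<comment> \<open>The clamp to [0, 1] has no effect for \<open>u\<close> in \<open>J\<close>. It
    makes every grid time a legitimate index of \<open>W\<close>, as the measurability argument runs
    over all integers.\<close>
  define V where "V n u w = min ((W (max 0 (min 1 (grid_point n u))) w 0)\<^sup>2) 1" for n u w
  have V_eq: "V n u w = min ((W (grid_point n u) w 0)\<^sup>2) 1" if "u \<in> J" for n u w
    using gp[OF that, of n] by (simp add: V_def)
  have V01: "0 \<le> V n u w" "V n u w \<le> 1" for n u w by (auto simp: V_def)
  have Vmeas: "(\<lambda>(w, u). V n u w) \<in> borel_measurable (M \<Otimes>\<^sub>M L)" for n
  proof -
    define f where "f k p = min ((W (max 0 (min 1 (of_int k / real (Suc n)))) (fst p) 0)\<^sup>2) 1"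
      for k :: int and p :: "'a \<times> real"
    have "(\<lambda>p. f (\<lceil>snd p * real (Suc n)\<rceil>) p) \<in> borel_measurable (M \<Otimes>\<^sub>M L)"
    proof (rule measurable_compose_countable'[where I = UNIV and f = f
        and g = "\<lambda>p. \<lceil>snd p * real (Suc n)\<rceil>"])
      show "f k \<in> borel_measurable (M \<Otimes>\<^sub>M L)" for k
        unfolding f_def by (intro borel_measurable_min borel_measurable_power borel_measurable_const
          measurable_compose[OF measurable_fst Wm]) auto
      have "(\<lambda>u. \<lceil>u * real (Suc n)\<rceil>) \<in> measurable lborel (count_space UNIV)" by measurable
      then have "(\<lambda>u. \<lceil>u * real (Suc n)\<rceil>) \<in> measurable L (count_space UNIV)"
        unfolding L_def by (rule measurable_restrict_space1)
      then show "(\<lambda>p. \<lceil>snd p * real (Suc n)\<rceil>) \<in> measurable (M \<Otimes>\<^sub>M L) (count_space UNIV)"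
        by (rule measurable_compose[OF measurable_snd])
    qed auto
    then show ?thesis by (simp add: f_def V_def grid_point_def split_beta')
  qed
  have int_pair: "integrable (M \<Otimes>\<^sub>M L) (\<lambda>(w, u). V n u w)" for n
  proof -
    interpret PL: finite_measure "M \<Otimes>\<^sub>M L"
      by (rule finite_measure_pair_measure) unfold_locales
    show ?thesis
      by (rule PL.integrable_const_bound[of _ 1]) (use Vmeas[of n] V01 in auto)
  qed
  define h where "h n w = (LINT u|L. V n u w)" for n w
  have h_int: "integrable M (h n)" for n
    unfolding h_def using P.integrable_fst'[OF int_pair[of n]] by simp
  have h_meas: "h n \<in> borel_measurable M" for n using h_int by simp
  have V_int_u: "integrable L (\<lambda>u. V n u w)" if "w \<in> space M" for n w
  proof (rule L.integrable_const_bound[of _ 1])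
    show "(\<lambda>u. V n u w) \<in> borel_measurable L" using measurable_Pair2[OF Vmeas that] by simp
  qed (use V01 in auto)
  have h01: "0 \<le> h n w" "h n w \<le> 1 / 2" if "w \<in> space M" for n w
  proof -
    show "0 \<le> h n w" unfolding h_def using V01 by simp
    have "h n w \<le> (LINT u|L. 1)" unfolding h_def
      using V01 by (intro integral_mono V_int_u that) auto
    then show "h n w \<le> 1 / 2" by (simp add: mL)
  qed
  have Eh: "(LINT w|M. h n w) \<ge> b\<^sup>2 / 4" for n
  proof -
    have "(LINT w|M. h n w) = (LINT u|L. LINT w|M. V n u w)"
      unfolding h_def using P.Fubini_integral[OF int_pair[of n]] by simp
    also have "\<dots> \<ge> (LINT u|L. b\<^sup>2 / 2)"
    proof (rule integral_mono)
      show "integrable L (\<lambda>u. LINT w|M. V n u w)" using P.integrable_snd[OF int_pair[of n]] by simp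
      fix u assume "u \<in> space L"
      then have u: "u \<in> J" by (simp add: spL)
      define v where "v = grid_point n u"
      have v: "v \<in> {0..1}" "v \<ge> 1/2" using gp[OF u] by (auto simp: v_def)
      \<comment> \<open>These weights single out the first component in the law of the
        increments.\<close>
      define a where "a l = (if l = 0 then 1 else 0 :: real)" for l :: nat
      have sums: "(\<Sum>l<q. a l * f l) = f 0" for f :: "nat \<Rightarrow> real"
        using q by (simp add: a_def if_distrib[where f = "\<lambda>x. x * _"] cong: if_cong)
      have "(\<Sum>l<q. \<Sum>m<q. a l * a m * S $$ (l, m)) = (\<Sum>l<q. a l * (\<Sum>m<q. a m * S $$ (l, m)))"
        by (simp add: sum_distrib_left mult.assoc)
      then have var: "(\<Sum>l<q. \<Sum>m<q. a l * a m * S $$ (l, m)) = \<sigma>\<^sup>2" by (simp add: sums s2)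
      have "distributed M lborel (\<lambda>w. \<Sum>l<q. a l * (W v w l - W 0 w l))
          (\<lambda>x. ennreal (normal_density 0
             (sqrt ((v - 0) * (\<Sum>l<q. \<Sum>m<q. a l * a m * S $$ (l, m)))) x))"
      proof -
        have "\<exists>l<q. a l \<noteq> 0" using q by (intro exI[of _ 0]) (auto simp: a_def)
        moreover have "0 \<le> (0::real)" "0 < v" "v \<le> 1" using v by auto
        moreover have "\<forall>s t a. 0 \<le> s \<longrightarrow> s < t \<longrightarrow> t \<le> 1 \<longrightarrow> (\<exists>l<q. a l \<noteq> 0) \<longrightarrow>
          distributed M lborel (\<lambda>w. \<Sum>l<q. a l * (W t w l - W s w l))
          (\<lambda>x. ennreal (normal_density 0
             (sqrt ((t - s) * (\<Sum>l<q. \<Sum>m<q. a l * a m * S $$ (l, m)))) x))"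
          using W unfolding brownian_motion_def by (elim conjE)
        ultimately show ?thesis by blast
      qed
      then have D: "distributed M lborel (\<lambda>w. W v w 0 - W 0 w 0) (\<lambda>x. ennreal (normal_density 0 (sqrt v * \<sigma>) x))"
        unfolding sums var using s2(2) by (simp add: real_sqrt_mult)
      have "1 / 2 \<le> sqrt v"
      proof (rule real_le_rsqrt)
        show "(1 / 2)\<^sup>2 \<le> v" using v by (simp add: power2_eq_square)
      qed
      then have "1 / 2 * \<sigma> \<le> sqrt v * \<sigma>" using s2(2) by (intro mult_right_mono) auto
      then have "4 * b \<le> sqrt v * \<sigma>" "0 < sqrt v * \<sigma>" using b s2(2) v by (linarith, simp)
      then have "b\<^sup>2 / 2 \<le> (LINT w|M. min ((W v w 0 - W 0 w 0)\<^sup>2) 1)"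
        by (intro normal_truncated_moment[OF D] b(1,2))
      also have "\<dots> = (LINT w|M. V n u w)"
      proof (rule integral_cong_AE)
        show "AE w in M. min ((W v w 0 - W 0 w 0)\<^sup>2) 1 = V n u w"
          using cont by eventually_elim (simp add: V_eq[OF u] v_def)
        show "(\<lambda>w. min ((W v w 0 - W 0 w 0)\<^sup>2) 1) \<in> borel_measurable M"
          using Wm[OF v(1)] Wm[of 0] by (intro borel_measurable_min borel_measurable_power borel_measurable_diff borel_measurable_const) auto
        show "(\<lambda>w. V n u w) \<in> borel_measurable M"
          unfolding V_def by (intro borel_measurable_min borel_measurable_power borel_measurable_const Wm) auto
      qed
      finally show "b\<^sup>2 / 2 \<le> (LINT w|M. V n u w)" .
    qed simp
    finally show ?thesis by (simp add: mL)
  qed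
  define H where "H w = (LINT u|L. min ((W u w 0)\<^sup>2) 1)" for w
  have h_lim: "AE w in M. (\<lambda>n. h n w) \<longlonglongrightarrow> H w"
    using cont AE_space
  proof eventually_elim
    case (elim w)
    show ?case unfolding h_def H_def
    proof (rule integral_dominated_convergence[where w = "\<lambda>_. 1"])
      have "continuous_on {0..1} (\<lambda>u. min ((W u w 0)\<^sup>2) 1)" using elim by (intro continuous_intros) auto
      then have "continuous_on J (\<lambda>u. min ((W u w 0)\<^sup>2) 1)"
        by (rule continuous_on_subset) (auto simp: J_def)
      then show "(\<lambda>u. min ((W u w 0)\<^sup>2) 1) \<in> borel_measurable L"
        unfolding L_def measurable_cong_sets[OF sets_restrict_space_cong[OF sets_lborel] refl]
        by (rule borel_measurable_continuous_on_restrict)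
      show "(\<lambda>u. V n u w) \<in> borel_measurable L" for n using V_int_u[OF elim(2), of n] by simp
      show "AE u in L. (\<lambda>n. V n u w) \<longlonglongrightarrow> min ((W u w 0)\<^sup>2) 1"
      proof (rule AE_I2)
        fix u assume "u \<in> space L"
        then have u: "u \<in> J" by (simp add: spL)
        have "(\<lambda>n. W (grid_point n u) w 0) \<longlonglongrightarrow> W u w 0"
          using elim(1) J01[OF u] gp[OF u]
          by (intro continuous_on_tendsto_compose[where s = "{0..1}" and f = "\<lambda>u. W u w 0", OF _ grid_point_tendsto]) auto
        then have "(\<lambda>n. min ((W (grid_point n u) w 0)\<^sup>2) 1) \<longlonglongrightarrow> min ((W u w 0)\<^sup>2) 1"
          by (intro tendsto_min tendsto_power tendsto_const)
        then show "(\<lambda>n. V n u w) \<longlonglongrightarrow> min ((W u w 0)\<^sup>2) 1" by (simp add: V_eq[OF u])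
      qed
    qed (use V01 in auto)
  qed
  \<comment> \<open>Dropping the truncation and enlarging \<open>J\<close> can only increase the
    integral; the last steps pass from Borel measure to its completion, in which the path energy is
    stated.\<close>
  have H_le: "AE w in M. H w \<le> (LINT u|lebesgue_on {0..1}. W u w 0 * W u w 0)"
    using cont
  proof eventually_elim
    case (elim w)
    define f where "f u = W u w 0 * W u w 0" for u
    have cf: "continuous_on {0..1} f" unfolding f_def using elim by (intro continuous_intros) auto
    have "H w \<le> (LINT u|L. f u)" unfolding H_def
    proof (rule integral_mono)
      have c2: "continuous_on J f" using cf by (rule continuous_on_subset) (auto simp: J_def)
      then have "continuous_on J (\<lambda>u. min (f u) 1)" by (intro continuous_intros)
      moreover have cL: "integrable L g" if "continuous_on J g" for g :: "real \<Rightarrow> real"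
      proof -
        have "set_integrable lborel J g"
          using that unfolding J_def by (rule borel_integrable_atLeastAtMost')
        then show ?thesis unfolding L_def
          by (simp add: set_integrable_def integrable_restrict_space J_def)
      qed
      ultimately show "integrable L (\<lambda>u. min ((W u w 0)\<^sup>2) 1)" by (simp add: f_def power2_eq_square)
      show "integrable L f" by (rule cL[OF c2])
    qed (simp add: f_def power2_eq_square)
    also have "\<dots> = (LINT u|lborel. indicator J u * f u)"
      by (simp add: L_def integral_restrict_space J_def)
    also have "\<dots> \<le> (LINT u|lborel. indicator {0..1} u * f u)"
    proof (rule integral_mono)
      have s: "set_integrable lborel {0..1} f" using cf by (rule borel_integrable_atLeastAtMost')
      then show "integrable lborel (\<lambda>u. indicator {0..1} u * f u)" by (simp add: set_integrable_def)
      have "set_integrable lborel J f" using s by (rule set_integrable_subset) (auto simp: J_def)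
      then show "integrable lborel (\<lambda>u. indicator J u * f u)" by (simp add: set_integrable_def)
      show "indicator J u * f u \<le> indicator {0..1} u * f u" for u
        by (auto simp: indicator_def J_def f_def)
    qed
    also have "\<dots> = (LINT u|lebesgue. indicator {0..1} u * f u)"
    proof -
      have s: "set_integrable lborel {0..1} f" using cf by (rule borel_integrable_atLeastAtMost')
      then have "(\<lambda>u. indicator {0..1} u * f u) \<in> borel_measurable lborel"
        by (auto simp: set_integrable_def)
      then show ?thesis by (simp add: integral_completion)
    qed
    also have "\<dots> = (LINT u|lebesgue_on {0..1}. f u)"
      by (simp add: integral_restrict_space)
    finally show ?case by (simp add: f_def)
  qed
  have "AE w in M. H w \<le> (LINT u|lebesgue_on {0..1}. W u w 0 * W u w 0) \<and> (\<lambda>n. h n w) \<longlonglongrightarrow> H w"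
    using H_le h_lim by eventually_elim simp
  from AE_event[OF this] obtain B where B: "B \<in> events" "prob B = 1"
    "\<forall>w\<in>B. H w \<le> (LINT u|lebesgue_on {0..1}. W u w 0 * W u w 0) \<and> (\<lambda>n. h n w) \<longlonglongrightarrow> H w"
    by blast
  define D where "D = A \<inter> B"
  have D: "D \<in> events" "D \<subseteq> A" "D \<subseteq> B" using A B by (auto simp: D_def)
  have DM: "D \<subseteq> space M" using D(1) by (rule sets.sets_into_space)
  have PD: "prob D = prob A"
  proof -
    have "AE w in M. w \<in> B" by (rule AE_prob_1[OF B(2)])
    then have "AE w in M. w \<in> D \<longleftrightarrow> w \<in> A" by eventually_elim (simp add: D_def)
    then show ?thesis using D(1) A(1) by (rule finite_measure_eq_AE)
  qed
  have HD: "H w < b\<^sup>2 / 8" if "w \<in> D" for w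
  proof -
    have "w \<in> A" "w \<in> B" using that D by auto
    then have "\<not> b\<^sup>2 / 8 \<le> (LINT u|lebesgue_on {0..1}. W u w 0 * W u w 0)"
      "H w \<le> (LINT u|lebesgue_on {0..1}. W u w 0 * W u w 0)" using neg B(3) by blast+
    then show ?thesis by linarith
  qed
  \<comment> \<open>Multiplied by the indicator of \<open>D\<close>, the sequence converges at every
    point, so the product with \<open>H\<close> is measurable as a pointwise limit, although nothing
    is known about \<open>H\<close> outside \<open>B\<close>.\<close>
  have lim: "(\<lambda>n. LINT w|M. indicator D w * h n w) \<longlonglongrightarrow> (LINT w|M. indicator D w * H w)"
  proof (rule integral_dominated_convergence[where w = "\<lambda>_. 1"])
    have "(\<lambda>w. indicator D w * h n w) \<in> borel_measurable M" for n using h_meas D(1) by auto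
    note m = this
    show "(\<lambda>w. indicator D w * h n w) \<in> borel_measurable M" for n by (rule m)
    have l: "(\<lambda>n. indicator D w * h n w) \<longlonglongrightarrow> indicator D w * H w" for w
      using B(3) D(3) by (auto simp: indicator_def)
    show "(\<lambda>w. indicator D w * H w) \<in> borel_measurable M"
      by (rule borel_measurable_LIMSEQ_real[OF l m])
    show "AE w in M. (\<lambda>n. indicator D w * h n w) \<longlonglongrightarrow> indicator D w * H w" using l by simp
    show "AE w in M. norm (indicator D w * h n w) \<le> 1" for n
    proof (rule AE_I2)
      fix w assume "w \<in> space M"
      then show "norm (indicator D w * h n w) \<le> 1" using h01[of w n] by (auto simp: indicator_def)
    qed
  qed simp
  \<comment> \<open>Outside \<open>D\<close>, a set of probability at most b^2/8, \<open>h\<close>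
    is at most 1/2. So 3b^2/16 of the expectation sits on \<open>D\<close>, more than the b^2/8 that
    \<open>HD\<close> permits in the limit.\<close>
  have lower: "(LINT w|M. indicator D w * h n w) \<ge> b\<^sup>2 / 4 - b\<^sup>2 / 16" for n
  proof -
    have i1: "integrable M (\<lambda>w. indicator D w * h n w)" using h_int[of n] D(1)
      by (intro integrable_real_mult_indicator[of _ _ "h n", simplified mult.commute]) auto
    have i2: "integrable M (\<lambda>w. indicator (space M - D) w * (1 / 2 :: real))"
      using D(1) by (intro integrable_mult_left integrable_real_indicator) (auto simp: emeasure_eq_measure)
    have "b\<^sup>2 / 4 \<le> (LINT w|M. h n w)" by (rule Eh)
    also have "\<dots> \<le> (LINT w|M. indicator D w * h n w + indicator (space M - D) w * (1 / 2))"
    proof (rule integral_mono[OF h_int Bochner_Integration.integrable_add[OF i1 i2]])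
      fix w assume "w \<in> space M"
      then show "h n w \<le> indicator D w * h n w + indicator (space M - D) w * (1 / 2)"
        using h01[of w n] by (auto simp: indicator_def)
    qed
    also have "\<dots> = (LINT w|M. indicator D w * h n w) + prob (space M - D) * (1 / 2)"
      using i1 i2 D(1) by simp
    also have "prob (space M - D) * (1 / 2) \<le> b\<^sup>2 / 16"
      using prob_compl[OF D(1)] A(2) PD by simp
    finally show ?thesis by simp
  qed
  have "(LINT w|M. indicator D w * H w) \<ge> b\<^sup>2 / 4 - b\<^sup>2 / 16"
    by (rule LIMSEQ_le_const[OF lim]) (use lower in auto)
  moreover have "(LINT w|M. indicator D w * H w) \<le> b\<^sup>2 / 8"
  proof -
    have "(LINT w|M. indicator D w * H w) \<le> (LINT w|M. b\<^sup>2 / 8)"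
    proof (rule integral_mono_AE')
      show "AE w in M. indicator D w * H w \<le> b\<^sup>2 / 8"
        using HD by (intro AE_I2) (auto simp: indicator_def less_imp_le)
    qed auto
    then show ?thesis by (simp add: prob_space)
  qed
  moreover have "b\<^sup>2 > 0" using b by simp
  ultimately show False by linarith
qed

section \<open>Principal components of a perturbed signal\<close>

definition frob2 :: "real mat \<Rightarrow> real" where
  "frob2 R = (\<Sum>a<dim_row R. \<Sum>b<dim_col R. (R $$ (a, b))\<^sup>2)"

lemma frob2_nonneg: "frob2 R \<ge> 0"
  by (simp add: frob2_def sum_nonneg)

lemma frob2_rows: "R \<in> carrier_mat m n \<Longrightarrow> frob2 R = (\<Sum>a<m. row R a \<bullet> row R a)"
  by (auto simp: frob2_def scalar_prod_self[of _ n] intro!: sum.cong)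

lemma quadratic_form_le_frob:
  assumes R: "R \<in> carrier_mat n n" and y: "y \<in> carrier_vec n"
  shows "\<bar>y \<bullet> (R *\<^sub>v y)\<bar> \<le> sqrt (frob2 R) * (y \<bullet> y)"
proof -
  have Ry: "R *\<^sub>v y \<in> carrier_vec n" using R y by simp
  have yy: "y \<bullet> y \<ge> 0" using y by (simp add: scalar_prod_self[of _ n] sum_nonneg)
  have "(R *\<^sub>v y) \<bullet> (R *\<^sub>v y) = (\<Sum>i<n. (row R i \<bullet> y)\<^sup>2)"
    using R y by (subst scalar_prod_self[of _ n]) auto
  also have "\<dots> \<le> (\<Sum>i<n. (row R i \<bullet> row R i) * (y \<bullet> y))"
    using R y by (intro sum_mono scalar_prod_cauchy_schwarz[of _ n]) auto
  also have "\<dots> = frob2 R * (y \<bullet> y)" by (simp add: frob2_rows[OF R] sum_distrib_right)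
  finally have 1: "(R *\<^sub>v y) \<bullet> (R *\<^sub>v y) \<le> frob2 R * (y \<bullet> y)" .
  have "(y \<bullet> (R *\<^sub>v y))\<^sup>2 \<le> (y \<bullet> y) * ((R *\<^sub>v y) \<bullet> (R *\<^sub>v y))"
    by (rule scalar_prod_cauchy_schwarz[OF y Ry])
  also have "\<dots> \<le> (y \<bullet> y) * (frob2 R * (y \<bullet> y))" by (intro mult_left_mono 1 yy)
  also have "\<dots> = (sqrt (frob2 R) * (y \<bullet> y))\<^sup>2"
    using frob2_nonneg[of R] by (simp add: power_mult_distrib) (simp add: power2_eq_square)
  finally have "\<bar>y \<bullet> (R *\<^sub>v y)\<bar> \<le> \<bar>sqrt (frob2 R) * (y \<bullet> y)\<bar>" by (simp only: abs_le_square_iff)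
  then show ?thesis using yy frob2_nonneg[of R] by simp
qed

text \<open>Test vectors y = G x are used. The form of G L G^T at y is at least l |G^T y|^2, the
  lower bound for G passes to G^T on the range of G, and the remainder costs at most its Frobenius
  norm.\<close>

lemma gram_signal_eig_lower_bound:
  assumes \<Omega>: "\<Omega> \<in> carrier_mat T T" "transpose_mat \<Omega> = \<Omega>" and G: "G \<in> carrier_mat T q"
    and L: "L \<in> carrier_mat q q" and q: "1 \<le> q" "q \<le> T"
    and s: "s > 0" "\<And>x. x \<in> carrier_vec q \<Longrightarrow> (real T)\<^sup>2 * s * (x \<bullet> x) \<le> (G *\<^sub>v x) \<bullet> (G *\<^sub>v x)"
    and l: "l \<ge> 0" "\<And>x. x \<in> carrier_vec q \<Longrightarrow> l * (x \<bullet> x) \<le> x \<bullet> (L *\<^sub>v x)"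
  shows "(real T)\<^sup>2 * l * s - sqrt (frob2 (\<Omega> - G * L * transpose_mat G)) \<le> eig \<Omega> q"
proof (rule eig_ge_on_subspace[OF \<Omega> G q])
  have T: "real T > 0" using q by simp
  define A where "A = G * L * transpose_mat G"
  have A: "A \<in> carrier_mat T T" using G L by (simp add: A_def)
  define R where "R = \<Omega> - A"
  have R: "R \<in> carrier_mat T T" using \<Omega> A by (auto simp: R_def)
  fix x :: "real vec" assume x: "x \<in> carrier_vec q"
  define y where "y = G *\<^sub>v x"
  have y: "y \<in> carrier_vec T" using G x by (simp add: y_def)
  have Gy: "transpose_mat G *\<^sub>v y \<in> carrier_vec q" using G y by simp
  { assume "x \<noteq> 0\<^sub>v q"
    then have "x \<bullet> x > 0" by (rule scalar_prod_self_pos[OF x])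
    then have "0 < (real T)\<^sup>2 * s * (x \<bullet> x)" using T s(1) by simp
    then have "y \<bullet> y > 0" using s(2)[OF x] by (simp add: y_def)
    then show "G *\<^sub>v x \<noteq> 0\<^sub>v T" using y by (auto simp: y_def) }
  have "y \<bullet> (A *\<^sub>v y) = y \<bullet> (G *\<^sub>v (L *\<^sub>v (transpose_mat G *\<^sub>v y)))"
    using G L y Gy by (simp add: A_def assoc_mult_mat_vec[of _ T q _ q] assoc_mult_mat_vec[of _ T q _ T])
  also have "\<dots> = (transpose_mat G *\<^sub>v y) \<bullet> (L *\<^sub>v (transpose_mat G *\<^sub>v y))"
    using transpose_vec_mult_scalar[OF G _ y, of "L *\<^sub>v (transpose_mat G *\<^sub>v y)"] L Gy by simp
  finally have Ay: "y \<bullet> (A *\<^sub>v y) \<ge> l * ((transpose_mat G *\<^sub>v y) \<bullet> (transpose_mat G *\<^sub>v y))"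
    using l(2)[OF Gy] by simp
  have yy: "y \<bullet> y \<ge> 0" using y by (simp add: scalar_prod_self[of _ T] sum_nonneg)
  \<comment> \<open>|y|^4 = ((G^T y).x)^2 is at most |G^T y|^2 |x|^2, and |x|^2 is at most |y|^2 /
    (T^2 s).\<close>
  have GG: "(real T)\<^sup>2 * s * (y \<bullet> y) \<le> (transpose_mat G *\<^sub>v y) \<bullet> (transpose_mat G *\<^sub>v y)"
  proof (cases "x = 0\<^sub>v q")
    case True
    then have "y = 0\<^sub>v T" using G unfolding y_def by (intro eq_vecI) auto
    then have "y \<bullet> y = 0" by simp
    then show ?thesis using Gy by (simp add: scalar_prod_self[of _ q] sum_nonneg)
  next
    case False
    then have xx: "x \<bullet> x > 0" by (rule scalar_prod_self_pos[OF x])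
    have "(transpose_mat G *\<^sub>v y) \<bullet> x = y \<bullet> y"
      using transpose_vec_mult_scalar[OF G x y] by (simp add: y_def)
    then have 1: "(y \<bullet> y)\<^sup>2 \<le> ((transpose_mat G *\<^sub>v y) \<bullet> (transpose_mat G *\<^sub>v y)) * (x \<bullet> x)"
      using scalar_prod_cauchy_schwarz[OF Gy x] by simp
    have "(real T)\<^sup>2 * s * (y \<bullet> y) * (x \<bullet> x) = (y \<bullet> y) * ((real T)\<^sup>2 * s * (x \<bullet> x))" by simp
    also have "\<dots> \<le> (y \<bullet> y) * (y \<bullet> y)"
      using s(2)[OF x] yy by (intro mult_left_mono) (auto simp: y_def)
    finally have "(real T)\<^sup>2 * s * (y \<bullet> y) * (x \<bullet> x)
        \<le> ((transpose_mat G *\<^sub>v y) \<bullet> (transpose_mat G *\<^sub>v y)) * (x \<bullet> x)"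
      using 1 by (simp add: power2_eq_square)
    then show ?thesis using xx by (simp only: mult_le_cancel_right_pos)
  qed
  have "\<Omega> *\<^sub>v y = A *\<^sub>v y + R *\<^sub>v y"
  proof -
    have "\<Omega> = A + R" using \<Omega> A by (intro eq_matI) (auto simp: R_def)
    then show ?thesis using A R y by (simp add: add_mult_distrib_mat_vec[of _ T T])
  qed
  then have "y \<bullet> (\<Omega> *\<^sub>v y) = y \<bullet> (A *\<^sub>v y) + y \<bullet> (R *\<^sub>v y)"
    using A R y by (simp add: scalar_prod_add_distrib[of _ T])
  moreover have "- (sqrt (frob2 R) * (y \<bullet> y)) \<le> y \<bullet> (R *\<^sub>v y)"
    using quadratic_form_le_frob[OF R y] by simp
  moreover have "l * ((real T)\<^sup>2 * s * (y \<bullet> y)) \<le> y \<bullet> (A *\<^sub>v y)"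
    using mult_left_mono[OF GG l(1)] Ay by simp
  ultimately have "((real T)\<^sup>2 * l * s - sqrt (frob2 R)) * (y \<bullet> y) \<le> y \<bullet> (\<Omega> *\<^sub>v y)"
    by (simp add: algebra_simps)
  then show "((real T)\<^sup>2 * l * s - sqrt (frob2 (\<Omega> - G * L * transpose_mat G))) * ((G *\<^sub>v x) \<bullet> (G *\<^sub>v x))
      \<le> (G *\<^sub>v x) \<bullet> (\<Omega> *\<^sub>v (G *\<^sub>v x))"
    by (simp add: y_def R_def A_def)
qed

text \<open>\<open>H_mat\<close> contains \<open>the (mat_inverse V)\<close>, which carries
  information only once invertibility is shown; uniqueness of the inverse then identifies
  it.\<close>

lemma mat_inverse_mat_diag:
  fixes v :: "nat \<Rightarrow> real"
  assumes v: "\<And>i. i < q \<Longrightarrow> v i \<noteq> 0"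
  shows "the (mat_inverse (mat_diag q v)) = mat_diag q (\<lambda>i. 1 / v i)"
proof -
  let ?V = "mat_diag q v" and ?W = "mat_diag q (\<lambda>i. 1 / v i)"
  have V: "?V \<in> carrier_mat q q" "?W \<in> carrier_mat q q" by auto
  have VW: "?V * ?W = 1\<^sub>m q" "?W * ?V = 1\<^sub>m q"
    unfolding mat_diag_diag using v by (auto simp: mat_diag_def intro!: eq_matI)
  have "?V \<in> Units (ring_mat TYPE(real) q ())"
    unfolding Units_def ring_mat_simps mem_Collect_eq using V VW by blast
  then obtain B where B: "mat_inverse ?V = Some B" using mat_inverse(1)[OF V(1), where b = "()"] by (cases "mat_inverse ?V") auto
  have VB: "?V * B = 1\<^sub>m q" and Bc: "B \<in> carrier_mat q q" using mat_inverse(2)[OF V(1) B] by auto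
  have "B = 1\<^sub>m q * B" using Bc by simp
  also have "\<dots> = ?W * ?V * B" unfolding VW(2) ..
  also have "\<dots> = ?W * (?V * B)" by (rule assoc_mult_mat[OF V(2) V(1) Bc])
  also have "\<dots> = ?W" unfolding VB by (rule right_mult_one_mat[OF V(2)])
  finally show ?thesis using B by simp
qed

text \<open>Since \<open>\<Omega> e\<^sub>i = eig\<^sub>i e\<^sub>i\<close>, the estimation error in row \<open>a\<close> is \<open>V\<^sup>-\<^sup>1\<close> applied to the coefficients of
  row \<open>a\<close> of \<open>\<Omega> - G L G\<^sup>T\<close> in the eigenvectors, so Bessel's inequality applies.\<close>

lemma fpca_error_bound:
  assumes \<Omega>: "\<Omega> \<in> carrier_mat T T" "transpose_mat \<Omega> = \<Omega>" and G: "G \<in> carrier_mat T q"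
    and L: "L \<in> carrier_mat q q" "transpose_mat L = L" and q: "1 \<le> q" "q \<le> T"
    and fp: "fpca_factors T q \<Omega> Gt"
    and \<mu>: "\<mu> > 0" "(real T)\<^sup>2 * \<mu> \<le> eig \<Omega> q"
  shows "(\<Sum>a<T. (vnorm (row Gt a - H_mat T (V_mat T q \<Omega>) Gt G L *\<^sub>v row G a))\<^sup>2) / real T
    \<le> frob2 (\<Omega> - G * L * transpose_mat G) / (\<mu>\<^sup>2 * real T ^ 3)"
proof -
  have T: "real T > 0" using q by simp
  define v where "v i = eig ((1 / (real T)\<^sup>2) \<cdot>\<^sub>m \<Omega>) (i + 1)" for i
  have v_eig: "eig \<Omega> (i + 1) = (real T)\<^sup>2 * v i" if "i < q" for i
    using eig_smult[OF \<Omega>, of "1 / (real T)\<^sup>2" i] that q T by (simp add: v_def)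
  have v_ge: "v i \<ge> \<mu>" if "i < q" for i
  proof -
    have "i \<le> q - 1" using that by simp
    then have "eig \<Omega> q \<le> eig \<Omega> (i + 1)" using eig_anti[OF \<Omega>, of i "q - 1"] that q by simp
    then have "(real T)\<^sup>2 * \<mu> \<le> (real T)\<^sup>2 * v i" using \<mu>(2) v_eig[OF that] by simp
    then show ?thesis using T by simp
  qed
  obtain e where ec: "\<And>i. i < q \<Longrightarrow> e i \<in> carrier_vec T"
    and ev: "\<And>i. i < q \<Longrightarrow> \<Omega> *\<^sub>v e i = eig \<Omega> (i + 1) \<cdot>\<^sub>v e i"
    and cG: "\<And>i. i < q \<Longrightarrow> col Gt i = real T \<cdot>\<^sub>v e i"
    and ee: "\<forall>i<q. \<forall>j<q. e i \<bullet> e j = (if i = j then 1 else 0)"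
    and Gt: "Gt \<in> carrier_mat T q"
    using fp unfolding fpca_factors_def by blast
  have on: "orthonormal_family T q e" using ec ee by (auto simp: orthonormal_family_def)
  define A where "A = G * L * transpose_mat G"
  have A: "A \<in> carrier_mat T T" using G L by (simp add: A_def)
  have tA: "transpose_mat A = A"
  proof -
    have "transpose_mat A = G * transpose_mat (G * L)"
      unfolding A_def using G L transpose_mult[of "G * L" T q "transpose_mat G" T] by simp
    also have "transpose_mat (G * L) = L * transpose_mat G" using transpose_mult[OF G L(1)] L(2) by simp
    also have "G * (L * transpose_mat G) = A"
      unfolding A_def using G L by (simp add: assoc_mult_mat[of _ T q _ q _ T])
    finally show ?thesis .
  qed
  define R where "R = \<Omega> - A"
  have R: "R \<in> carrier_mat T T" using \<Omega> A by (auto simp: R_def)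
  have H: "H_mat T (V_mat T q \<Omega>) Gt G L
      = mat_diag q (\<lambda>i. 1 / v i) * ((1 / (real T)\<^sup>2) \<cdot>\<^sub>m (transpose_mat Gt * G)) * L"
  proof -
    have "the (mat_inverse (V_mat T q \<Omega>)) = mat_diag q (\<lambda>i. 1 / v i)"
      unfolding V_mat_def v_def[symmetric]
      by (rule mat_inverse_mat_diag) (use v_ge \<mu>(1) in fastforce)
    then show ?thesis by (simp add: H_mat_def)
  qed
  have err: "(row Gt a - H_mat T (V_mat T q \<Omega>) Gt G L *\<^sub>v row G a) $ i = (e i \<bullet> row R a) / (real T * v i)"
    if a: "a < T" and i: "i < q" for a i
  proof -
    have vi: "v i > 0" using v_ge[OF i] \<mu>(1) by simp
    have g: "row G a \<in> carrier_vec q" using G a by auto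
    have Lg: "L *\<^sub>v row G a \<in> carrier_vec q" using L g by simp
    define M where "M = (1 / (real T)\<^sup>2) \<cdot>\<^sub>m (transpose_mat Gt * G)"
    have M: "M \<in> carrier_mat q q" using Gt G by (simp add: M_def)
    define D where "D = mat_diag q (\<lambda>i. 1 / v i)"
    have D: "D \<in> carrier_mat q q" by (simp add: D_def)
    have colA: "col A a = G *\<^sub>v (L *\<^sub>v row G a)"
    proof -
      have "col A a = (G * L) *\<^sub>v col (transpose_mat G) a"
        unfolding A_def using G L a by (intro col_mult2) auto
      also have "col (transpose_mat G) a = row G a" using G a by simp
      finally show ?thesis using G L g by simp
    qed
    have "D * M * L *\<^sub>v row G a = D *\<^sub>v (M *\<^sub>v (L *\<^sub>v row G a))"
      using D M L g Lg by (simp add: assoc_mult_mat_vec[of _ q q _ q])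
    also have "\<dots> $ i = (1 / v i) * (M *\<^sub>v (L *\<^sub>v row G a)) $ i"
    proof -
      have "(D *\<^sub>v z) $ i = (1 / v i) * z $ i" if z: "z \<in> carrier_vec q" for z
      proof -
        have "(D *\<^sub>v z) $ i = (\<Sum>j<q. (if i = j then 1 / v j else 0) * z $ j)"
          using i z by (simp add: D_def mat_diag_def scalar_prod_def lessThan_atLeast0)
        also have "\<dots> = (\<Sum>j<q. if i = j then (1 / v j) * z $ j else 0)"
          by (intro sum.cong) auto
        finally show ?thesis using i by simp
      qed
      then show ?thesis using M Lg by simp
    qed
    also have "(M *\<^sub>v (L *\<^sub>v row G a)) $ i = (1 / (real T)\<^sup>2) * (col Gt i \<bullet> (G *\<^sub>v (L *\<^sub>v row G a)))"
    proof -
      have "M *\<^sub>v (L *\<^sub>v row G a) = (1 / (real T)\<^sup>2) \<cdot>\<^sub>v ((transpose_mat Gt * G) *\<^sub>v (L *\<^sub>v row G a))"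
      proof -
        have "(c \<cdot>\<^sub>m P) *\<^sub>v z = c \<cdot>\<^sub>v (P *\<^sub>v z)" if "P \<in> carrier_mat q q" "z \<in> carrier_vec q" for c :: real and P z
          using that by (intro eq_vecI) auto
        then show ?thesis unfolding M_def using Gt G Lg by simp
      qed
      also have "(transpose_mat Gt * G) *\<^sub>v (L *\<^sub>v row G a) = transpose_mat Gt *\<^sub>v (G *\<^sub>v (L *\<^sub>v row G a))"
        using Gt G Lg by (intro assoc_mult_mat_vec[of _ q T _ q]) auto
      finally show ?thesis using Gt i by simp
    qed
    \<comment> \<open>Multiplying row \<open>a\<close> of \<open>G\<close> by \<open>L\<close> and
      \<open>G\<close> yields column \<open>a\<close> of \<open>A\<close>; symmetry turns it into
      row \<open>a\<close>, to be compared with row \<open>a\<close> of \<Omega>.\<close>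
    also have "col Gt i \<bullet> (G *\<^sub>v (L *\<^sub>v row G a)) = real T * (e i \<bullet> row A a)"
    proof -
      have "row A a = col A a" using tA A a by (metis carrier_matD(1) row_transpose carrier_matD(2))
      moreover have "col A a \<in> carrier_vec T" using A a by simp
      ultimately show ?thesis unfolding cG[OF i] colA[symmetric] using ec[OF i] by simp
    qed
    finally have Hga: "(D * M * L *\<^sub>v row G a) $ i = (e i \<bullet> row A a) / (real T * v i)"
      using T vi by (simp add: field_simps power2_eq_square)
    \<comment> \<open>The eigenvalue is T^2 v_i and the column is T e_i, so the eigenvector equation
      leaves one factor T in the denominator.\<close>
    have Gta: "Gt $$ (a, i) = (e i \<bullet> row \<Omega> a) / (real T * v i)"
    proof -
      have "Gt $$ (a, i) = col Gt i $ a" using Gt a i by simp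
      also have "\<dots> = real T * e i $ a" unfolding cG[OF i] using ec[OF i] a by simp
      finally have 1: "Gt $$ (a, i) = real T * e i $ a" .
      have "(\<Omega> *\<^sub>v e i) $ a = (real T)\<^sup>2 * v i * e i $ a"
        unfolding ev[OF i] v_eig[OF i] using ec[OF i] a by simp
      moreover have "(\<Omega> *\<^sub>v e i) $ a = row \<Omega> a \<bullet> e i" using \<Omega> a by simp
      moreover have "row \<Omega> a \<bullet> e i = e i \<bullet> row \<Omega> a"
        using \<Omega> a ec[OF i] by (intro comm_scalar_prod[of _ T]) auto
      ultimately have "e i \<bullet> row \<Omega> a = (real T)\<^sup>2 * v i * e i $ a" by simp
      then show ?thesis unfolding 1 using T vi by (simp add: power2_eq_square)
    qed
    have "row R a = row \<Omega> a - row A a" using \<Omega> A a unfolding R_def by (intro eq_vecI) auto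
    then have "e i \<bullet> row R a = e i \<bullet> row \<Omega> a - e i \<bullet> row A a"
      using ec[OF i] \<Omega> A a by (simp add: scalar_prod_minus_distrib[of _ T])
    moreover have "(row Gt a - D * M * L *\<^sub>v row G a) $ i = Gt $$ (a, i) - (D * M * L *\<^sub>v row G a) $ i"
      using D M L Gt a i by simp
    ultimately show ?thesis
      unfolding H D_def[symmetric] M_def[symmetric] by (simp add: Gta Hga diff_divide_distrib)
  qed
  have row_err: "(vnorm (row Gt a - H_mat T (V_mat T q \<Omega>) Gt G L *\<^sub>v row G a))\<^sup>2
      \<le> (row R a \<bullet> row R a) / ((real T)\<^sup>2 * \<mu>\<^sup>2)" if a: "a < T" for a
  proof -
    define d where "d = row Gt a - H_mat T (V_mat T q \<Omega>) Gt G L *\<^sub>v row G a"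
    have "dim_row (H_mat T (V_mat T q \<Omega>) Gt G L) = q" unfolding H by (simp add: mat_diag_def)
    then have d: "d \<in> carrier_vec q" using Gt unfolding d_def by (intro carrier_vecI) simp
    have dd: "d \<bullet> d = (\<Sum>i<q. ((e i \<bullet> row R a) / (real T * v i))\<^sup>2)"
      unfolding scalar_prod_self[OF d] by (rule sum.cong) (auto simp: d_def err[OF a])
    also have "\<dots> \<le> (\<Sum>i<q. (e i \<bullet> row R a)\<^sup>2 / ((real T)\<^sup>2 * \<mu>\<^sup>2))"
    proof (rule sum_mono)
      fix i assume "i \<in> {..<q}"
      then have "\<mu> \<le> v i" using v_ge by simp
      then have "(real T)\<^sup>2 * \<mu>\<^sup>2 \<le> (real T)\<^sup>2 * (v i)\<^sup>2" using \<mu>(1) by (intro mult_left_mono power_mono) auto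
      moreover have "(real T)\<^sup>2 * \<mu>\<^sup>2 > 0" using T \<mu>(1) by simp
      ultimately show "((e i \<bullet> row R a) / (real T * v i))\<^sup>2 \<le> (e i \<bullet> row R a)\<^sup>2 / ((real T)\<^sup>2 * \<mu>\<^sup>2)"
        unfolding power_divide power_mult_distrib
        using frac_le[OF zero_le_power2 order_refl] by blast
    qed
    also have "\<dots> = (\<Sum>i<q. (e i \<bullet> row R a)\<^sup>2) / ((real T)\<^sup>2 * \<mu>\<^sup>2)" by (simp add: sum_divide_distrib)
    also have "\<dots> \<le> (row R a \<bullet> row R a) / ((real T)\<^sup>2 * \<mu>\<^sup>2)"
      using R a by (intro divide_right_mono bessel_inequality[OF on]) auto
    finally have fin: "d \<bullet> d \<le> (row R a \<bullet> row R a) / ((real T)\<^sup>2 * \<mu>\<^sup>2)" .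
    have "d \<bullet> d \<ge> 0" using d by (simp add: scalar_prod_self[of _ q] sum_nonneg)
    then show ?thesis using fin unfolding d_def[symmetric] vnorm_def by simp
  qed
  have "(\<Sum>a<T. (vnorm (row Gt a - H_mat T (V_mat T q \<Omega>) Gt G L *\<^sub>v row G a))\<^sup>2) / real T
      \<le> (\<Sum>a<T. (row R a \<bullet> row R a) / ((real T)\<^sup>2 * \<mu>\<^sup>2)) / real T"
    using T by (intro divide_right_mono sum_mono row_err) auto
  also have "\<dots> = frob2 R / (\<mu>\<^sup>2 * real T ^ 3)"
    unfolding frob2_rows[OF R] sum_divide_distrib[symmetric] by (simp add: power3_eq_cube power2_eq_square)
  finally show ?thesis by (simp add: R_def A_def)
qed

section \<open>The sample at fixed sizes\<close>

lemma quadratic_form_unit_vec: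
  fixes A :: "real mat"
  assumes "A \<in> carrier_mat n n" "i < n"
  shows "unit_vec n i \<bullet> (A *\<^sub>v unit_vec n i) = A $$ (i, i)"
  using assms by (simp add: mult_mat_unit_vec[of _ n n] scalar_prod_left_unit)

lemma fam_inner_lincomb_right:
  assumes "\<And>l. l \<in> I \<Longrightarrow> f l \<in> fam_L2 C N" "h \<in> fam_L2 C N"
  shows "fam_inner C N h (\<lambda>i u. \<Sum>l\<in>I. c l * f l i u) = (\<Sum>l\<in>I. c l * fam_inner C N h (f l))"
  using fam_inner_lincomb_left[OF assms] by (simp only: fam_inner_commute[of C N h])

lemma sum_atLeast1_eq_lessThan: "(\<Sum>t=1..n. f t) = (\<Sum>a<n. f (a + 1))"
  for f :: "nat \<Rightarrow> real"
  using sum.atLeast1_atMost_eq[of f n] by simp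

text \<open>One pair of sample sizes is frozen. All bounds in this context are inequalities with
  explicit constants, so that their uniformity in N, T and q can be read off before the limit is
  taken.\<close>

locale factor_sample = noise M C \<epsilon> \<zeta> c\<^sub>e c\<^sub>h
  for M :: "'w measure" and C :: "nat \<Rightarrow> 'u::euclidean_space set" and \<epsilon> \<zeta> c\<^sub>e c\<^sub>h +
  fixes N T q k :: nat and Cs :: "nat \<Rightarrow> 'v::euclidean_space set"
    and B :: "nat \<Rightarrow> nat \<Rightarrow> 'u \<Rightarrow> 'v \<Rightarrow> real" and \<phi> :: "nat \<Rightarrow> nat \<Rightarrow> 'v \<Rightarrow> real"
    and G :: "nat \<Rightarrow> nat \<Rightarrow> 'w \<Rightarrow> real" and F \<eta> :: "nat \<Rightarrow> nat \<Rightarrow> 'w \<Rightarrow> 'v \<Rightarrow> real"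
    and Z :: "nat \<Rightarrow> nat \<Rightarrow> 'w \<Rightarrow> 'u \<Rightarrow> real" and c\<^sub>B :: real
  assumes N: "N \<ge> 1" and T: "T \<ge> 1"
    and B_op: "\<And>i j. i \<ge> 1 \<Longrightarrow> j \<in> {1..k} \<Longrightarrow> L2_integral_operator (Cs j) (C i) (B i j)"
    and cB: "c\<^sub>B > 0"
    and B_norm: "\<And>i j. i \<ge> 1 \<Longrightarrow> j \<in> {1..k} \<Longrightarrow>
          L2_opnorm (Cs j) (C i) (int_op (Cs j) (B i j)) \<le> ennreal c\<^sub>B"
    and basis: "\<And>j l. j \<in> {1..k} \<Longrightarrow> l < q \<Longrightarrow> \<phi> j l \<in> L2 (Cs j)"
    and F_random: "\<And>j t. j \<in> {1..k} \<Longrightarrow> t \<ge> 1 \<Longrightarrow> random_L2 M (Cs j) (F j t)"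
    and eta_random: "\<And>j t. j \<in> {1..k} \<Longrightarrow> t \<ge> 1 \<Longrightarrow> random_L2 M (Cs j) (\<eta> j t)"
    and Z_random: "\<And>i t. i \<ge> 1 \<Longrightarrow> t \<ge> 1 \<Longrightarrow> random_L2 M (C i) (Z i t)"
    and Z_model: "\<And>i t. i \<ge> 1 \<Longrightarrow> t \<ge> 1 \<Longrightarrow> AE w in M. AE u in lebesgue_on (C i).
            Z i t w u = (\<Sum>j=1..k. int_op (Cs j) (B i j) (F j t w) u) + \<epsilon> i t w u"
    and F_model: "\<And>j t. j \<in> {1..k} \<Longrightarrow> t \<ge> 1 \<Longrightarrow> AE w in M. AE v in lebesgue_on (Cs j).
            F j t w v = (\<Sum>l<q. \<phi> j l v * G l t w) + \<eta> j t w v"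
    and eta_moment: "\<And>j t. j \<in> {1..k} \<Longrightarrow> t \<ge> 1 \<Longrightarrow> integrable M (\<lambda>w. (L2_norm (Cs j) (\<eta> j t w))\<^sup>2)"
begin

abbreviation "\<Lambda> \<equiv> Lambda k Cs B \<phi>"
abbreviation "ip \<equiv> fam_inner C N"
abbreviation "Gram \<equiv> loading_gram C N q \<Lambda>"

definition common :: "'w \<Rightarrow> nat \<Rightarrow> nat \<Rightarrow> 'u \<Rightarrow> real" where
  "common w t = (\<lambda>i u. \<Sum>l<q. G l t w * \<Lambda> i l u)"

definition sieve_err :: "'w \<Rightarrow> nat \<Rightarrow> nat \<Rightarrow> 'u \<Rightarrow> real" where
  "sieve_err w t = (\<lambda>i u. \<Sum>j=1..k. int_op (Cs j) (B i j) (\<eta> j t w) u)"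

lemma Lambda_L2: "i \<ge> 1 \<Longrightarrow> l < q \<Longrightarrow> \<Lambda> i l \<in> L2 (C i)"
  unfolding Lambda_def[abs_def] by (intro L2_sum int_op_L2[OF B_op] basis) auto

lemma Lambda_fam: "l < q \<Longrightarrow> (\<lambda>i. \<Lambda> i l) \<in> fam_L2 C N"
  by (simp add: fam_L2_def Lambda_L2)

lemma common_fam: "common w t \<in> fam_L2 C N"
  unfolding common_def using Lambda_fam by (intro fam_L2_lincomb) auto

lemma sieve_err_L2: "i \<ge> 1 \<Longrightarrow> t \<ge> 1 \<Longrightarrow> w \<in> space M \<Longrightarrow> sieve_err w t i \<in> L2 (C i)"
  unfolding sieve_err_def by (intro L2_sum int_op_L2[OF B_op] random_L2_mem[OF eta_random]) auto

lemma sieve_err_fam: "t \<ge> 1 \<Longrightarrow> w \<in> space M \<Longrightarrow> sieve_err w t \<in> fam_L2 C N"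
  by (simp add: fam_L2_def sieve_err_L2)

lemma Gram_carrier: "Gram \<in> carrier_mat q q"
  by (simp add: loading_gram_def)

lemma Gram_index: "l < q \<Longrightarrow> m < q \<Longrightarrow> Gram $$ (l, m) = ip (\<lambda>i. \<Lambda> i l) (\<lambda>i. \<Lambda> i m)"
  by (simp add: loading_gram_def fam_inner_def)

lemma Gram_sym: "transpose_mat Gram = Gram"
  by (rule eq_matI) (auto simp: loading_gram_def L2_inner_commute)

lemma G_mat_carrier: "G_mat T q G w \<in> carrier_mat T q"
  by (simp add: G_mat_def)

lemma ip_common:
  "ip (common w t) (common w s) = (\<Sum>l<q. \<Sum>m<q. G l t w * G m s w * Gram $$ (l, m))"
proof -
  have "ip (common w t) (common w s) = (\<Sum>l<q. G l t w * ip (\<lambda>i. \<Lambda> i l) (common w s))"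
    unfolding common_def[of w t] using Lambda_fam common_fam by (intro fam_inner_lincomb_left) auto
  also have "\<dots> = (\<Sum>l<q. G l t w * (\<Sum>m<q. G m s w * ip (\<lambda>i. \<Lambda> i l) (\<lambda>i. \<Lambda> i m)))"
    unfolding common_def[of w s] using Lambda_fam
    by (intro sum.cong refl arg_cong2[where f = "(*)"] fam_inner_lincomb_right) auto
  finally show ?thesis by (simp add: Gram_index sum_distrib_left mult.assoc)
qed

lemma signal_index:
  assumes "a < T" "b < T"
  shows "(G_mat T q G w * Gram * transpose_mat (G_mat T q G w)) $$ (a, b)
    = ip (common w (a + 1)) (common w (b + 1))"
proof -
  have "(G_mat T q G w * Gram * transpose_mat (G_mat T q G w)) $$ (a, b)
      = (\<Sum>m<q. (\<Sum>l<q. G l (a + 1) w * Gram $$ (l, m)) * G m (b + 1) w)"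
    using assms Gram_carrier by (simp add: G_mat_def scalar_prod_def lessThan_atLeast0)
  also have "\<dots> = (\<Sum>l<q. \<Sum>m<q. G l (a + 1) w * G m (b + 1) w * Gram $$ (l, m))"
    unfolding sum_distrib_right by (subst sum.swap) (simp add: mult_ac)
  finally show ?thesis unfolding ip_common .
qed

text \<open>Inserting the factor model into the operators and exchanging the sums over j and l turns
  the images of the basis functions into loadings. The exceptional null sets depend on i, t and j,
  but there are finitely many of them.\<close>

lemma model_decomposition:
  "AE w in M. \<forall>i\<in>{1..N}. \<forall>t\<in>{1..T}. AE u in lebesgue_on (C i).
     Z i t w u = (common w t i u + sieve_err w t i u) + \<epsilon> i t w u"
proof (rule AE_finite_allI, simp, rule AE_finite_allI, simp)
  fix i t assume "i \<in> {1..N}" "t \<in> {1..T}"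
  then have it: "i \<ge> 1" "t \<ge> 1" by auto
  have "AE w in M. \<forall>j\<in>{1..k}. AE v in lebesgue_on (Cs j).
      F j t w v = (\<Sum>l<q. \<phi> j l v * G l t w) + \<eta> j t w v"
    by (rule AE_finite_allI) (auto intro: F_model it)
  with Z_model[OF it] show "AE w in M. AE u in lebesgue_on (C i).
     Z i t w u = (common w t i u + sieve_err w t i u) + \<epsilon> i t w u"
    using AE_space
  proof eventually_elim
    case (elim w)
    have "AE u in lebesgue_on (C i). \<forall>j\<in>{1..k}. int_op (Cs j) (B i j) (F j t w) u
        = (\<Sum>l<q. G l t w * int_op (Cs j) (B i j) (\<phi> j l) u) + int_op (Cs j) (B i j) (\<eta> j t w) u"
    proof (rule AE_finite_allI)
      fix j assume j: "j \<in> {1..k}"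
      show "AE u in lebesgue_on (C i). int_op (Cs j) (B i j) (F j t w) u
        = (\<Sum>l<q. G l t w * int_op (Cs j) (B i j) (\<phi> j l) u) + int_op (Cs j) (B i j) (\<eta> j t w) u"
        using j elim(2,3) it
        by (intro int_op_lincomb B_op basis random_L2_mem[OF F_random] random_L2_mem[OF eta_random]) auto
    qed simp
    with elim(1) show ?case
    proof eventually_elim
      case (elim u)
      have "(\<Sum>j=1..k. int_op (Cs j) (B i j) (F j t w) u)
          = (\<Sum>j=1..k. \<Sum>l<q. G l t w * int_op (Cs j) (B i j) (\<phi> j l) u)
            + (\<Sum>j=1..k. int_op (Cs j) (B i j) (\<eta> j t w) u)"
        using elim(2) by (simp add: sum.distrib)
      also have "(\<Sum>j=1..k. \<Sum>l<q. G l t w * int_op (Cs j) (B i j) (\<phi> j l) u) = common w t i u"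
        unfolding common_def Lambda_def sum_distrib_left by (rule sum.swap)
      finally show ?case using elim(1) by (simp add: sieve_err_def)
    qed
  qed
qed

definition remainder :: "'w \<Rightarrow> real mat" where
  "remainder w = Omega_tilde C N T Z w - G_mat T q G w * Gram * transpose_mat (G_mat T q G w)"

text \<open>The entries of \<open>Omega_tilde\<close> see only almost-everywhere classes, so
  \<open>Z\<close> may be replaced by its decomposition; then \<open>gram_remainder_bound\<close>
  applies at the fixed sample point.\<close>

lemma frob2_remainder:
  assumes w: "w \<in> space M"
    and dec: "\<forall>i\<in>{1..N}. \<forall>t\<in>{1..T}. AE u in lebesgue_on (C i).
     Z i t w u = (common w t i u + sieve_err w t i u) + \<epsilon> i t w u"
  shows "frob2 (remainder w) \<le>
    8 * (2 * (\<Sum>t=1..T. ip (common w t) (common w t)) * (\<Sum>t=1..T. ip (sieve_err w t) (sieve_err w t))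
      + (\<Sum>t=1..T. ip (sieve_err w t) (sieve_err w t))\<^sup>2
      + 2 * (\<Sum>t=1..T. \<Sum>l<q. (G l t w)\<^sup>2) * (\<Sum>t=1..T. \<Sum>l<q. (ip (\<lambda>i. \<Lambda> i l) (\<lambda>i. \<epsilon> i t w))\<^sup>2)
      + 2 * (\<Sum>t=1..T. ip (sieve_err w t) (sieve_err w t)) * (\<Sum>t=1..T. ip (\<lambda>i. \<epsilon> i t w) (\<lambda>i. \<epsilon> i t w))
      + (\<Sum>t=1..T. \<Sum>s=1..T. (ip (\<lambda>i. \<epsilon> i t w) (\<lambda>i. \<epsilon> i s w))\<^sup>2))"
proof -
  define Y where "Y t = (\<lambda>i u. (common w t i u + sieve_err w t i u) + \<epsilon> i t w u)" for t
  have Y: "Y t \<in> fam_L2 C N" if "t \<ge> 1" for t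
    unfolding Y_def using common_fam sieve_err_fam[OF that w] eps_mem[OF that w] by (intro fam_L2_add)
  have om: "(\<Sum>i=1..N. L2_inner (C i) (Z i t w) (Z i s w)) / real N = ip (Y t) (Y s)"
    if t: "t \<in> {1..T}" "s \<in> {1..T}" for t s
  proof -
    have "L2_inner (C i) (Z i t w) (Z i s w) = L2_inner (C i) (Y t i) (Y s i)" if i: "i \<in> {1..N}" for i
    proof (rule L2_inner_cong_AE)
      show "AE u in lebesgue_on (C i). Z i t w u = Y t i u" "AE u in lebesgue_on (C i). Z i s w u = Y s i u"
        unfolding Y_def using dec i t by blast+
      show "Z i t w \<in> L2 (C i)" "Z i s w \<in> L2 (C i)"
        using i t by (auto intro: random_L2_mem[OF Z_random _ ] w)
      show "Y t i \<in> L2 (C i)" "Y s i \<in> L2 (C i)" using Y[of t] Y[of s] i t by (auto simp: fam_L2_def)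
    qed
    then show ?thesis by (simp add: fam_inner_def)
  qed
  have car: "Omega_tilde C N T Z w \<in> carrier_mat T T" by (simp add: Omega_tilde_def)
  have "frob2 (remainder w)
      = (\<Sum>a<T. \<Sum>b<T. (ip (Y (a + 1)) (Y (b + 1)) - ip (common w (a + 1)) (common w (b + 1)))\<^sup>2)"
  proof -
    have d: "dim_row (remainder w) = T" "dim_col (remainder w) = T"
      using car G_mat_carrier Gram_carrier by (auto simp: remainder_def)
    have "remainder w $$ (a, b) = ip (Y (a + 1)) (Y (b + 1)) - ip (common w (a + 1)) (common w (b + 1))"
      if "a < T" "b < T" for a b
    proof -
      have "remainder w $$ (a, b) = Omega_tilde C N T Z w $$ (a, b)
          - (G_mat T q G w * Gram * transpose_mat (G_mat T q G w)) $$ (a, b)"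
        unfolding remainder_def using that by (intro index_minus_mat) (auto simp: G_mat_def)
      also have "Omega_tilde C N T Z w $$ (a, b) = ip (Y (a + 1)) (Y (b + 1))"
        using om[of "a + 1" "b + 1"] that by (simp add: Omega_tilde_def)
      finally show ?thesis by (simp only: signal_index[OF that])
    qed
    then show ?thesis by (simp add: frob2_def d)
  qed
  also have "\<dots> = (\<Sum>t=1..T. \<Sum>s=1..T. (ip (Y t) (Y s) - ip (common w t) (common w s))\<^sup>2)"
    by (simp only: sum_atLeast1_eq_lessThan)
  also have "\<dots> \<le> 8 * (2 * (\<Sum>t=1..T. ip (common w t) (common w t)) * (\<Sum>t=1..T. ip (sieve_err w t) (sieve_err w t))
      + (\<Sum>t=1..T. ip (sieve_err w t) (sieve_err w t))\<^sup>2
      + 2 * (\<Sum>t=1..T. \<Sum>l<q. (G l t w)\<^sup>2) * (\<Sum>t=1..T. \<Sum>l<q. (ip (\<lambda>i. \<Lambda> i l) (\<lambda>i. \<epsilon> i t w))\<^sup>2)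
      + 2 * (\<Sum>t=1..T. ip (sieve_err w t) (sieve_err w t)) * (\<Sum>t=1..T. ip (\<lambda>i. \<epsilon> i t w) (\<lambda>i. \<epsilon> i t w))
      + (\<Sum>t=1..T. \<Sum>s=1..T. (ip (\<lambda>i. \<epsilon> i t w) (\<lambda>i. \<epsilon> i s w))\<^sup>2))"
    by (rule gram_remainder_bound[where g = "\<lambda>l t. G l t w" and X = "sieve_err w" and E = "\<lambda>t i. \<epsilon> i t w"])
      (auto simp: Lambda_fam sieve_err_fam w eps_mem common_def Y_def)
  finally show ?thesis .
qed

text \<open>The factor \<open>k\<close> is the price of Cauchy-Schwarz for the sum over j. The
  operator bound is uniform in i, so it survives the averaging.\<close>

lemma sieve_err_energy:
  assumes t: "t \<ge> 1" and w: "w \<in> space M"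
  shows "ip (sieve_err w t) (sieve_err w t) \<le> real k * c\<^sub>B\<^sup>2 * (\<Sum>j=1..k. (L2_norm (Cs j) (\<eta> j t w))\<^sup>2)"
proof -
  define D where "D = real k * c\<^sub>B\<^sup>2 * (\<Sum>j=1..k. (L2_norm (Cs j) (\<eta> j t w))\<^sup>2)"
  have "L2_inner (C i) (sieve_err w t i) (sieve_err w t i) \<le> D" if i: "i \<in> {1..N}" for i
  proof -
    have i1: "i \<ge> 1" using i by simp
    have eta: "\<eta> j t w \<in> L2 (Cs j)" if "j \<in> {1..k}" for j by (rule random_L2_mem[OF eta_random[OF that t] w])
    have "L2_inner (C i) (sieve_err w t i) (sieve_err w t i)
        \<le> real k * (\<Sum>j=1..k. L2_inner (C i) (int_op (Cs j) (B i j) (\<eta> j t w)) (int_op (Cs j) (B i j) (\<eta> j t w)))"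
      unfolding sieve_err_def by (rule L2_inner_self_sum_le) (rule int_op_L2[OF B_op[OF i1] eta])
    also have "\<dots> \<le> real k * (\<Sum>j=1..k. c\<^sub>B\<^sup>2 * L2_inner (Cs j) (\<eta> j t w) (\<eta> j t w))"
      by (intro mult_left_mono sum_mono int_op_norm_le[OF B_op[OF i1] B_norm[OF i1] cB eta]) auto
    also have "\<dots> = D" by (simp add: D_def L2_norm_sq sum_distrib_left mult.assoc)
    finally show ?thesis .
  qed
  then have "(\<Sum>i=1..N. L2_inner (C i) (sieve_err w t i) (sieve_err w t i)) \<le> (\<Sum>i=1..N. D)"
    by (rule sum_mono)
  then show ?thesis using N unfolding fam_inner_def D_def[symmetric] by (simp add: field_simps)
qed

text \<open>Four applications of Markov's inequality at level e/4 control the sieve error and the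
  noise. The sums that involve \<open>G\<close> stay random here; they are bounded later, on the
  events where the eigenvalues and the sample second moments of \<open>G\<close> are under
  control.\<close>

lemma remainder_event:
  assumes e: "e > 0" and dt: "\<And>j t. j \<in> {1..k} \<Longrightarrow> t \<ge> 1 \<Longrightarrow>
          (LINT w|M. (L2_norm (Cs j) (\<eta> j t w))\<^sup>2) \<le> (d t)\<^sup>2"
  defines "x \<equiv> real k * c\<^sub>B\<^sup>2 * (real k * (\<Sum>t=1..T. (d t)\<^sup>2) / (e / 4))"
    and "y \<equiv> real T * (c\<^sub>h * (\<Sum>l<q. Gram $$ (l, l)) / real N) / (e / 4)"
    and "z \<equiv> real T * c\<^sub>e / (e / 4)"
    and "v \<equiv> (2 * real T * c\<^sub>e\<^sup>2 + 2 * (real T)\<^sup>2 * c\<^sub>e / real N) / (e / 4)"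
  shows "\<exists>A\<in>events. prob A \<ge> 1 - e \<and> (\<forall>w\<in>A. frob2 (remainder w) \<le>
    8 * (2 * (\<Sum>t=1..T. ip (common w t) (common w t)) * x + x\<^sup>2
      + 2 * (\<Sum>t=1..T. \<Sum>l<q. (G l t w)\<^sup>2) * y + 2 * x * z + v))"
proof -
  have e4: "e / 4 > 0" using e by simp
  obtain A0 where A0: "A0 \<in> events" "prob A0 = 1" "\<forall>w\<in>A0. \<forall>i\<in>{1..N}. \<forall>t\<in>{1..T}. AE u in lebesgue_on (C i).
     Z i t w u = (common w t i u + sieve_err w t i u) + \<epsilon> i t w u"
    using AE_event[OF model_decomposition] by blast
  define Y1 where "Y1 w = (\<Sum>t=1..T. \<Sum>j=1..k. (L2_norm (Cs j) (\<eta> j t w))\<^sup>2)" for w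
  have Y1i: "integrable M Y1"
    unfolding Y1_def using eta_moment by (intro Bochner_Integration.integrable_sum) auto
  have "(LINT w|M. Y1 w) = (\<Sum>t=1..T. LINT w|M. (\<Sum>j=1..k. (L2_norm (Cs j) (\<eta> j t w))\<^sup>2))"
    unfolding Y1_def using eta_moment
    by (intro Bochner_Integration.integral_sum Bochner_Integration.integrable_sum) auto
  also have "\<dots> = (\<Sum>t=1..T. \<Sum>j=1..k. LINT w|M. (L2_norm (Cs j) (\<eta> j t w))\<^sup>2)"
    using eta_moment by (intro sum.cong refl Bochner_Integration.integral_sum) auto
  also have "\<dots> \<le> (\<Sum>t=1..T. \<Sum>j=1..k. (d t)\<^sup>2)" by (intro sum_mono dt) auto
  also have "\<dots> = real k * (\<Sum>t=1..T. (d t)\<^sup>2)" by (simp add: sum_distrib_left)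
  finally have Y1e: "(LINT w|M. Y1 w) \<le> real k * (\<Sum>t=1..T. (d t)\<^sup>2)" .
  obtain A1 where A1: "A1 \<in> events" "prob A1 \<ge> 1 - e / 4"
      "\<forall>w\<in>A1. Y1 w \<le> real k * (\<Sum>t=1..T. (d t)\<^sup>2) / (e / 4)"
    using markov_event[OF Y1i _ Y1e e4] by (auto simp: Y1_def sum_nonneg)
  have tr: "(\<Sum>l<q. ip (\<lambda>i. \<Lambda> i l) (\<lambda>i. \<Lambda> i l)) = (\<Sum>l<q. Gram $$ (l, l))" by (simp add: Gram_index)
  have "\<exists>A2\<in>events. prob A2 \<ge> 1 - e / 4 \<and>
      (\<forall>w\<in>A2. (\<Sum>t=1..T. \<Sum>l<q. (ip (\<lambda>i. \<Lambda> i l) (\<lambda>i. \<epsilon> i t w))\<^sup>2) \<le> y)"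
    unfolding y_def tr[symmetric]
    by (rule markov_event[OF loading_noise_moment(1)[OF N] _ loading_noise_moment(2)[OF N] e4])
      (auto intro!: Lambda_L2 sum_nonneg)
  then obtain A2 where A2: "A2 \<in> events" "prob A2 \<ge> 1 - e / 4"
      "\<forall>w\<in>A2. (\<Sum>t=1..T. \<Sum>l<q. (ip (\<lambda>i. \<Lambda> i l) (\<lambda>i. \<epsilon> i t w))\<^sup>2) \<le> y" by blast
  have "\<exists>A3\<in>events. prob A3 \<ge> 1 - e / 4 \<and>
      (\<forall>w\<in>A3. (\<Sum>t=1..T. ip (\<lambda>i. \<epsilon> i t w) (\<lambda>i. \<epsilon> i t w)) \<le> z)"
    unfolding z_def
    by (rule markov_event[OF noise_energy_moment(1)[OF N] _ noise_energy_moment(2)[OF N] e4])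
      (intro sum_nonneg fam_inner_self_nonneg)
  then obtain A3 where A3: "A3 \<in> events" "prob A3 \<ge> 1 - e / 4"
      "\<forall>w\<in>A3. (\<Sum>t=1..T. ip (\<lambda>i. \<epsilon> i t w) (\<lambda>i. \<epsilon> i t w)) \<le> z" by blast
  have "\<exists>A4\<in>events. prob A4 \<ge> 1 - e / 4 \<and>
      (\<forall>w\<in>A4. (\<Sum>t=1..T. \<Sum>s=1..T. (ip (\<lambda>i. \<epsilon> i t w) (\<lambda>i. \<epsilon> i s w))\<^sup>2) \<le> v)"
    unfolding v_def
    by (rule markov_event[OF noise_gram_moment(1)[OF N] _ noise_gram_moment(2)[OF N] e4])
      (intro sum_nonneg zero_le_power2)
  then obtain A4 where A4: "A4 \<in> events" "prob A4 \<ge> 1 - e / 4"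
      "\<forall>w\<in>A4. (\<Sum>t=1..T. \<Sum>s=1..T. (ip (\<lambda>i. \<epsilon> i t w) (\<lambda>i. \<epsilon> i s w))\<^sup>2) \<le> v" by blast
  define A where "A = A0 \<inter> ((A1 \<inter> A2) \<inter> (A3 \<inter> A4))"
  have Aev: "A \<in> events" using A0 A1 A2 A3 A4 by (auto simp: A_def)
  \<comment> \<open>The almost sure event \<open>A0\<close> costs 0; the bracketing follows the
    nested intersections.\<close>
  have "prob A \<ge> 1 - (0 + ((e / 4 + e / 4) + (e / 4 + e / 4)))"
    unfolding A_def using A0 A1 A2 A3 A4 by (intro prob_inter_ge sets.Int) auto
  then have PA: "prob A \<ge> 1 - e" by simp
  show ?thesis
  proof (intro bexI[of _ A] conjI ballI PA Aev)
    fix w assume wA: "w \<in> A"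
    then have w: "w \<in> space M" using Aev sets.sets_into_space by blast
    define X where "X = (\<Sum>t=1..T. ip (sieve_err w t) (sieve_err w t))"
    define al where "al = (\<Sum>t=1..T. ip (common w t) (common w t))"
    define ga where "ga = (\<Sum>t=1..T. \<Sum>l<q. (G l t w)\<^sup>2)"
    define be where "be = (\<Sum>t=1..T. \<Sum>l<q. (ip (\<lambda>i. \<Lambda> i l) (\<lambda>i. \<epsilon> i t w))\<^sup>2)"
    define th where "th = (\<Sum>t=1..T. ip (\<lambda>i. \<epsilon> i t w) (\<lambda>i. \<epsilon> i t w))"
    define ps where "ps = (\<Sum>t=1..T. \<Sum>s=1..T. (ip (\<lambda>i. \<epsilon> i t w) (\<lambda>i. \<epsilon> i s w))\<^sup>2)"
    have nn: "X \<ge> 0" "al \<ge> 0" "ga \<ge> 0" "be \<ge> 0" "th \<ge> 0"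
      by (auto simp: X_def al_def ga_def be_def th_def intro!: sum_nonneg fam_inner_self_nonneg)
    have "X \<le> (\<Sum>t=1..T. real k * c\<^sub>B\<^sup>2 * (\<Sum>j=1..k. (L2_norm (Cs j) (\<eta> j t w))\<^sup>2))"
      unfolding X_def using w by (intro sum_mono sieve_err_energy) auto
    also have "\<dots> = real k * c\<^sub>B\<^sup>2 * Y1 w" by (simp add: Y1_def sum_distrib_left)
    also have "\<dots> \<le> x" unfolding x_def using A1(3) wA by (intro mult_left_mono) (auto simp: A_def)
    finally have X: "X \<le> x" .
    have be: "be \<le> y" using A2(3) wA by (auto simp: A_def be_def)
    have th: "th \<le> z" using A3(3) wA by (auto simp: A_def th_def)
    have ps: "ps \<le> v" using A4(3) wA by (auto simp: A_def ps_def)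
    have "frob2 (remainder w) \<le> 8 * (2 * al * X + X\<^sup>2 + 2 * ga * be + 2 * X * th + ps)"
      unfolding X_def al_def ga_def be_def th_def ps_def
      using A0(3) wA by (intro frob2_remainder[OF w]) (auto simp: A_def)
    also have "\<dots> \<le> 8 * (2 * al * x + x\<^sup>2 + 2 * ga * y + 2 * x * z + v)"
      using X be th ps nn by (intro mult_left_mono add_mono mult_mono power_mono) auto
    finally show "frob2 (remainder w) \<le>
    8 * (2 * (\<Sum>t=1..T. ip (common w t) (common w t)) * x + x\<^sup>2
      + 2 * (\<Sum>t=1..T. \<Sum>l<q. (G l t w)\<^sup>2) * y + 2 * x * z + v)"
      by (simp only: al_def ga_def)
  qed
qed

end

section \<open>Perturbed forms and the arithmetic of the rate\<close>

lemma quadratic_form_sum: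
  fixes A :: "real mat"
  assumes "A \<in> carrier_mat n n" "x \<in> carrier_vec n"
  shows "x \<bullet> (A *\<^sub>v x) = (\<Sum>l<n. \<Sum>m<n. x $ l * x $ m * A $$ (l, m))"
  using assms by (simp add: scalar_prod_def lessThan_atLeast0 sum_distrib_left mult_ac)

lemma quadratic_form_perturb:
  assumes A: "A \<in> carrier_mat n n" and B: "B \<in> carrier_mat n n" and x: "x \<in> carrier_vec n"
    and d: "mat_opnorm (A - B) \<le> d"
  shows "x \<bullet> (B *\<^sub>v x) - d * (x \<bullet> x) \<le> x \<bullet> (A *\<^sub>v x)"
    "x \<bullet> (A *\<^sub>v x) \<le> x \<bullet> (B *\<^sub>v x) + d * (x \<bullet> x)"
proof -
  have AB: "A - B \<in> carrier_mat n n" using A B by auto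
  have xx: "x \<bullet> x \<ge> 0" using x by (simp add: scalar_prod_self[of _ n] sum_nonneg)
  have "x \<bullet> ((A - B) *\<^sub>v x) = x \<bullet> (A *\<^sub>v x) - x \<bullet> (B *\<^sub>v x)"
    unfolding quadratic_form_sum[OF A x] quadratic_form_sum[OF B x] quadratic_form_sum[OF AB x]
    using A B by (simp add: sum_subtractf[symmetric] algebra_simps)
  moreover have "\<bar>x \<bullet> ((A - B) *\<^sub>v x)\<bar> \<le> d * (x \<bullet> x)"
    using quadratic_form_le_opnorm[OF AB x] mult_right_mono[OF d xx] by linarith
  ultimately show "x \<bullet> (B *\<^sub>v x) - d * (x \<bullet> x) \<le> x \<bullet> (A *\<^sub>v x)"
    "x \<bullet> (A *\<^sub>v x) \<le> x \<bullet> (B *\<^sub>v x) + d * (x \<bullet> x)" by linarith+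
qed

lemma pd_form_bounds:
  assumes pd: "pd_mat n S" and ev: "\<And>x. eigenvalue S x \<Longrightarrow> c \<le> x \<and> x \<le> C" and x: "x \<in> carrier_vec n"
  shows "c * (x \<bullet> x) \<le> x \<bullet> (S *\<^sub>v x)" "x \<bullet> (S *\<^sub>v x) \<le> C * (x \<bullet> x)"
proof -
  have S: "S \<in> carrier_mat n n" "transpose_mat S = S" using pd by (auto simp: pd_mat_def)
  have b: "c \<le> eig S (i + 1) \<and> eig S (i + 1) \<le> C" if "i < n" for i
    by (rule ev[OF eig_eigenvalue[OF S that]])
  show "c * (x \<bullet> x) \<le> x \<bullet> (S *\<^sub>v x)" by (rule quadratic_form_ge_min_eig[OF S x]) (use b in blast)
  show "x \<bullet> (S *\<^sub>v x) \<le> C * (x \<bullet> x)" by (rule quadratic_form_le_max_eig[OF S x]) (use b in blast)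
qed

text \<open>\<open>P\<close>, \<open>V\<close> and \<open>U\<close> are the parts of T^3 \<nu>lo^2
  rate that belong to T^-2, 1/N and \<delta>^2, and each term is charged to one or two of them.
  \<open>D \<le> nu\<close> absorbs the square of the sieve error; \<open>c0 \<le> nu\<close>
  supplies the factor \<open>nu\<close> that the mixed term \<open>x * z\<close> and the 1/N part of
  \<open>v\<close> lack.\<close>

lemma remainder_rate_arith:
  fixes T N q :: real
  assumes pos: "T \<ge> 1" "N \<ge> 1" "q \<ge> 1" "c0 > 0" "c0 \<le> nu" "cl > 0" "CL > 0" "D \<ge> 0" "D \<le> nu"
    and K: "K1 \<ge> 0" "K2 \<ge> 0" "K3 \<ge> 0" "K4 \<ge> 0"
    and ga: "0 \<le> ga" "ga \<le> T\<^sup>2 * (2 * q * nu / cl)" and al: "0 \<le> al" "al \<le> 2 * CL * ga"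
    and x: "0 \<le> x" "x \<le> K1 * T * D" and y: "y \<le> K2 * T * q / N"
    and z: "0 \<le> z" "z \<le> K3 * T" and v: "v \<le> K4 * (T + T\<^sup>2 / N)"
  shows "8 * (2 * al * x + x\<^sup>2 + 2 * ga * y + 2 * x * z + v)
    \<le> 8 * (8 * CL * K1 / cl + K1\<^sup>2 + 4 * K2 / cl + 2 * K1 * K3 / c0 + K4 + K4 / c0)
      * (T ^ 3 * (q / T\<^sup>2 + q\<^sup>2 * nu / N + q\<^sup>2 * nu * D))"
proof -
  define P where "P = T ^ 3 * (q / T\<^sup>2)"
  define V where "V = T ^ 3 * (q\<^sup>2 * nu / N)"
  define U where "U = T ^ 3 * (q\<^sup>2 * nu * D)"
  have nu: "nu > 0" using pos by linarith
  have nn: "P \<ge> 0" "V \<ge> 0" "U \<ge> 0" using pos nu by (auto simp: P_def V_def U_def)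
  have q2: "q \<le> q\<^sup>2" "1 \<le> q\<^sup>2" using pos(3) by (auto simp: power2_eq_square mult_le_cancel_left1 self_le_power intro: order_trans[OF pos(3)])
  have T3: "T\<^sup>2 \<le> T ^ 3" using pos(1) by (intro power_increasing) auto
  have nuc: "1 \<le> nu / c0" using pos by simp
  have U1: "T ^ 3 * (q * nu * D) \<le> U"
    unfolding U_def using q2 pos nu by (intro mult_left_mono mult_right_mono) auto
  have U2: "T\<^sup>2 * (nu * D) \<le> U"
  proof -
    have "T\<^sup>2 * (1 * nu * D) \<le> T ^ 3 * (q\<^sup>2 * nu * D)"
      using q2 T3 pos nu by (intro mult_mono) auto
    then show ?thesis by (simp add: U_def)
  qed
  have a: "2 * al * x \<le> 8 * CL * K1 / cl * U"
  proof -
    have "2 * al * x \<le> 2 * (2 * CL * (T\<^sup>2 * (2 * q * nu / cl))) * (K1 * T * D)"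
    proof (intro mult_mono x)
      have "2 * CL * ga \<le> 2 * CL * (T\<^sup>2 * (2 * q * nu / cl))" using ga pos by (intro mult_left_mono) auto
      then show "al \<le> 2 * CL * (T\<^sup>2 * (2 * q * nu / cl))" using al by linarith
    qed (use pos nu x al in auto)
    also have "\<dots> = 8 * CL * K1 / cl * (T ^ 3 * (q * nu * D))"
      by (simp add: power2_eq_square power3_eq_cube)
    also have "\<dots> \<le> 8 * CL * K1 / cl * U" using U1 pos K by (intro mult_left_mono) auto
    finally show ?thesis .
  qed
  have b: "x\<^sup>2 \<le> K1\<^sup>2 * U"
  proof -
    have "x\<^sup>2 \<le> (K1 * T * D)\<^sup>2" using x by (intro power_mono) auto
    also have "\<dots> = K1\<^sup>2 * (T\<^sup>2 * (D * D))" by (simp add: power2_eq_square mult_ac)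
    also have "\<dots> \<le> K1\<^sup>2 * (T\<^sup>2 * (nu * D))" using pos by (intro mult_left_mono mult_right_mono) auto
    also have "\<dots> \<le> K1\<^sup>2 * U" by (intro mult_left_mono U2) auto
    finally show ?thesis .
  qed
  have c: "2 * ga * y \<le> 4 * K2 / cl * V"
  proof -
    have "2 * ga * y \<le> 2 * ga * (K2 * T * q / N)" using y ga by (intro mult_left_mono) auto
    also have "\<dots> \<le> 2 * (T\<^sup>2 * (2 * q * nu / cl)) * (K2 * T * q / N)"
      using ga pos K by (intro mult_right_mono mult_left_mono) auto
    also have "\<dots> = 4 * K2 / cl * V" by (simp add: V_def power2_eq_square power3_eq_cube)
    finally show ?thesis .
  qed
  have d: "2 * x * z \<le> 2 * K1 * K3 / c0 * U"
  proof -
    have "2 * x * z \<le> 2 * (K1 * T * D) * (K3 * T)"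
      using x z pos K by (intro mult_mono) auto
    also have "\<dots> = 2 * K1 * K3 * (T\<^sup>2 * (1 * D))" by (simp add: power2_eq_square)
    also have "\<dots> \<le> 2 * K1 * K3 * (T\<^sup>2 * (nu / c0 * D))"
      using nuc K pos by (intro mult_left_mono mult_right_mono) auto
    also have "\<dots> = 2 * K1 * K3 / c0 * (T\<^sup>2 * (nu * D))" by simp
    also have "\<dots> \<le> 2 * K1 * K3 / c0 * U" using K pos by (intro mult_left_mono U2) auto
    finally show ?thesis .
  qed
  have e: "v \<le> K4 * P + K4 / c0 * V"
  proof -
    have "T * 1 \<le> T * q" using pos by (intro mult_left_mono) auto
    also have "T * q = P" using pos by (simp add: P_def power2_eq_square power3_eq_cube)
    finally have 1: "T \<le> P" by simp
    have "T\<^sup>2 / N = T\<^sup>2 * (1 * 1 / N)" by simp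
    also have "\<dots> \<le> T ^ 3 * (q\<^sup>2 * (nu / c0) / N)"
      using T3 q2 nuc pos by (intro mult_mono divide_right_mono) auto
    also have "\<dots> = V / c0" by (simp add: V_def)
    finally have 2: "T\<^sup>2 / N \<le> V / c0" .
    have "K4 * (T + T\<^sup>2 / N) \<le> K4 * (P + V / c0)" using 1 2 K by (intro mult_left_mono) auto
    then show ?thesis using v by (simp add: algebra_simps)
  qed
  have extra: "0 \<le> 8 * CL * K1 / cl" "0 \<le> K1\<^sup>2" "0 \<le> 4 * K2 / cl" "0 \<le> 2 * K1 * K3 / c0" "0 \<le> K4 / c0"
    using pos K by auto
  have sum: "T ^ 3 * (q / T\<^sup>2 + q\<^sup>2 * nu / N + q\<^sup>2 * nu * D) = P + V + U"
    by (simp add: P_def V_def U_def algebra_simps)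
  \<comment> \<open>With the coefficients abstracted, the remaining inequality is linear in the
    products.\<close>
  define k1 k2 k3 k4 k5 where k: "k1 = 8 * CL * K1 / cl" "k2 = K1\<^sup>2" "k3 = 4 * K2 / cl" "k4 = 2 * K1 * K3 / c0" "k5 = K4 / c0"
  have ge: "k1 * U \<le> k1 * (P + V + U)" "k2 * U \<le> k2 * (P + V + U)" "k3 * V \<le> k3 * (P + V + U)"
    "k4 * U \<le> k4 * (P + V + U)" "k5 * V + K4 * P \<le> k5 * (P + V + U) + K4 * (P + V + U)"
    using extra K nn unfolding k[symmetric] by (intro mult_left_mono add_mono; simp)+
  have "2 * al * x + x\<^sup>2 + 2 * ga * y + 2 * x * z + v \<le> k1 * U + k2 * U + k3 * V + k4 * U + (k5 * V + K4 * P)"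
    using a b c d e unfolding k[symmetric] by linarith
  also have "\<dots> \<le> (k1 + k2 + k3 + k4 + K4 + k5) * (P + V + U)"
    using ge unfolding distrib_right by linarith
  finally have "2 * al * x + x\<^sup>2 + 2 * ga * y + 2 * x * z + v \<le> (k1 + k2 + k3 + k4 + K4 + k5) * (P + V + U)" .
  then have "8 * (2 * al * x + x\<^sup>2 + 2 * ga * y + 2 * x * z + v)
      \<le> 8 * ((k1 + k2 + k3 + k4 + K4 + k5) * (P + V + U))"
    by (rule mult_left_mono) simp
  then show ?thesis unfolding sum k[symmetric] by (simp only: mult.assoc[of 8])
qed

section \<open>Energies of factors and loadings, and the error bound at one sample point\<close>

context factor_sample
begin

definition S_mat :: "'w \<Rightarrow> real mat" where
  "S_mat w = mat q q (\<lambda>(l, m). (\<Sum>s=1..T. G l s w * G m s w) / (real T)\<^sup>2)"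

lemma S_mat_carrier: "S_mat w \<in> carrier_mat q q"
  by (simp add: S_mat_def)

lemma G_mat_norm:
  assumes x: "x \<in> carrier_vec q"
  shows "(G_mat T q G w *\<^sub>v x) \<bullet> (G_mat T q G w *\<^sub>v x) = (real T)\<^sup>2 * (x \<bullet> (S_mat w *\<^sub>v x))"
proof -
  have c: "G_mat T q G w *\<^sub>v x \<in> carrier_vec T" using x G_mat_carrier by (meson mult_mat_vec_carrier)
  have ix: "(G_mat T q G w *\<^sub>v x) $ a = (\<Sum>l<q. G l (a + 1) w * x $ l)" if "a < T" for a
    using that x by (simp add: G_mat_def scalar_prod_def lessThan_atLeast0)
  have "(G_mat T q G w *\<^sub>v x) \<bullet> (G_mat T q G w *\<^sub>v x)
      = (\<Sum>a<T. \<Sum>l<q. \<Sum>m<q. x $ l * x $ m * (G l (a + 1) w * G m (a + 1) w))"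
    unfolding scalar_prod_self[OF c]
    by (intro sum.cong refl) (simp add: ix power2_eq_square sum_product mult_ac)
  also have "\<dots> = (\<Sum>l<q. \<Sum>a<T. \<Sum>m<q. x $ l * x $ m * (G l (a + 1) w * G m (a + 1) w))" by (rule sum.swap)
  also have "\<dots> = (\<Sum>l<q. \<Sum>m<q. \<Sum>a<T. x $ l * x $ m * (G l (a + 1) w * G m (a + 1) w))"
    by (rule sum.cong[OF refl]) (rule sum.swap)
  also have "\<dots> = (\<Sum>l<q. \<Sum>m<q. x $ l * x $ m * (\<Sum>s=1..T. G l s w * G m s w))"
    by (simp only: sum_atLeast1_eq_lessThan sum_distrib_left)
  also have "\<dots> = (real T)\<^sup>2 * (x \<bullet> (S_mat w *\<^sub>v x))"
    unfolding quadratic_form_sum[OF S_mat_carrier x] sum_distrib_left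
    using T by (intro sum.cong refl) (simp add: S_mat_def sum_distrib_left[symmetric])
  finally show ?thesis .
qed

text \<open>The energy is T^2 times the trace of \<open>S_mat\<close>, whose q diagonal entries are
  values of its form at unit vectors.\<close>

lemma factor_energy:
  assumes u: "\<And>x. x \<in> carrier_vec q \<Longrightarrow> x \<bullet> (S_mat w *\<^sub>v x) \<le> u * (x \<bullet> x)"
  shows "(\<Sum>t=1..T. \<Sum>l<q. (G l t w)\<^sup>2) \<le> (real T)\<^sup>2 * (real q * u)"
proof -
  have "(\<Sum>t=1..T. \<Sum>l<q. (G l t w)\<^sup>2) = (\<Sum>l<q. \<Sum>t=1..T. (G l t w)\<^sup>2)" by (rule sum.swap)
  also have "\<dots> = (\<Sum>l<q. (real T)\<^sup>2 * S_mat w $$ (l, l))"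
    using T by (intro sum.cong refl) (simp add: S_mat_def power2_eq_square)
  also have "\<dots> \<le> (\<Sum>l<q. (real T)\<^sup>2 * u)"
  proof (intro sum_mono mult_left_mono)
    fix l assume "l \<in> {..<q}"
    then show "S_mat w $$ (l, l) \<le> u"
      using u[of "unit_vec q l"] quadratic_form_unit_vec[OF S_mat_carrier, of l w]
      by (simp add: scalar_prod_left_unit)
  qed simp
  finally show ?thesis by (simp add: mult_ac)
qed

lemma common_energy:
  assumes u: "\<And>x. x \<in> carrier_vec q \<Longrightarrow> x \<bullet> (Gram *\<^sub>v x) \<le> u * (x \<bullet> x)"
  shows "(\<Sum>t=1..T. ip (common w t) (common w t)) \<le> u * (\<Sum>t=1..T. \<Sum>l<q. (G l t w)\<^sup>2)"
proof -
  have "ip (common w t) (common w t) \<le> u * (\<Sum>l<q. (G l t w)\<^sup>2)" for t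
  proof -
    define x where "x = vec q (\<lambda>l. G l t w)"
    have x: "x \<in> carrier_vec q" by (simp add: x_def)
    have "ip (common w t) (common w t) = x \<bullet> (Gram *\<^sub>v x)"
      unfolding ip_common quadratic_form_sum[OF Gram_carrier x] by (simp add: x_def)
    also have "\<dots> \<le> u * (x \<bullet> x)" by (rule u[OF x])
    also have "x \<bullet> x = (\<Sum>l<q. (G l t w)\<^sup>2)" unfolding scalar_prod_self[OF x] by (simp add: x_def)
    finally show ?thesis .
  qed
  then show ?thesis unfolding sum_distrib_left by (rule sum_mono)
qed

lemma Gram_trace_le:
  assumes u: "\<And>x. x \<in> carrier_vec q \<Longrightarrow> x \<bullet> (Gram *\<^sub>v x) \<le> u * (x \<bullet> x)"
  shows "(\<Sum>l<q. Gram $$ (l, l)) \<le> real q * u"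
proof -
  have "(\<Sum>l<q. Gram $$ (l, l)) \<le> (\<Sum>l<q. u)"
  proof (rule sum_mono)
    fix l assume "l \<in> {..<q}"
    then show "Gram $$ (l, l) \<le> u"
      using u[of "unit_vec q l"] quadratic_form_unit_vec[OF Gram_carrier, of l]
      by (simp add: scalar_prod_left_unit)
  qed
  then show ?thesis by simp
qed

text \<open>The bound on \<rho> keeps the Frobenius norm of the remainder below half of the signal
  T^2 l s. The other half bounds the q-th eigenvalue from below, so \<open>fpca_error_bound\<close>
  applies with \<mu> = l s / 2.\<close>

lemma sample_error_bound:
  assumes q: "1 \<le> q" "q \<le> T" and fp: "fpca_factors T q (Omega_tilde C N T Z w) Gt"
    and s: "s > 0" "\<And>x. x \<in> carrier_vec q \<Longrightarrow> s * (x \<bullet> x) \<le> x \<bullet> (S_mat w *\<^sub>v x)"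
    and l: "l > 0" "\<And>x. x \<in> carrier_vec q \<Longrightarrow> l * (x \<bullet> x) \<le> x \<bullet> (Gram *\<^sub>v x)"
    and \<rho>: "frob2 (remainder w) \<le> \<rho>" "\<rho> \<le> ((real T)\<^sup>2 * (l * s / 2))\<^sup>2"
  shows "(\<Sum>t=1..T. (vnorm (row Gt (t - 1)
      - H_mat T (V_mat T q (Omega_tilde C N T Z w)) Gt (G_mat T q G w) Gram *\<^sub>v G_vec q G t w))\<^sup>2) / real T
    \<le> \<rho> / ((l * s / 2)\<^sup>2 * real T ^ 3)"
proof -
  let ?O = "Omega_tilde C N T Z w" and ?G = "G_mat T q G w"
  have O: "?O \<in> carrier_mat T T" "transpose_mat ?O = ?O"
    by (auto simp: Omega_tilde_def L2_inner_commute intro!: eq_matI)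
  have TT: "real T > 0" using T by simp
  have sG: "(real T)\<^sup>2 * s * (x \<bullet> x) \<le> (?G *\<^sub>v x) \<bullet> (?G *\<^sub>v x)" if "x \<in> carrier_vec q" for x
    unfolding G_mat_norm[OF that] using mult_left_mono[OF s(2)[OF that], of "(real T)\<^sup>2"] by (simp add: mult.assoc)
  have eg: "(real T)\<^sup>2 * l * s - sqrt (frob2 (remainder w)) \<le> eig ?O q"
    unfolding remainder_def
    by (rule gram_signal_eig_lower_bound[OF O G_mat_carrier Gram_carrier q s(1) sG less_imp_le[OF l(1)] l(2)])
  have ls: "l * s / 2 > 0" using l s by simp
  have "sqrt (frob2 (remainder w)) \<le> (real T)\<^sup>2 * (l * s / 2)"
    using \<rho> ls by (intro real_le_lsqrt) auto
  then have "(real T)\<^sup>2 * (l * s / 2) \<le> eig ?O q" using eg by (simp add: field_simps)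
  from fpca_error_bound[OF O G_mat_carrier Gram_carrier Gram_sym q fp ls this]
  have "(\<Sum>a<T. (vnorm (row Gt a - H_mat T (V_mat T q ?O) Gt ?G Gram *\<^sub>v row ?G a))\<^sup>2) / real T
    \<le> frob2 (remainder w) / ((l * s / 2)\<^sup>2 * real T ^ 3)" by (simp add: remainder_def)
  also have "\<dots> \<le> \<rho> / ((l * s / 2)\<^sup>2 * real T ^ 3)" using \<rho>(1) by (intro divide_right_mono) auto
  also have "(\<Sum>a<T. (vnorm (row Gt a - H_mat T (V_mat T q ?O) Gt ?G Gram *\<^sub>v row ?G a))\<^sup>2)
      = (\<Sum>t=1..T. (vnorm (row Gt (t - 1)
      - H_mat T (V_mat T q ?O) Gt ?G Gram *\<^sub>v G_vec q G t w))\<^sup>2)"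
    unfolding sum_atLeast1_eq_lessThan
  proof (rule sum.cong[OF refl])
    fix a assume "a \<in> {..<T}"
    then have "row ?G a = G_vec q G (a + 1) w" by (intro eq_vecI) (auto simp: G_mat_def G_vec_def)
    then show "(vnorm (row Gt a - H_mat T (V_mat T q ?O) Gt ?G Gram *\<^sub>v row ?G a))\<^sup>2
      = (vnorm (row Gt (a + 1 - 1) - H_mat T (V_mat T q ?O) Gt ?G Gram *\<^sub>v G_vec q G (a + 1) w))\<^sup>2" by simp
  qed
  finally show ?thesis .
qed

end

section \<open>The rate\<close>

text \<open>The eigenvalue conditions are scale invariant except for the additive errors \<open>q\<^sup>-\<^sup>\<kappa>\<close>; the fixed
  first component of \<open>W\<close> keeps \<open>\<nu>up\<close> away from zero and so provides the scale.\<close>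

lemma (in prob_space) brownian_top_eigenvalue_lower_bound:
  assumes W: "brownian_motion M q S W" and q: "q \<ge> 1" and s2: "S $$ (0, 0) = \<sigma>\<^sup>2" "\<sigma> > 0"
    and b: "0 < b" "b \<le> 1" "8 * b \<le> \<sigma>"
    and pd: "pd_mat q \<Sigma>" and ev: "\<And>x. eigenvalue \<Sigma> x \<Longrightarrow> c \<le> x \<and> x \<le> C'" and c: "c > 0"
    and A: "A \<in> events" "prob A \<ge> 1 - b\<^sup>2 / 8"
    and nu: "\<And>w. w \<in> A \<Longrightarrow> 0 \<le> eigen_nu q \<Sigma> W w q \<and> eigen_nu q \<Sigma> W w 1 \<le> u"
  shows "c * (b\<^sup>2 / 8) \<le> u"
proof -
  obtain w where w: "w \<in> A" "(LINT u|lebesgue_on {0..1}. W u w 0 * W u w 0) \<ge> b\<^sup>2 / 8"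
    using brownian_energy_lower_bound[OF W q s2 b A] by blast
  have B: "BB_integral q W w \<in> carrier_mat q q" "transpose_mat (BB_integral q W w) = BB_integral q W w"
    by (auto simp: BB_integral_def mult.commute intro!: eq_matI)
  have e: "unit_vec q 0 \<in> carrier_vec q" by simp
  \<comment> \<open>At the first unit vector the form is the energy of the first component, which is
    large at the chosen \<open>w\<close>.\<close>
  have "unit_vec q 0 \<bullet> (BB_integral q W w *\<^sub>v unit_vec q 0) \<le> u / c * (unit_vec q 0 \<bullet> unit_vec q 0)"
    by (rule sandwich_form_bounds(2)[OF pd ev B q _ _ _ c e, where l = 0])
      (use nu[OF w(1)] in \<open>auto simp: eigen_nu_def\<close>)
  moreover have "unit_vec q 0 \<bullet> (BB_integral q W w *\<^sub>v unit_vec q 0) = BB_integral q W w $$ (0, 0)"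
    using quadratic_form_unit_vec[OF B(1), of 0] q by simp
  moreover have "unit_vec q 0 \<bullet> unit_vec q 0 = (1::real)" using q by (simp add: scalar_prod_left_unit)
  moreover have "BB_integral q W w $$ (0, 0) = (LINT u|lebesgue_on {0..1}. W u w 0 * W u w 0)"
    using q by (simp add: BB_integral_def)
  ultimately have "(LINT u|lebesgue_on {0..1}. W u w 0 * W u w 0) \<le> u / c" by simp
  with w(2) have "b\<^sup>2 / 8 \<le> u / c" by (rule order_trans)
  then show ?thesis using c by (simp add: field_simps)
qed

text \<open>With the exponent 1/(2\<kappa> + 1) this yields q \<le> T eventually, the range in which
  the estimator is specified.\<close>

lemma eventually_powr_le_self:
  assumes "a < 1"
  shows "eventually (\<lambda>n. C * real n powr a \<le> real n) sequentially"
proof -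
  define X where "X = (\<bar>C\<bar> + 1) powr (1 / (1 - a))"
  have "eventually (\<lambda>n. X \<le> real n) sequentially"
    using filterlim_real_sequentially unfolding filterlim_at_top by blast
  then have "eventually (\<lambda>n. C \<le> real n powr (1 - a)) sequentially"
  proof eventually_elim
    case (elim n)
    have "C \<le> X powr (1 - a)" using assms by (simp add: X_def powr_powr)
    also have "\<dots> \<le> real n powr (1 - a)" using assms elim by (intro powr_mono2) (auto simp: X_def)
    finally show ?case .
  qed
  then show ?thesis using eventually_gt_at_top[of 0]
  proof eventually_elim
    case (elim n)
    then have "C * real n powr a \<le> real n powr (1 - a) * real n powr a" by (intro mult_right_mono) auto
    also have "\<dots> = real n" using elim by (simp add: powr_add[symmetric])
    finally show ?case .
  qed
qed

theorem proposition3p1: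
  fixes M :: "'w measure"
    and C :: "nat \<Rightarrow> 'u::euclidean_space set"
    and Cs :: "nat \<Rightarrow> 'v::euclidean_space set"
    and k :: nat and Q :: "nat \<Rightarrow> nat \<Rightarrow> nat"
    and B :: "nat \<Rightarrow> nat \<Rightarrow> 'u \<Rightarrow> 'v \<Rightarrow> real"
    and \<phi> :: "nat \<Rightarrow> nat \<Rightarrow> nat \<Rightarrow> 'v \<Rightarrow> real"
    and G \<xi> :: "nat \<Rightarrow> nat \<Rightarrow> 'w \<Rightarrow> real"
    and F \<eta> :: "nat \<Rightarrow> nat \<Rightarrow> nat \<Rightarrow> 'w \<Rightarrow> 'v \<Rightarrow> real"
    and \<epsilon> :: "nat \<Rightarrow> nat \<Rightarrow> 'w \<Rightarrow> 'u \<Rightarrow> real"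
    and Z :: "nat \<Rightarrow> nat \<Rightarrow> nat \<Rightarrow> 'w \<Rightarrow> 'u \<Rightarrow> real"
    and W :: "nat \<Rightarrow> nat \<Rightarrow> real \<Rightarrow> 'w \<Rightarrow> nat \<Rightarrow> real"
    and \<Sigma>\<Lambda> \<Sigma>\<xi> :: "nat \<Rightarrow> real mat"
    and \<nu>lo \<nu>up \<iota>lo \<delta> :: "nat \<Rightarrow> real" and \<delta>t :: "nat \<Rightarrow> nat \<Rightarrow> real"
    and \<zeta> :: "nat \<Rightarrow> nat \<Rightarrow> nat \<Rightarrow> real"
    and \<kappa> C\<^sub>B C\<^sub>\<epsilon> C\<^sub>4 C\<^sub>h c\<^sub>\<Lambda> C\<^sub>\<Lambda> :: real
    and Gt :: "nat \<Rightarrow> nat \<Rightarrow> 'w \<Rightarrow> real mat"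
  assumes prob: "prob_space M"
    \<comment> \<open>domains, dimensions\<close>
    and C: "\<And>i. i \<ge> 1 \<Longrightarrow> bounded (C i) \<and> C i \<in> sets lebesgue"
    and Cs: "\<And>j. j \<in> {1..k} \<Longrightarrow> bounded (Cs j) \<and> Cs j \<in> sets lebesgue"
    and k: "k \<ge> 1"
    and Q: "\<And>N T. Q N T \<ge> 1"
    \<comment> \<open>model: \<open>G\<close> and \<open>\<xi>\<close> are given by components, of which the first \<open>q = Q N T\<close> are used;
        \<open>\<phi>\<close>, \<open>F\<close>, \<open>\<eta>\<close>, \<open>Z\<close> may depend on \<open>q\<close>, their first argument\<close>
    and B_op: "\<And>i j. i \<ge> 1 \<Longrightarrow> j \<in> {1..k} \<Longrightarrow> L2_integral_operator (Cs j) (C i) (B i j)"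
    and basis: "\<And>N T j l. N \<ge> 1 \<Longrightarrow> T \<ge> 1 \<Longrightarrow> j \<in> {1..k} \<Longrightarrow> l < Q N T \<Longrightarrow> \<phi> (Q N T) j l \<in> L2 (Cs j)"
    and F_random: "\<And>N T j t. N \<ge> 1 \<Longrightarrow> T \<ge> 1 \<Longrightarrow> j \<in> {1..k} \<Longrightarrow> t \<ge> 1 \<Longrightarrow>
          random_L2 M (Cs j) (F (Q N T) j t)"
    and eta_random: "\<And>N T j t. N \<ge> 1 \<Longrightarrow> T \<ge> 1 \<Longrightarrow> j \<in> {1..k} \<Longrightarrow> t \<ge> 1 \<Longrightarrow>
          random_L2 M (Cs j) (\<eta> (Q N T) j t)"
    and eps_random: "\<And>i t. i \<ge> 1 \<Longrightarrow> t \<ge> 1 \<Longrightarrow> random_L2 M (C i) (\<epsilon> i t)"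
    and Z_random: "\<And>N T i t. N \<ge> 1 \<Longrightarrow> T \<ge> 1 \<Longrightarrow> i \<ge> 1 \<Longrightarrow> t \<ge> 1 \<Longrightarrow>
          random_L2 M (C i) (Z (Q N T) i t)"
    and Z_model: "\<And>N T i t. N \<ge> 1 \<Longrightarrow> T \<ge> 1 \<Longrightarrow> i \<ge> 1 \<Longrightarrow> t \<ge> 1 \<Longrightarrow>
          AE w in M. AE u in lebesgue_on (C i).
            Z (Q N T) i t w u
              = (\<Sum>j=1..k. int_op (Cs j) (B i j) (F (Q N T) j t w) u) + \<epsilon> i t w u"
    and F_model: "\<And>N T j t. N \<ge> 1 \<Longrightarrow> T \<ge> 1 \<Longrightarrow> j \<in> {1..k} \<Longrightarrow> t \<ge> 1 \<Longrightarrow>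
          AE w in M. AE v in lebesgue_on (Cs j).
            F (Q N T) j t w v
              = (\<Sum>l<Q N T. \<phi> (Q N T) j l v * G l t w) + \<eta> (Q N T) j t w v"
    and G_random: "\<And>N T l t. N \<ge> 1 \<Longrightarrow> T \<ge> 1 \<Longrightarrow> l < Q N T \<Longrightarrow> G l t \<in> borel_measurable M"
    and G_diff: "\<And>N T l t w. N \<ge> 1 \<Longrightarrow> T \<ge> 1 \<Longrightarrow> l < Q N T \<Longrightarrow> t \<ge> 1 \<Longrightarrow> w \<in> space M \<Longrightarrow>
          G l t w - G l (t - 1) w = \<xi> l t w"
    and xi_stationary: "\<And>N T. N \<ge> 1 \<Longrightarrow> T \<ge> 1 \<Longrightarrow> cov_stationary M (Q N T) \<xi>"
    and G_init: "bigO_P M NT_lim (\<lambda>(N, T) w. Max ((\<lambda>l. \<bar>G l 0 w\<bar>) ` {..<Q N T})) (\<lambda>_. 1)"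
    \<comment> \<open>estimator\<close>
    and estimator: "\<And>N T w. N \<ge> 1 \<Longrightarrow> T \<ge> 1 \<Longrightarrow> Q N T \<le> T \<Longrightarrow> w \<in> space M \<Longrightarrow>
          fpca_factors T (Q N T) (Omega_tilde C N T (Z (Q N T)) w) (Gt N T w)"
    \<comment> \<open>(a)\<close>
    and a: "C\<^sub>B > 0" "\<And>i j. i \<ge> 1 \<Longrightarrow> j \<in> {1..k} \<Longrightarrow>
          L2_opnorm (Cs j) (C i) (int_op (Cs j) (B i j)) \<le> ennreal C\<^sub>B"
    \<comment> \<open>(b)\<close>
    and kappa: "\<kappa> > 0"
    and b_pd: "0 < c\<^sub>\<Lambda>" "\<And>N T. N \<ge> 1 \<Longrightarrow> T \<ge> 1 \<Longrightarrow> pd_mat (Q N T) (\<Sigma>\<Lambda> (Q N T)) \<and>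
          (\<forall>x. eigenvalue (\<Sigma>\<Lambda> (Q N T)) x \<longrightarrow> c\<^sub>\<Lambda> \<le> x \<and> x \<le> C\<^sub>\<Lambda>)"
    and b: "(\<lambda>(N, T). mat_opnorm
            (loading_gram C N (Q N T) (Lambda k Cs B (\<phi> (Q N T))) - \<Sigma>\<Lambda> (Q N T)))
          \<in> o[NT_lim](\<lambda>(N, T). real (Q N T) powr (-\<kappa>))"
    \<comment> \<open>(c)\<close>
    and c_cov: "\<And>N T. N \<ge> 1 \<Longrightarrow> T \<ge> 1 \<Longrightarrow>
          long_run_cov M (Q N T) \<xi> (\<Sigma>\<xi> (Q N T)) \<and> pd_mat (Q N T) (\<Sigma>\<xi> (Q N T))"
    and c_BM: "\<And>N T. N \<ge> 1 \<Longrightarrow> T \<ge> 1 \<Longrightarrow> brownian_motion M (Q N T) (\<Sigma>\<xi> (Q N T)) (W N T)"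
    and c: "smallo_P M NT_lim
          (\<lambda>(N, T) w. mat_opnorm
             (mat (Q N T) (Q N T) (\<lambda>(l, m). (\<Sum>s=1..T. G l s w * G m s w) / (real T)\<^sup>2)
               - BB_integral (Q N T) (W N T) w))
          (\<lambda>(N, T). real (Q N T) powr (-\<kappa>))"
    \<comment> \<open>(d)\<close>
    and d_pos: "\<And>q. q \<ge> 1 \<Longrightarrow> \<nu>lo q > 0 \<and> \<nu>up q > 0 \<and> \<iota>lo q > 0"
    and d_prob: "((\<lambda>(N, T). measure M {w \<in> space M.
            \<nu>lo (Q N T) \<le> eigen_nu (Q N T) (\<Sigma>\<Lambda> (Q N T)) (W N T) w (Q N T) \<and>
            eigen_nu (Q N T) (\<Sigma>\<Lambda> (Q N T)) (W N T) w (Q N T)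
              < eigen_nu (Q N T) (\<Sigma>\<Lambda> (Q N T)) (W N T) w 1 \<and>
            eigen_nu (Q N T) (\<Sigma>\<Lambda> (Q N T)) (W N T) w 1 \<le> \<nu>up (Q N T) \<and>
            eigen_gap (Q N T) (\<Sigma>\<Lambda> (Q N T)) (W N T) w \<ge> \<iota>lo (Q N T)}) \<longlongrightarrow> 1) NT_lim"
    and d_ratio: "(\<lambda>(N, T). real (Q N T) powr (-\<kappa>) * (\<nu>up (Q N T) / \<nu>lo (Q N T))\<^sup>2)
          \<in> O[NT_lim](\<lambda>_. 1)"
    and d_gap: "(\<lambda>(N, T). inverse (\<iota>lo (Q N T)) * real (Q N T) powr (1 - \<kappa>) *
            \<nu>up (Q N T) powr (3/2) * \<nu>lo (Q N T) powr (-1/2)) \<in> O[NT_lim](\<lambda>_. 1)"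
    and d_q: "(\<lambda>(N, T). real (Q N T)) \<in> O[NT_lim](\<lambda>(N, T). real T powr (1 / (2 * \<kappa> + 1)))"
    \<comment> \<open>(e)\<close>
    and e_indep: "\<And>N T. N \<ge> 1 \<Longrightarrow> T \<ge> 1 \<Longrightarrow> prob_space.indep_set M
          (sigma_sets (space M) (\<Union>i\<in>{1..}. \<Union>t\<in>{1..}. L2_events M (C i) (\<epsilon> i t)))
          (sigma_sets (space M)
            ((\<Union>l\<in>{..<Q N T}. \<Union>t\<in>{1..}. real_events M (\<xi> l t)) \<union>
             (\<Union>j\<in>{1..k}. \<Union>t\<in>{1..}. L2_events M (Cs j) (\<eta> (Q N T) j t))))"
    and e_mean: "\<And>i t. i \<ge> 1 \<Longrightarrow> t \<ge> 1 \<Longrightarrow> mean_zero_L2 M (C i) (\<epsilon> i t)"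
    and e_moment: "\<And>i t. i \<ge> 1 \<Longrightarrow> t \<ge> 1 \<Longrightarrow>
          integrable M (\<lambda>w. L2_norm (C i) (\<epsilon> i t w) ^ 4) \<and>
          (LINT w|M. L2_norm (C i) (\<epsilon> i t w) ^ 4) \<le> C\<^sub>4"
    \<comment> \<open>(f)\<close>
    and f_nonneg: "\<And>t q. \<delta>t t q \<ge> 0"
    and f_eta: "\<And>N T j t. N \<ge> 1 \<Longrightarrow> T \<ge> 1 \<Longrightarrow> j \<in> {1..k} \<Longrightarrow> t \<ge> 1 \<Longrightarrow>
          integrable M (\<lambda>w. (L2_norm (Cs j) (\<eta> (Q N T) j t w))\<^sup>2) \<and>
          (LINT w|M. (L2_norm (Cs j) (\<eta> (Q N T) j t w))\<^sup>2) \<le> (\<delta>t t (Q N T))\<^sup>2"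
    and f_max: "((\<lambda>(N, T). Max ((\<lambda>t. \<delta>t t (Q N T)) ` {1..T})) \<longlongrightarrow> 0) NT_lim"
    and f_avg: "(\<lambda>(N, T). (\<Sum>t=1..T. (\<delta>t t (Q N T))\<^sup>2) / real T) \<in> O[NT_lim](\<lambda>(N, T). (\<delta> (Q N T))\<^sup>2)"
    \<comment> \<open>(g)\<close>
    and zeta: "\<And>N s t. \<zeta> N s t
          = (\<Sum>i=1..N. (LINT w|M. L2_inner (C i) (\<epsilon> i t w) (\<epsilon> i s w))) / real N"
    and g: "C\<^sub>\<epsilon> > 0"
      "\<And>N t. N \<ge> 1 \<Longrightarrow> t \<ge> 1 \<Longrightarrow> \<bar>\<zeta> N t t\<bar> \<le> C\<^sub>\<epsilon>"
      "\<And>N T t. N \<ge> 1 \<Longrightarrow> t \<in> {1..T} \<Longrightarrow> (\<Sum>s=1..T. \<bar>\<zeta> N s t\<bar>) \<le> C\<^sub>\<epsilon>"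
      "\<And>N s t. N \<ge> 1 \<Longrightarrow> s \<ge> 1 \<Longrightarrow> t \<ge> 1 \<Longrightarrow>
         (LINT w|M. (\<Sum>i=1..N. L2_inner (C i) (\<epsilon> i t w) (\<epsilon> i s w)
            - (LINT w'|M. L2_inner (C i) (\<epsilon> i t w') (\<epsilon> i s w')))\<^sup>2) \<le> C\<^sub>\<epsilon> * real N"
    \<comment> \<open>(h): the upper constant is uniform; a uniform lower constant would contradict
        the finite second moments in (e), so the lower one may depend on \<open>N\<close>, \<open>t\<close>, \<open>h\<close>\<close>
    and h: "\<And>N t h. N \<ge> 1 \<Longrightarrow> t \<ge> 1 \<Longrightarrow> (\<And>i. i \<ge> 1 \<Longrightarrow> h i \<in> L2 (C i)) \<Longrightarrow>
         (LINT w|M. (\<Sum>i=1..N. L2_inner (C i) (h i) (\<epsilon> i t w))\<^sup>2)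
             \<le> C\<^sub>h * (\<Sum>i=1..N. (L2_norm (C i) (h i))\<^sup>2) \<and>
         (\<exists>c>0. c * (\<Sum>i=1..N. (L2_norm (C i) (h i))\<^sup>2)
             \<le> (LINT w|M. (\<Sum>i=1..N. L2_inner (C i) (h i) (\<epsilon> i t w))\<^sup>2))"
    \<comment> \<open>the additional condition\<close>
    and rate_null: "(\<lambda>(N, T). rate N T (real (Q N T)) (\<nu>lo (Q N T)) (\<nu>up (Q N T)) (\<delta> (Q N T)))
          \<in> o[NT_lim](\<lambda>_. 1)"
  shows "bigO_P M NT_lim
          (\<lambda>(N, T) w. (\<Sum>t=1..T. (vnorm
              (row (Gt N T w) (t - 1)
                - H_mat T (V_mat T (Q N T) (Omega_tilde C N T (Z (Q N T)) w)) (Gt N T w)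
                    (G_mat T (Q N T) G w)
                    (loading_gram C N (Q N T) (Lambda k Cs B (\<phi> (Q N T))))
                  *\<^sub>v G_vec (Q N T) G t w))\<^sup>2) / real T)
          (\<lambda>(N, T). rate N T (real (Q N T)) (\<nu>lo (Q N T)) (\<nu>up (Q N T)) (\<delta> (Q N T)))"
proof -
  interpret prob_space M by (rule prob)
  define err where "err N T w = (\<Sum>t=1..T. (vnorm
              (row (Gt N T w) (t - 1)
                - H_mat T (V_mat T (Q N T) (Omega_tilde C N T (Z (Q N T)) w)) (Gt N T w)
                    (G_mat T (Q N T) G w)
                    (loading_gram C N (Q N T) (Lambda k Cs B (\<phi> (Q N T))))
                  *\<^sub>v G_vec (Q N T) G t w))\<^sup>2) / real T"
    for N T w
  have noise: "noise M C \<epsilon> \<zeta> C\<^sub>\<epsilon> C\<^sub>h"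
    by (intro noise.intro prob noise_axioms.intro; fact?)
      (use C e_moment h in blast)+
  have sample: "factor_sample M C \<epsilon> \<zeta> C\<^sub>\<epsilon> C\<^sub>h N T (Q N T) k Cs B (\<phi> (Q N T)) G (F (Q N T)) (\<eta> (Q N T)) (Z (Q N T)) C\<^sub>B"
    if NT: "N \<ge> 1" "T \<ge> 1" for N T
    by (intro factor_sample.intro noise factor_sample_axioms.intro NT B_op a basis F_random eta_random
        Z_random Z_model F_model f_eta[THEN conjunct1])
  have q1: "real (Q N T) \<ge> 1" for N T using Q[of N T] by simp
  \<comment> \<open>Any actual eigenvalue lies between the two constants and thereby orders
    them.\<close>
  have C\<Lambda>: "c\<^sub>\<Lambda> \<le> C\<^sub>\<Lambda>"
  proof -
    have pd: "pd_mat (Q 1 1) (\<Sigma>\<Lambda> (Q 1 1))" using b_pd(2)[of 1 1] by simp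
    then have "eigenvalue (\<Sigma>\<Lambda> (Q 1 1)) (eig (\<Sigma>\<Lambda> (Q 1 1)) (0 + 1))"
      using Q[of 1 1] by (intro eig_eigenvalue[of _ "Q 1 1"]) (auto simp: pd_mat_def)
    then show ?thesis using b_pd(2)[of 1 1] by force
  qed
  define s2 where "s2 = \<Sigma>\<xi> (Q 1 1) $$ (0, 0)"
  have s2: "s2 > 0"
  proof -
    have S: "\<Sigma>\<xi> (Q 1 1) \<in> carrier_mat (Q 1 1) (Q 1 1)"
      and pos: "\<And>v. v \<in> carrier_vec (Q 1 1) \<Longrightarrow> v \<noteq> 0\<^sub>v (Q 1 1) \<Longrightarrow> v \<bullet> (\<Sigma>\<xi> (Q 1 1) *\<^sub>v v) > 0"
      using c_cov[of 1 1] by (auto simp: pd_mat_def)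
    have "unit_vec (Q 1 1) 0 \<noteq> (0\<^sub>v (Q 1 1) :: real vec)"
    proof
      assume "unit_vec (Q 1 1) 0 = (0\<^sub>v (Q 1 1) :: real vec)"
      then have "unit_vec (Q 1 1) 0 $ 0 = (0\<^sub>v (Q 1 1) :: real vec) $ 0" by simp
      then show False using Q[of 1 1] by simp
    qed
    then show ?thesis
      using pos[of "unit_vec (Q 1 1) 0"] quadratic_form_unit_vec[OF S, of 0] Q[of 1 1] by (simp add: s2_def)
  qed
  \<comment> \<open>The corner entry is the limit of one and the same sequence, built from
    \<open>\<xi> 0\<close> alone, for all sample sizes. The variance read off at sizes (1, 1)
    therefore serves for every q.\<close>
  have s2_eq: "\<Sigma>\<xi> (Q N T) $$ (0, 0) = (sqrt s2)\<^sup>2" if "N \<ge> 1" "T \<ge> 1" for N T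
  proof -
    let ?f = "\<lambda>T. (\<Sum>t=1..T. \<Sum>s=1..T. (LINT w|M. \<xi> 0 t w * \<xi> 0 s w)) / real T"
    have "?f \<longlonglongrightarrow> \<Sigma>\<xi> (Q N T) $$ (0, 0)" if "N \<ge> 1" "T \<ge> 1" for N T
    proof -
      have "\<forall>l<Q N T. \<forall>m<Q N T. (\<lambda>T. (\<Sum>t=1..T. \<Sum>s=1..T. (LINT w|M. \<xi> l t w * \<xi> m s w)) / real T)
          \<longlonglongrightarrow> \<Sigma>\<xi> (Q N T) $$ (l, m)"
        using c_cov[OF that] unfolding long_run_cov_def by (elim conjE)
      moreover have "0 < Q N T" using Q[of N T] by simp
      ultimately show ?thesis by blast
    qed
    from LIMSEQ_unique[OF this[OF that] this[of 1 1]] show ?thesis using s2 by (simp add: s2_def)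
  qed
  \<comment> \<open>The largest value that meets the constraints of the Brownian bound for \<sigma>
    = sqrt s2.\<close>
  define b0 where "b0 = min 1 (sqrt s2 / 8)"
  have b0: "0 < b0" "b0 \<le> 1" "8 * b0 \<le> sqrt s2" using s2 by (auto simp: b0_def)
  \<comment> \<open>The lower bound for \<nu>up that
    \<open>brownian_top_eigenvalue_lower_bound\<close> will give, the same for all sample
    sizes.\<close>
  define c0 where "c0 = c\<^sub>\<Lambda> * (b0\<^sup>2 / 8)"
  have c0: "c0 > 0" using b0 b_pd(1) by (simp add: c0_def)
  define nu where "nu N T w i = eigen_nu (Q N T) (\<Sigma>\<Lambda> (Q N T)) (W N T) w i" for N T w i
  define Ev where "Ev N T = {w \<in> space M. \<nu>lo (Q N T) \<le> nu N T w (Q N T) \<and> nu N T w (Q N T) < nu N T w 1 \<and>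
      nu N T w 1 \<le> \<nu>up (Q N T) \<and> eigen_gap (Q N T) (\<Sigma>\<Lambda> (Q N T)) (W N T) w \<ge> \<iota>lo (Q N T)}" for N T
  have Ev_lim: "((\<lambda>p. measure M (Ev (fst p) (snd p))) \<longlongrightarrow> 1) NT_lim"
    using d_prob by (simp add: Ev_def nu_def split_beta')
  obtain Cd where Cd: "Cd > 0" "\<forall>\<^sub>F p in NT_lim. real (Q (fst p) (snd p)) powr (-\<kappa>)
      * (\<nu>up (Q (fst p) (snd p)) / \<nu>lo (Q (fst p) (snd p)))\<^sup>2 \<le> Cd"
    using d_ratio by (elim landau_o.bigE) (auto simp: case_prod_beta abs_mult)
  obtain cf where cf: "cf > 0" "\<forall>\<^sub>F p in NT_lim. (\<Sum>t=1..snd p. (\<delta>t t (Q (fst p) (snd p)))\<^sup>2) / real (snd p)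
      \<le> cf * (\<delta> (Q (fst p) (snd p)))\<^sup>2"
  proof -
    obtain c where c: "c > 0" "\<forall>\<^sub>F p in NT_lim. norm ((\<lambda>(N, T). (\<Sum>t=1..T. (\<delta>t t (Q N T))\<^sup>2) / real T) p)
       \<le> c * norm ((\<lambda>(N, T). (\<delta> (Q N T))\<^sup>2) p)" using f_avg by (elim landau_o.bigE)
    have "\<forall>\<^sub>F p in NT_lim. (\<Sum>t=1..snd p. (\<delta>t t (Q (fst p) (snd p)))\<^sup>2) / real (snd p)
      \<le> c * (\<delta> (Q (fst p) (snd p)))\<^sup>2"
      using c(2)
    proof eventually_elim
      case (elim p)
      then have "\<bar>(\<Sum>t=1..snd p. (\<delta>t t (Q (fst p) (snd p)))\<^sup>2) / real (snd p)\<bar>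
        \<le> c * (\<delta> (Q (fst p) (snd p)))\<^sup>2" by (simp add: case_prod_beta)
      then show ?case by (rule abs_le_D1)
    qed
    then show thesis using c(1) by (intro that)
  qed
  have q_le: "\<forall>\<^sub>F p in NT_lim. Q (fst p) (snd p) \<le> snd p"
  proof -
    obtain c where c: "c > 0" "\<forall>\<^sub>F p in NT_lim. norm ((\<lambda>(N, T). real (Q N T)) p)
       \<le> c * norm ((\<lambda>(N, T). real T powr (1 / (2 * \<kappa> + 1))) p)" using d_q by (elim landau_o.bigE)
    have "1 / (2 * \<kappa> + 1) < 1" using kappa by simp
    from eventually_compose_filterlim[OF eventually_powr_le_self[OF this, of c] filterlim_snd]
    have "\<forall>\<^sub>F p in NT_lim. c * real (snd p) powr (1 / (2 * \<kappa> + 1)) \<le> real (snd p)" by blast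
    with c(2) show ?thesis
    proof eventually_elim
      case (elim p)
      then have "real (Q (fst p) (snd p)) \<le> real (snd p)" by (simp add: case_prod_beta)
      then show ?case by simp
    qed
  qed
  have NT1: "\<forall>\<^sub>F p in NT_lim. fst p \<ge> 1 \<and> snd p \<ge> 1"
    using eventually_compose_filterlim[OF eventually_ge_at_top[of 1] filterlim_fst[of sequentially sequentially]]
      eventually_compose_filterlim[OF eventually_ge_at_top[of 1] filterlim_snd[of sequentially sequentially]]
    by eventually_elim simp
  have L_ev: "\<forall>\<^sub>F p in NT_lim. mat_opnorm (loading_gram C (fst p) (Q (fst p) (snd p))
      (Lambda k Cs B (\<phi> (Q (fst p) (snd p)))) - \<Sigma>\<Lambda> (Q (fst p) (snd p))) \<le> c\<^sub>\<Lambda> / 2"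
  proof -
    have "\<forall>\<^sub>F p in NT_lim. norm ((\<lambda>(N, T). mat_opnorm
            (loading_gram C N (Q N T) (Lambda k Cs B (\<phi> (Q N T))) - \<Sigma>\<Lambda> (Q N T))) p)
          \<le> c\<^sub>\<Lambda> / 2 * norm ((\<lambda>(N, T). real (Q N T) powr (-\<kappa>)) p)"
      using b b_pd(1) by (intro landau_o.smallD) auto
    then show ?thesis
    proof eventually_elim
      case (elim p)
      have "real (Q (fst p) (snd p)) powr (-\<kappa>) \<le> 1"
        using powr_mono[of "-\<kappa>" 0 "real (Q (fst p) (snd p))"] kappa q1[of "fst p" "snd p"] by simp
      then have "c\<^sub>\<Lambda> / 2 * real (Q (fst p) (snd p)) powr (-\<kappa>) \<le> c\<^sub>\<Lambda> / 2 * 1"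
        using b_pd(1) by (intro mult_left_mono) auto
      then show ?case using elim by (simp add: case_prod_beta)
    qed
  qed
  \<comment> \<open>Through \<open>kq_nl\<close>, the first value keeps the approximation error
    below half of the lower form bound \<open>\<nu>lo / C\<^sub>\<Lambda>\<close>. The second keeps
    it below the upper form bound \<open>\<nu>up / c\<^sub>\<Lambda>\<close>, which at most
    doubles.\<close>
  define d where "d = min (c0 / (2 * C\<^sub>\<Lambda> * Cd)) (c0 / c\<^sub>\<Lambda>)"
  have CLpos: "C\<^sub>\<Lambda> > 0" using C\<Lambda> b_pd(1) by linarith
  have d: "d > 0" using c0 CLpos Cd(1) b_pd(1) by (simp add: d_def)
  show ?thesis unfolding bigO_P_def err_def[symmetric]
  proof (intro allI impI)
    fix e :: real assume e: "e > 0"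
    \<comment> \<open>Three events share \<open>e\<close>: the remainder bound, the approximation of
      \<open>S_mat\<close> by the Brownian integral, and the eigenvalue event
      \<open>Ev\<close>.\<close>
    define e3 where "e3 = e / 3"
    have e3: "e3 > 0" using e by (simp add: e3_def)
    \<comment> \<open>\<open>K1\<close> to \<open>K4\<close> are the levels from
      \<open>remainder_event\<close> with the powers of T, N, q and \<delta> factored out;
      \<open>K5\<close> is the constant of \<open>remainder_rate_arith\<close> for them.\<close>
    define K1 where "K1 = real k * C\<^sub>B\<^sup>2 * (real k * cf / (e3 / 4))"
    define K2 where "K2 = \<bar>C\<^sub>h\<bar> * (2 * C\<^sub>\<Lambda>) / (e3 / 4)"
    define K3 where "K3 = C\<^sub>\<epsilon> / (e3 / 4)"
    define K4 where "K4 = (2 * C\<^sub>\<epsilon>\<^sup>2 + 2 * C\<^sub>\<epsilon>) / (e3 / 4)"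
    define K5 where "K5 = 8 * (8 * C\<^sub>\<Lambda> * K1 / c\<^sub>\<Lambda> + K1\<^sup>2 + 4 * K2 / c\<^sub>\<Lambda> + 2 * K1 * K3 / c0 + K4 + K4 / c0)"
    have K: "K1 \<ge> 0" "K2 \<ge> 0" "K3 \<ge> 0" "K4 > 0"
      using e3 cf(1) CLpos g(1) by (auto simp: K1_def K2_def K3_def K4_def intro!: divide_pos_pos add_pos_pos)
    have K5: "K5 > 0"
      unfolding K5_def using K CLpos b_pd(1) c0
      by (intro mult_pos_pos add_nonneg_pos add_pos_nonneg add_nonneg_nonneg) auto
    \<comment> \<open>With form bounds \<open>l = c\<^sub>\<Lambda> / 2\<close> for the loadings and
      \<open>s = \<nu>lo / (2 * C\<^sub>\<Lambda>)\<close> for the factors, half of the product is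
      \<open>m * \<nu>lo\<close>.\<close>
    define m where "m = c\<^sub>\<Lambda> / (8 * C\<^sub>\<Lambda>)"
    have m: "m > 0" using CLpos b_pd(1) by (simp add: m_def)
    \<comment> \<open>The bound 1 will give \<open>dl \<le> nup\<close>; the bound
      \<open>m\<^sup>2 / K5\<close> keeps the remainder below half of the signal.\<close>
    have rate_ev: "\<forall>\<^sub>F p in NT_lim. rate (fst p) (snd p) (real (Q (fst p) (snd p))) (\<nu>lo (Q (fst p) (snd p)))
        (\<nu>up (Q (fst p) (snd p))) (\<delta> (Q (fst p) (snd p))) \<le> min 1 (m\<^sup>2 / K5)"
    proof -
      have "\<forall>\<^sub>F p in NT_lim. norm ((\<lambda>(N, T). rate N T (real (Q N T)) (\<nu>lo (Q N T)) (\<nu>up (Q N T)) (\<delta> (Q N T))) p)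
        \<le> min 1 (m\<^sup>2 / K5) * norm (1::real)"
        using rate_null m K5 by (intro landau_o.smallD) auto
      then show ?thesis
      proof eventually_elim
        case (elim p)
        then have "\<bar>rate (fst p) (snd p) (real (Q (fst p) (snd p))) (\<nu>lo (Q (fst p) (snd p)))
            (\<nu>up (Q (fst p) (snd p))) (\<delta> (Q (fst p) (snd p)))\<bar> \<le> min 1 (m\<^sup>2 / K5)"
          by (simp add: case_prod_beta)
        then show ?case by (rule abs_le_D1)
      qed
    qed
    have S_ev: "\<forall>\<^sub>F p in NT_lim. \<exists>A\<in>sets M. measure M A \<ge> 1 - e3 \<and> (\<forall>w\<in>A. \<bar>mat_opnorm
             (mat (Q (fst p) (snd p)) (Q (fst p) (snd p))
                (\<lambda>(l, m). (\<Sum>s=1..snd p. G l s w * G m s w) / (real (snd p))\<^sup>2)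
               - BB_integral (Q (fst p) (snd p)) (W (fst p) (snd p)) w)\<bar> \<le> d * real (Q (fst p) (snd p)) powr (-\<kappa>))"
      using c[unfolded smallo_P_def, rule_format, OF d e3] by (simp add: case_prod_beta)
    \<comment> \<open>The term with \<open>e3\<close> serves the final probability and the one with
      \<open>b0\<close> the Brownian bound. Exceeding 1/2 makes the measure positive, from which
      \<open>Ev\<close> is non-empty and measurable.\<close>
    have Ev_ev: "\<forall>\<^sub>F p in NT_lim. measure M (Ev (fst p) (snd p)) > max (1 / 2) (1 - min e3 (b0\<^sup>2 / 8))"
      by (rule order_tendstoD(1)[OF Ev_lim]) (use e3 b0 in auto)
    define K0 where "K0 = K5 / m\<^sup>2"
    have main: "\<exists>A\<in>sets M. measure M A \<ge> 1 - e \<and> (\<forall>w\<in>A. \<bar>err N T w\<bar>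
          \<le> K0 * rate N T (real (Q N T)) (\<nu>lo (Q N T)) (\<nu>up (Q N T)) (\<delta> (Q N T)))"
      if NT: "N \<ge> 1" "T \<ge> 1" and qT: "Q N T \<le> T"
        and Cd': "real (Q N T) powr (-\<kappa>) * (\<nu>up (Q N T) / \<nu>lo (Q N T))\<^sup>2 \<le> Cd"
        and cf': "(\<Sum>t=1..T. (\<delta>t t (Q N T))\<^sup>2) / real T \<le> cf * (\<delta> (Q N T))\<^sup>2"
        and Lb: "mat_opnorm (loading_gram C N (Q N T) (Lambda k Cs B (\<phi> (Q N T))) - \<Sigma>\<Lambda> (Q N T)) \<le> c\<^sub>\<Lambda> / 2"
        and rb: "rate N T (real (Q N T)) (\<nu>lo (Q N T)) (\<nu>up (Q N T)) (\<delta> (Q N T)) \<le> min 1 (m\<^sup>2 / K5)"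
        and Sb: "\<exists>A\<in>sets M. measure M A \<ge> 1 - e3 \<and> (\<forall>w\<in>A. \<bar>mat_opnorm
             (mat (Q N T) (Q N T) (\<lambda>(l, m). (\<Sum>s=1..T. G l s w * G m s w) / (real T)\<^sup>2)
               - BB_integral (Q N T) (W N T) w)\<bar> \<le> d * real (Q N T) powr (-\<kappa>))"
        and Eb: "measure M (Ev N T) > max (1 / 2) (1 - min e3 (b0\<^sup>2 / 8))"
      for N T
    proof -
      define q where "q = Q N T"
      interpret fs: factor_sample M C \<epsilon> \<zeta> C\<^sub>\<epsilon> C\<^sub>h N T q k Cs B "\<phi> q" G "F q" "\<eta> q" "Z q" C\<^sub>B
        unfolding q_def by (rule sample[OF NT])
      define nl where "nl = \<nu>lo q"
      define nup where "nup = \<nu>up q"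
      define dl where "dl = (\<delta> q)\<^sup>2"
      define rt where "rt = rate N T (real q) nl nup (\<delta> q)"
      have q: "1 \<le> q" "q \<le> T" "real q \<ge> 1" using Q qT by (auto simp: q_def)
      have nlp: "nl > 0" "nup > 0" using d_pos[OF q(1)] by (auto simp: nl_def nup_def)
      have pd: "pd_mat q (\<Sigma>\<Lambda> q)" and evb: "\<And>x. eigenvalue (\<Sigma>\<Lambda> q) x \<Longrightarrow> c\<^sub>\<Lambda> \<le> x \<and> x \<le> C\<^sub>\<Lambda>"
        using b_pd(2)[OF NT] by (auto simp: q_def)
      \<comment> \<open>A set outside \<open>sets M\<close> has \<open>measure\<close> 0 by
        convention, so positive measure implies measurability.\<close>
      have Evs: "Ev N T \<in> sets M"
      proof (rule ccontr)
        assume "Ev N T \<notin> sets M"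
        then have "measure M (Ev N T) = 0" by (rule measure_notin_sets)
        then show False using Eb by simp
      qed
      have EvD: "nl \<le> nu N T w q" "nu N T w q < nu N T w 1" "nu N T w 1 \<le> nup" if "w \<in> Ev N T" for w
        using that by (auto simp: Ev_def q_def nl_def nup_def)
      have "Ev N T \<noteq> {}" using Eb by auto
      then have nlu: "nl \<le> nup" using EvD by fastforce
      have c0n: "c0 \<le> nup" unfolding c0_def
      proof (rule brownian_top_eigenvalue_lower_bound[OF _ q(1) _ _ b0 pd evb b_pd(1) Evs])
        show "brownian_motion M q (\<Sigma>\<xi> q) (W N T)" using c_BM[OF NT] by (simp add: q_def)
        show "\<Sigma>\<xi> q $$ (0, 0) = (sqrt s2)\<^sup>2" using s2_eq[OF NT] by (simp add: q_def)
        show "sqrt s2 > 0" using s2 by simp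
        show "prob (Ev N T) \<ge> 1 - b0\<^sup>2 / 8" using Eb by linarith
        show "0 \<le> eigen_nu q (\<Sigma>\<Lambda> q) (W N T) w q \<and> eigen_nu q (\<Sigma>\<Lambda> q) (W N T) w 1 \<le> nup" if "w \<in> Ev N T" for w
          using EvD[OF that] nlp by (simp add: nu_def q_def)
      qed
      define kq where "kq = real q powr (-\<kappa>)"
      have kq: "0 \<le> kq" "kq \<le> 1"
        using powr_mono[of "-\<kappa>" 0 "real q"] kappa q(3) by (auto simp: kq_def)
      \<comment> \<open>The ratio condition gives kq \<nu>up^2 \<le> Cd \<nu>lo^2, and \<nu>up^2 is
        at least \<nu>lo c0. Cancelling \<nu>lo shows that the error of order kq is at most a
        multiple of \<nu>lo.\<close>
      have kq_nl: "kq \<le> Cd * nl / c0"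
      proof -
        have "kq * (nup / nl)\<^sup>2 \<le> Cd" using Cd' by (simp add: kq_def q_def nup_def nl_def)
        then have "kq * nup\<^sup>2 \<le> Cd * nl\<^sup>2" using nlp by (simp add: power_divide field_simps)
        moreover have "kq * (nl * c0) \<le> kq * nup\<^sup>2"
          unfolding power2_eq_square using nlu c0n nlp c0 kq by (intro mult_left_mono mult_mono) auto
        ultimately have "nl * (kq * c0) \<le> nl * (Cd * nl)" by (simp add: power2_eq_square mult_ac)
        then have "kq * c0 \<le> Cd * nl" using nlp by simp
        then show ?thesis using c0 by (simp add: field_simps)
      qed
      have dk1: "d * kq \<le> nl / (2 * C\<^sub>\<Lambda>)"
      proof -
        have "d * kq \<le> c0 / (2 * C\<^sub>\<Lambda> * Cd) * (Cd * nl / c0)"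
          using d kq kq_nl c0 CLpos Cd(1) by (intro mult_mono) (auto simp: d_def)
        also have "\<dots> = nl / (2 * C\<^sub>\<Lambda>)" using c0 CLpos Cd(1) by simp
        finally show ?thesis .
      qed
      have dk2: "d * kq \<le> nup / c\<^sub>\<Lambda>"
      proof -
        have "d * kq \<le> c0 / c\<^sub>\<Lambda> * 1" using d kq c0 b_pd(1) by (intro mult_mono) (auto simp: d_def)
        also have "\<dots> \<le> nup / c\<^sub>\<Lambda>" using c0n b_pd(1) by (simp add: divide_right_mono)
        finally show ?thesis .
      qed
      have rt_eq: "rt * nl\<^sup>2 = q / (real T)\<^sup>2 + (real q)\<^sup>2 * nup / N + (real q)\<^sup>2 * nup * dl"
        using nlp by (simp add: rt_def rate_def dl_def power_int_minus power2_eq_square field_simps)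
      have rtb: "rt \<le> 1" "rt \<le> m\<^sup>2 / K5" using rb by (auto simp: rt_def q_def nl_def nup_def)
      have dl0: "dl \<ge> 0" by (simp add: dl_def)
      \<comment> \<open>Since the rate is at most 1, the \<delta> term gives nup dl \<le> nl^2 \<le>
        nup^2.\<close>
      have dln: "dl \<le> nup"
      proof -
        have "1 * nup * dl \<le> (real q)\<^sup>2 * nup * dl"
          using q(3) nlp dl0 by (intro mult_right_mono) (auto simp: power2_eq_square mult_ge1_I)
        also have "\<dots> \<le> rt * nl\<^sup>2" unfolding rt_eq using nlp by simp
        also have "\<dots> \<le> 1 * nl\<^sup>2" using rtb by (intro mult_right_mono) auto
        also have "\<dots> \<le> nup * nup" unfolding power2_eq_square using nlu nlp by (simp add: mult_mono)
        finally show ?thesis using nlp by simp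
      qed
      have Lform: "c\<^sub>\<Lambda> / 2 * (x \<bullet> x) \<le> x \<bullet> (fs.Gram *\<^sub>v x)" "x \<bullet> (fs.Gram *\<^sub>v x) \<le> 2 * C\<^sub>\<Lambda> * (x \<bullet> x)"
        if x: "x \<in> carrier_vec q" for x
      proof -
        have xx: "x \<bullet> x \<ge> 0" using x by (simp add: scalar_prod_self[of _ q] sum_nonneg)
        have Sc: "\<Sigma>\<Lambda> q \<in> carrier_mat q q" using pd by (simp add: pd_mat_def)
        have L': "mat_opnorm (fs.Gram - \<Sigma>\<Lambda> q) \<le> c\<^sub>\<Lambda> / 2" using Lb by (simp add: q_def)
        note p = quadratic_form_perturb[OF fs.Gram_carrier Sc x L'] pd_form_bounds[OF pd evb x]
        show "c\<^sub>\<Lambda> / 2 * (x \<bullet> x) \<le> x \<bullet> (fs.Gram *\<^sub>v x)" using p by (simp add: field_simps)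
        have "c\<^sub>\<Lambda> / 2 * (x \<bullet> x) \<le> C\<^sub>\<Lambda> * (x \<bullet> x)" using C\<Lambda> CLpos xx by (intro mult_right_mono) auto
        then show "x \<bullet> (fs.Gram *\<^sub>v x) \<le> 2 * C\<^sub>\<Lambda> * (x \<bullet> x)" using p by linarith
      qed
      obtain A1 where A1: "A1 \<in> sets M" "prob A1 \<ge> 1 - e3" "\<And>w. w \<in> A1 \<Longrightarrow>
          mat_opnorm (fs.S_mat w - BB_integral q (W N T) w) \<le> d * kq"
      proof -
        obtain A1 where 1: "A1 \<in> sets M" "prob A1 \<ge> 1 - e3" "\<forall>w\<in>A1. \<bar>mat_opnorm
             (fs.S_mat w - BB_integral q (W N T) w)\<bar> \<le> d * kq"
          using Sb unfolding fs.S_mat_def unfolding q_def kq_def by blast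
        show thesis by (rule that[OF 1(1,2)]) (rule abs_le_D1[OF 1(3)[rule_format]])
      qed
      have eta2: "(LINT w|M. (L2_norm (Cs j) (\<eta> q j t w))\<^sup>2) \<le> (\<delta>t t q)\<^sup>2" if "j \<in> {1..k}" "t \<ge> 1" for j t
        using f_eta[OF NT that] by (simp add: q_def)
      define xx where "xx = real k * C\<^sub>B\<^sup>2 * (real k * (\<Sum>t=1..T. (\<delta>t t q)\<^sup>2) / (e3 / 4))"
      define yy where "yy = real T * (C\<^sub>h * (\<Sum>l<q. fs.Gram $$ (l, l)) / real N) / (e3 / 4)"
      define zz where "zz = real T * C\<^sub>\<epsilon> / (e3 / 4)"
      define vv where "vv = (2 * real T * C\<^sub>\<epsilon>\<^sup>2 + 2 * (real T)\<^sup>2 * C\<^sub>\<epsilon> / real N) / (e3 / 4)"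
      from fs.remainder_event[OF e3 eta2] obtain A2 where A2: "A2 \<in> sets M" "prob A2 \<ge> 1 - e3"
        "\<And>w. w \<in> A2 \<Longrightarrow> frob2 (fs.remainder w) \<le>
          8 * (2 * (\<Sum>t=1..T. fs.ip (fs.common w t) (fs.common w t)) * xx + xx\<^sup>2
          + 2 * (\<Sum>t=1..T. \<Sum>l<q. (G l t w)\<^sup>2) * yy + 2 * xx * zz + vv)"
        unfolding xx_def yy_def zz_def vv_def by blast
      have Tp: "real T \<ge> 1" "real N \<ge> 1" using NT by auto
      have x_le: "xx \<le> K1 * T * dl"
      proof -
        have "(\<Sum>t=1..T. (\<delta>t t q)\<^sup>2) \<le> cf * dl * T"
          using cf' Tp by (simp add: q_def dl_def pos_divide_le_eq)
        then have "xx \<le> real k * C\<^sub>B\<^sup>2 * (real k * (cf * dl * T) / (e3 / 4))"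
          unfolding xx_def using e3 by (intro mult_left_mono divide_right_mono) auto
        also have "\<dots> = K1 * T * dl" by (simp add: K1_def)
        finally show ?thesis .
      qed
      have x_nn: "0 \<le> xx" using e3 by (simp add: xx_def sum_nonneg)
      have y_le: "yy \<le> K2 * T * q / N"
      proof -
        have trn: "0 \<le> (\<Sum>l<q. fs.Gram $$ (l, l))"
          by (intro sum_nonneg) (simp add: fs.Gram_index fam_inner_self_nonneg)
        have "C\<^sub>h * (\<Sum>l<q. fs.Gram $$ (l, l)) \<le> \<bar>C\<^sub>h\<bar> * (\<Sum>l<q. fs.Gram $$ (l, l))"
          using trn by (intro mult_right_mono) auto
        also have "\<dots> \<le> \<bar>C\<^sub>h\<bar> * (real q * (2 * C\<^sub>\<Lambda>))"
          by (intro mult_left_mono fs.Gram_trace_le Lform) auto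
        finally have "yy \<le> real T * (\<bar>C\<^sub>h\<bar> * (real q * (2 * C\<^sub>\<Lambda>)) / real N) / (e3 / 4)"
          unfolding yy_def using e3 by (intro mult_left_mono divide_right_mono) auto
        also have "\<dots> = K2 * T * q / N" by (simp add: K2_def mult_ac)
        finally show ?thesis .
      qed
      have z: "0 \<le> zz" "zz \<le> K3 * T" using e3 g(1) by (auto simp: zz_def K3_def mult_ac)
      have v_le: "vv \<le> K4 * (T + (real T)\<^sup>2 / N)"
      proof -
        have "2 * real T * C\<^sub>\<epsilon>\<^sup>2 + 2 * (real T)\<^sup>2 * C\<^sub>\<epsilon> / real N
            \<le> (2 * C\<^sub>\<epsilon>\<^sup>2 + 2 * C\<^sub>\<epsilon>) * (T + (real T)\<^sup>2 / N)"
          using g(1) Tp by (simp add: algebra_simps)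
        then have "vv \<le> (2 * C\<^sub>\<epsilon>\<^sup>2 + 2 * C\<^sub>\<epsilon>) * (T + (real T)\<^sup>2 / N) / (e3 / 4)"
          unfolding vv_def using e3 by (intro divide_right_mono) auto
        then show ?thesis by (simp only: K4_def times_divide_eq_left)
      qed
      define A where "A = A2 \<inter> (A1 \<inter> Ev N T)"
      have As: "A \<in> sets M" using A1 A2 Evs by (auto simp: A_def)
      have "prob A \<ge> 1 - (e3 + (e3 + e3))"
        unfolding A_def using A1 A2 Evs Eb by (intro prob_inter_ge sets.Int) auto
      then have PA: "prob A \<ge> 1 - e" by (simp add: e3_def)
      have bound: "err N T w \<le> K0 * rt" if wA: "w \<in> A" for w
      proof -
        have w: "w \<in> space M" using wA As sets.sets_into_space by blast
        have wE: "w \<in> Ev N T" "w \<in> A1" "w \<in> A2" using wA by (auto simp: A_def)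
        have BBc: "BB_integral q (W N T) w \<in> carrier_mat q q"
          "transpose_mat (BB_integral q (W N T) w) = BB_integral q (W N T) w"
          by (auto simp: BB_integral_def mult.commute intro!: eq_matI)
        have eb: "nl \<le> eig (psd_sqrt (\<Sigma>\<Lambda> q) * BB_integral q (W N T) w * psd_sqrt (\<Sigma>\<Lambda> q)) q"
          "eig (psd_sqrt (\<Sigma>\<Lambda> q) * BB_integral q (W N T) w * psd_sqrt (\<Sigma>\<Lambda> q)) 1 \<le> nup"
          using EvD[OF wE(1)] by (auto simp: nu_def eigen_nu_def q_def)
        have Sform: "nl / (2 * C\<^sub>\<Lambda>) * (x \<bullet> x) \<le> x \<bullet> (fs.S_mat w *\<^sub>v x)"
          "x \<bullet> (fs.S_mat w *\<^sub>v x) \<le> 2 * nup / c\<^sub>\<Lambda> * (x \<bullet> x)" if x: "x \<in> carrier_vec q" for x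
        proof -
          have xx: "x \<bullet> x \<ge> 0" using x by (simp add: scalar_prod_self[of _ q] sum_nonneg)
          have "nl / C\<^sub>\<Lambda> * (x \<bullet> x) \<le> x \<bullet> (BB_integral q (W N T) w *\<^sub>v x)"
            by (rule sandwich_form_bounds(1)[OF pd evb BBc q(1) eb(1) less_imp_le[OF nlp(1)] eb(2) b_pd(1) x])
          moreover have "x \<bullet> (BB_integral q (W N T) w *\<^sub>v x) \<le> nup / c\<^sub>\<Lambda> * (x \<bullet> x)"
            by (rule sandwich_form_bounds(2)[OF pd evb BBc q(1) eb(1) less_imp_le[OF nlp(1)] eb(2) b_pd(1) x])
          moreover note quadratic_form_perturb[OF fs.S_mat_carrier BBc(1) x A1(3)[OF wE(2)]]
          ultimately have p: "nl / C\<^sub>\<Lambda> * (x \<bullet> x) - d * kq * (x \<bullet> x) \<le> x \<bullet> (fs.S_mat w *\<^sub>v x)"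
            "x \<bullet> (fs.S_mat w *\<^sub>v x) \<le> nup / c\<^sub>\<Lambda> * (x \<bullet> x) + d * kq * (x \<bullet> x)" by linarith+
          have "nl / C\<^sub>\<Lambda> * (x \<bullet> x) - nl / (2 * C\<^sub>\<Lambda>) * (x \<bullet> x) \<le> x \<bullet> (fs.S_mat w *\<^sub>v x)"
            by (rule order_trans[OF diff_left_mono[OF mult_right_mono[OF dk1 xx]] p(1)])
          then show "nl / (2 * C\<^sub>\<Lambda>) * (x \<bullet> x) \<le> x \<bullet> (fs.S_mat w *\<^sub>v x)" by (simp add: field_simps)
          have "x \<bullet> (fs.S_mat w *\<^sub>v x) \<le> nup / c\<^sub>\<Lambda> * (x \<bullet> x) + nup / c\<^sub>\<Lambda> * (x \<bullet> x)"
            by (rule order_trans[OF p(2) add_left_mono[OF mult_right_mono[OF dk2 xx]]])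
          then show "x \<bullet> (fs.S_mat w *\<^sub>v x) \<le> 2 * nup / c\<^sub>\<Lambda> * (x \<bullet> x)" by (simp add: field_simps)
        qed
        define ga where "ga = (\<Sum>t=1..T. \<Sum>l<q. (G l t w)\<^sup>2)"
        define al where "al = (\<Sum>t=1..T. fs.ip (fs.common w t) (fs.common w t))"
        have ga: "0 \<le> ga" "ga \<le> (real T)\<^sup>2 * (2 * real q * nup / c\<^sub>\<Lambda>)"
          using fs.factor_energy[OF Sform(2)] by (simp_all add: ga_def sum_nonneg mult_ac)
        have al: "0 \<le> al" "al \<le> 2 * C\<^sub>\<Lambda> * ga"
          using fs.common_energy[OF Lform(2)] by (simp_all add: al_def ga_def sum_nonneg fam_inner_self_nonneg)
        define \<rho> where "\<rho> = K5 * (real T ^ 3 * (rt * nl\<^sup>2))"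
        have "frob2 (fs.remainder w) \<le> 8 * (2 * al * xx + xx\<^sup>2 + 2 * ga * yy + 2 * xx * zz + vv)"
          using A2(3)[OF wE(3)] by (simp only: al_def ga_def)
        also have "\<dots> \<le> \<rho>" unfolding \<rho>_def K5_def rt_eq
          by (rule remainder_rate_arith[OF Tp q(3) c0 c0n b_pd(1) CLpos dl0 dln K(1-3) less_imp_le[OF K(4)]
                ga al x_nn x_le y_le z v_le])
        finally have fr: "frob2 (fs.remainder w) \<le> \<rho>" .
        have ml: "c\<^sub>\<Lambda> / 2 * (nl / (2 * C\<^sub>\<Lambda>)) / 2 = m * nl" by (simp add: m_def)
        \<comment> \<open>\<rho> grows like T^3 and the squared signal like T^4, so the constants
          settle the comparison through K5 rt \<le> m^2.\<close>
        have \<rho>b: "\<rho> \<le> ((real T)\<^sup>2 * (m * nl))\<^sup>2"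
        proof -
          have "K5 * rt \<le> m\<^sup>2" using rtb(2) K5 by (simp add: field_simps)
          then have "(K5 * rt) * (real T ^ 3 * nl\<^sup>2) \<le> m\<^sup>2 * (real T ^ 3 * nl\<^sup>2)" by (intro mult_right_mono) auto
          also have "\<dots> \<le> m\<^sup>2 * (real T ^ 4 * nl\<^sup>2)"
            using Tp by (intro mult_left_mono mult_right_mono power_increasing) auto
          also have "\<dots> = ((real T)\<^sup>2 * (m * nl))\<^sup>2" by (simp add: power_mult_distrib flip: power_mult)
          finally show ?thesis by (simp add: \<rho>_def mult_ac)
        qed
        have fp: "fpca_factors T q (Omega_tilde C N T (Z q) w) (Gt N T w)"
          using estimator[OF NT qT w] by (simp add: q_def)
        have "err N T w \<le> \<rho> / ((c\<^sub>\<Lambda> / 2 * (nl / (2 * C\<^sub>\<Lambda>)) / 2)\<^sup>2 * real T ^ 3)"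
          unfolding err_def q_def[symmetric]
        proof (rule fs.sample_error_bound[OF q(1,2) fp _ Sform(1) _ Lform(1) fr])
          show "nl / (2 * C\<^sub>\<Lambda>) > 0" "c\<^sub>\<Lambda> / 2 > 0" using nlp CLpos b_pd(1) by simp_all
          show "\<rho> \<le> ((real T)\<^sup>2 * (c\<^sub>\<Lambda> / 2 * (nl / (2 * C\<^sub>\<Lambda>)) / 2))\<^sup>2" unfolding ml by (rule \<rho>b)
        qed
        also have "\<dots> = K0 * rt"
          unfolding ml \<rho>_def K0_def using nlp m Tp by (simp add: power_mult_distrib field_simps)
        finally show ?thesis .
      qed
      show ?thesis
      proof (intro bexI[OF _ As] conjI ballI PA)
        fix w assume w: "w \<in> A"
        have "0 \<le> err N T w" unfolding err_def by (intro divide_nonneg_nonneg sum_nonneg) auto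
        then show "\<bar>err N T w\<bar> \<le> K0 * rate N T (real (Q N T)) (\<nu>lo (Q N T)) (\<nu>up (Q N T)) (\<delta> (Q N T))"
          using bound[OF w] unfolding rt_def nl_def nup_def q_def by simp
      qed
    qed
    have "\<forall>\<^sub>F p in NT_lim. \<exists>A\<in>sets M. measure M A \<ge> 1 - e \<and> (\<forall>w\<in>A. \<bar>(\<lambda>(N, T) w. err N T w) p w\<bar>
          \<le> K0 * (\<lambda>(N, T). rate N T (real (Q N T)) (\<nu>lo (Q N T)) (\<nu>up (Q N T)) (\<delta> (Q N T))) p)"
      using NT1 q_le Cd(2) cf(2) L_ev rate_ev S_ev Ev_ev
    proof eventually_elim
      case (elim p)
      then show ?case using main[of "fst p" "snd p"] unfolding case_prod_beta by blast
    qed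
    then show "\<exists>K. \<forall>\<^sub>F p in NT_lim. \<exists>A\<in>sets M. measure M A \<ge> 1 - e \<and> (\<forall>w\<in>A. \<bar>(\<lambda>(N, T) w. err N T w) p w\<bar>
          \<le> K * (\<lambda>(N, T). rate N T (real (Q N T)) (\<nu>lo (Q N T)) (\<nu>up (Q N T)) (\<delta> (Q N T))) p)" by blast
  qed
qed

end
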